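(* Let $\alpha>-1$, $1<p,q<\infty$, $0<\delta<1$, and let $\{z_{l,j}\}_{l,j\in\mathbb{Z}}$, $z_{l,j}=\frac{\delta^2}{4}l\,2^{\gamma j-1}+i2^{\gamma j}$, be the associated $\delta$-lattice. Let $\Phi\in\mathscr{L}\cup\mathscr{U}$, let $\vec{\varepsilon}\in\{0,1\}^2$, put $\omega=\mathcal{T}_\Phi^{\vec{\varepsilon}}$, and let $k\in\mathbb{R}$. Then the following assertions are satisfied. (a) For any sequence of complex numbers $\{\lambda_{l,j}\}_{l,j\in\mathbb{Z}}$ such that $$\sum_{j\in\mathbb{Z}}\left(\sum_{l\in\mathbb{Z}}|\lambda_{l,j}|^p\right)^{\frac qp}\omega^k(2^{\gamma j})2^{\gamma j(\alpha+1+\frac qp)}<\infty,$$ the series $\sum_{l,j}\lambda_{l,j}2^{\gamma j(\alpha+2)}K_\alpha(z,z_{l,j})$ is convergent in $A^{p,q}_{\omega^k,\alpha}(\mathbb{C}_+)$. Moreover, its sum $F$ satisfies $$\|F\|^q_{A^{p,q}_{\omega^k,\alpha}}\le C_\delta\sum_{j}\left(\sum_{l}|\lambda_{l,j}|^p\right)^{\frac qp}\omega^k(2^{\gamma j})2^{\gamma j(\alpha+1+\frac qp)},$$ where $C_\delta$ does not depend on the sequence $\{\lambda_{l,j}\}$. (b) If $\delta$ is small enough, then any function $F\in A^{p,q}_{\omega^k,\alpha}(\mathbb{C}_+)$ may be represented as $$F(z)=\sum_{l,j}\lambda_{l,j}2^{\gamma j(\alpha+2)}K_\alpha(z,z_{l,j})$$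 with $$\sum_{j}\left(\sum_{l}|\lambda_{l,j}|^p\right)^{\frac qp}\omega^k(2^{\gamma j})2^{\gamma j(\alpha+1+\frac qp)}\le C_\delta\|F\|^q_{A^{p,q}_{\omega^k,\alpha}},$$ where $C_\delta$ does not depend on $F$.
   Context: $\mathbb{C}_+=\{z\in\mathbb{C}:\operatorname{Im} z>0\}$. $K_\alpha(z,w)=\frac{c_\alpha}{(z-\bar w)^{2+\alpha}}$ is the Bergman kernel, $c_\alpha$ being the constant depending only on $\alpha$ for which $f\mapsto\int_{\mathbb{C}_+}K_\alpha(\cdot,w)f(w)(\operatorname{Im} w)^\alpha dV(w)$ is the orthogonal projection of $L^2(\mathbb{C}_+,(\operatorname{Im} w)^\alpha dV(w))$ onto its closed subspace of holomorphic functions ($dV$ is Lebesgue measure). Lattice: for $0<\delta<1$, $\gamma$ is a fixed real number such that $$\frac{\log\left(\frac{1+\delta^2/20}{1-\delta^2/20}\right)}{4\log2}<\gamma<\frac{\log\left(\frac{1+\delta^2/4}{1-\delta^2/4}\right)}{4\log2}.$$ Growth functions and weights: a growth function is a continuous, nondecreasing, onto function $\Phi:[0,\infty)\to[0,\infty)$, not identically null. For $r>0$, $\Phi$ is of upper-type $r$ (resp. lower-type $r$) if there is $C_r>0$ such that for all $t\ge 1$ (resp. all $0<t\le 1$) and all $s>0$, $\Phi(st)\le C_r t^r\Phi(s)$. $\mathscr{U}^r$ ($r\ge1$) is the set of growth functions of upper-type $r$ such that $t\mapsto\Phi(t)/t$ is nondecreasing on $(0,\infty)$; $\mathscr{L}_r$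 ($0<r\le1$) is the set of growth functions of lower-type $r$ such that $t\mapsto\Phi(t)/t$ is nonincreasing on $(0,\infty)$. $\mathscr{U}=\bigcup_{r\ge1}\mathscr{U}^r$, $\mathscr{L}=\bigcup_{0<r\le1}\mathscr{L}_r$. For $\vec{\varepsilon}=(\varepsilon_1,\varepsilon_2)\in\{0,1\}^2$ and $t>0$, $\mathcal{T}_\Phi^{\vec{\varepsilon}}(t)=1+\varepsilon_1\ln_+(\Phi(1/t))+\varepsilon_2\ln_+(\Phi(t))$, where $\ln_+=\max(\ln,0)$. Spaces: $A^{p,q}_{\omega^k,\alpha}(\mathbb{C}_+)$ is the space of holomorphic functions $f$ on $\mathbb{C}_+$ such that $\|f\|^q_{A^{p,q}_{\omega^k,\alpha}}:=\int_0^\infty\left(\int_{\mathbb{R}}|f(x+iy)|^p\,dx\right)^{q/p}\omega^k(y)y^\alpha\,dy<\infty$. *)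

theory Defs
  imports "HOL-Analysis.Analysis"
begin

definition upper_half_plane :: "complex set" where
  "upper_half_plane = {z. Im z > 0}"

subsection \<open>The Bergman kernel\<close>

definition bergman_measure :: "real \<Rightarrow> complex measure" where
  "bergman_measure \<alpha> =
     density (restrict_space lborel upper_half_plane) (\<lambda>w. ennreal (Im w powr \<alpha>))"

definition square_integrable_fun :: "'a measure \<Rightarrow> ('a \<Rightarrow> complex) \<Rightarrow> bool" where
  "square_integrable_fun M f \<longleftrightarrow>
     f \<in> borel_measurable M \<and> integrable M (\<lambda>w. (norm (f w))\<^sup>2)"

definition bergman_A2 :: "real \<Rightarrow> (complex \<Rightarrow> complex) set" where
  "bergman_A2 \<alpha> =
     {f. f holomorphic_on upper_half_plane \<and> square_integrable_fun (bergman_measure \<alpha>) f}"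

text \<open>The operator is the orthogonal projection: its value lies in the closed subspace, and
  the difference to the argument is orthogonal to that subspace.\<close>

definition is_bergman_projection :: "real \<Rightarrow> ((complex \<Rightarrow> complex) \<Rightarrow> (complex \<Rightarrow> complex)) \<Rightarrow> bool" where
  "is_bergman_projection \<alpha> P \<longleftrightarrow>
     (\<forall>f. square_integrable_fun (bergman_measure \<alpha>) f \<longrightarrow>
        P f \<in> bergman_A2 \<alpha> \<and>
        (\<forall>g \<in> bergman_A2 \<alpha>. (LINT w|bergman_measure \<alpha>. (f w - P f w) * cnj (g w)) = 0))"

text \<open>For \<open>z\<close> and \<open>w\<close> in the upper half-plane so is \<open>z - cnj w\<close>; the power is the principal
  branch there. A different holomorphic branch on the upper half-plane would only change the
  normalising constant below, not the kernel.\<close>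

definition kernel_with_const :: "complex \<Rightarrow> real \<Rightarrow> complex \<Rightarrow> complex \<Rightarrow> complex" where
  "kernel_with_const c \<alpha> z w = c / (z - cnj w) powr of_real (2 + \<alpha>)"

definition bergman_const :: "real \<Rightarrow> complex" where
  "bergman_const \<alpha> =
     (THE c. is_bergman_projection \<alpha>
        (\<lambda>f z. LINT w|bergman_measure \<alpha>. kernel_with_const c \<alpha> z w * f w))"

definition bergman_kernel :: "real \<Rightarrow> complex \<Rightarrow> complex \<Rightarrow> complex" where
  "bergman_kernel \<alpha> = kernel_with_const (bergman_const \<alpha>) \<alpha>"

subsection \<open>The lattice\<close>

definition admissible_gamma :: "real \<Rightarrow> real \<Rightarrow> bool" where
  "admissible_gamma \<delta> \<gamma> \<longleftrightarrow>
     ln ((1 + \<delta>\<^sup>2 / 20) / (1 - \<delta>\<^sup>2 / 20)) / (4 * ln 2) < \<gamma> \<and>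
     \<gamma> < ln ((1 + \<delta>\<^sup>2 / 4) / (1 - \<delta>\<^sup>2 / 4)) / (4 * ln 2)"

definition lattice_point :: "real \<Rightarrow> real \<Rightarrow> int \<Rightarrow> int \<Rightarrow> complex" where
  "lattice_point \<delta> \<gamma> l j =
     Complex (\<delta>\<^sup>2 / 4 * of_int l * 2 powr (\<gamma> * of_int j - 1)) (2 powr (\<gamma> * of_int j))"

subsection \<open>Growth functions and weights\<close>

definition growth_function :: "(real \<Rightarrow> real) \<Rightarrow> bool" where
  "growth_function \<Phi> \<longleftrightarrow>
     continuous_on {0..} \<Phi> \<and> mono_on {0..} \<Phi> \<and> \<Phi> ` {0..} = {0..} \<and> (\<exists>t\<ge>0. \<Phi> t \<noteq> 0)"

definition upper_type :: "real \<Rightarrow> (real \<Rightarrow> real) \<Rightarrow> bool" where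
  "upper_type r \<Phi> \<longleftrightarrow> (\<exists>C>0. \<forall>t\<ge>1. \<forall>s>0. \<Phi> (s * t) \<le> C * t powr r * \<Phi> s)"

definition lower_type :: "real \<Rightarrow> (real \<Rightarrow> real) \<Rightarrow> bool" where
  "lower_type r \<Phi> \<longleftrightarrow> (\<exists>C>0. \<forall>t. 0 < t \<and> t \<le> 1 \<longrightarrow> (\<forall>s>0. \<Phi> (s * t) \<le> C * t powr r * \<Phi> s))"

definition upper_growth_type :: "real \<Rightarrow> (real \<Rightarrow> real) set" where
  "upper_growth_type r =
     {\<Phi>. growth_function \<Phi> \<and> upper_type r \<Phi> \<and> mono_on {0<..} (\<lambda>t. \<Phi> t / t)}"

definition lower_growth_type :: "real \<Rightarrow> (real \<Rightarrow> real) set" where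
  "lower_growth_type r =
     {\<Phi>. growth_function \<Phi> \<and> lower_type r \<Phi> \<and> antimono_on {0<..} (\<lambda>t. \<Phi> t / t)}"

definition upper_growth :: "(real \<Rightarrow> real) set" where
  "upper_growth = (\<Union>r\<in>{1..}. upper_growth_type r)"

definition lower_growth :: "(real \<Rightarrow> real) set" where
  "lower_growth = (\<Union>r\<in>{0<..1}. lower_growth_type r)"

definition ln_plus :: "real \<Rightarrow> real" where
  "ln_plus x = max (ln x) 0"

definition log_weight :: "(real \<Rightarrow> real) \<Rightarrow> nat \<Rightarrow> nat \<Rightarrow> real \<Rightarrow> real" where
  "log_weight \<Phi> \<epsilon>1 \<epsilon>2 t =
     1 + of_nat \<epsilon>1 * ln_plus (\<Phi> (1 / t)) + of_nat \<epsilon>2 * ln_plus (\<Phi> t)"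

subsection \<open>Weighted mixed norm spaces\<close>

text \<open>Only used with exponent \<open>r > 0\<close>.\<close>

definition ennreal_powr :: "ennreal \<Rightarrow> real \<Rightarrow> ennreal" where
  "ennreal_powr x r = (if x = \<infinity> then \<infinity> else ennreal (enn2real x powr r))"

text \<open>The \<open>q\<close>-th power of the norm, with values in \<open>[0,\<infinity>]\<close>.\<close>

definition mixed_norm_pow ::
    "real \<Rightarrow> real \<Rightarrow> (real \<Rightarrow> real) \<Rightarrow> real \<Rightarrow> real \<Rightarrow> (complex \<Rightarrow> complex) \<Rightarrow> ennreal" where
  "mixed_norm_pow p q \<omega> k \<alpha> f =
     (\<integral>\<^sup>+y\<in>{0<..}. ennreal_powr (\<integral>\<^sup>+x. ennreal (norm (f (Complex x y)) powr p) \<partial>lborel) (q / p)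
        * ennreal (\<omega> y powr k * y powr \<alpha>) \<partial>lborel)"

definition mixed_bergman ::
    "real \<Rightarrow> real \<Rightarrow> (real \<Rightarrow> real) \<Rightarrow> real \<Rightarrow> real \<Rightarrow> (complex \<Rightarrow> complex) set" where
  "mixed_bergman p q \<omega> k \<alpha> =
     {f. f holomorphic_on upper_half_plane \<and> mixed_norm_pow p q \<omega> k \<alpha> f < \<infinity>}"

text \<open>Unconditional convergence in norm of a series indexed by \<open>I\<close>, to a sum in the space
  (\<open>has_sum\<close> for the norm topology).\<close>

definition sums_in_mixed_bergman ::
    "real \<Rightarrow> real \<Rightarrow> (real \<Rightarrow> real) \<Rightarrow> real \<Rightarrow> real \<Rightarrow> ('i \<Rightarrow> complex \<Rightarrow> complex) \<Rightarrow> 'i set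
       \<Rightarrow> (complex \<Rightarrow> complex) \<Rightarrow> bool" where
  "sums_in_mixed_bergman p q \<omega> k \<alpha> u I F \<longleftrightarrow>
     (\<forall>i\<in>I. u i \<in> mixed_bergman p q \<omega> k \<alpha>) \<and> F \<in> mixed_bergman p q \<omega> k \<alpha> \<and>
     ((\<lambda>S. mixed_norm_pow p q \<omega> k \<alpha> (\<lambda>z. F z - (\<Sum>i\<in>S. u i z))) \<longlongrightarrow> 0)
       (finite_subsets_at_top I)"

text \<open>The \<open>q\<close>-th power of the norm of a coefficient family, with values in \<open>[0,\<infinity>]\<close>.\<close>

definition coeff_norm_pow ::
    "real \<Rightarrow> real \<Rightarrow> (real \<Rightarrow> real) \<Rightarrow> real \<Rightarrow> real \<Rightarrow> real \<Rightarrow> (int \<Rightarrow> int \<Rightarrow> complex) \<Rightarrow> ennreal" where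
  "coeff_norm_pow p q \<omega> k \<alpha> \<gamma> \<mu> =
     (\<Sum>\<^sub>\<infinity>j\<in>UNIV. ennreal_powr (\<Sum>\<^sub>\<infinity>l\<in>UNIV. ennreal (norm (\<mu> l j) powr p)) (q / p)
        * ennreal (\<omega> (2 powr (\<gamma> * of_int j)) powr k
                   * 2 powr (\<gamma> * of_int j * (\<alpha> + 1 + q / p))))"

definition atom_term ::
    "real \<Rightarrow> real \<Rightarrow> real \<Rightarrow> (int \<Rightarrow> int \<Rightarrow> complex) \<Rightarrow> int \<times> int \<Rightarrow> complex \<Rightarrow> complex" where
  "atom_term \<alpha> \<delta> \<gamma> \<mu> = (\<lambda>(l, j) z.
     \<mu> l j * of_real (2 powr (\<gamma> * of_int j * (\<alpha> + 2)))
       * bergman_kernel \<alpha> z (lattice_point \<delta> \<gamma> l j))"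

end

theory Submission
  imports Defs "HOL-Complex_Analysis.Complex_Analysis"
begin

text \<open>In coordinates relative to \<open>z\<close>, the integral operator with the modulus of the Bergman
  kernel is an average of horizontal translates and of dilates of its argument. Translations are
  isometries of the mixed norm, and a dilation by \<open>t\<close> has norm at most a constant times its
  unweighted norm times a small power of \<open>max t (1 / t)\<close>, because a logarithmic weight varies more
  slowly than any power. Minkowski's integral inequality therefore bounds the operator on the mixed
  norm space, without interpolation.

  Under the Cayley transform centred at \<open>z\<close> the reproducing integral becomes, up to a holomorphic
  factor, the integral of a holomorphic function against a radial weight on the disc. The mean value
  property then gives the reproducing formula for every function in the space and identifies the
  normalising constant of the projection.

  Each atom is dominated by the positive operator applied to the indicator of its lattice cell, which
  gives (a). For (b), the reproducing integral of \<open>F\<close> is replaced by the sum over the cells whose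
  coefficients are the weighted integrals of \<open>F\<close> over the cells. The kernel varies little on small
  cells, so the error has at most half the norm of \<open>F\<close>, and a Neumann series removes it.\<close>

subsection \<open>Powers and integral inequalities\<close>

text \<open>Estimates are made first for \<open>[0,\<infinity>]\<close>-valued functions, so that
  questions of convergence become finiteness of \<open>PP\<close>. A finite mixed norm gives finite
  values of \<open>PP\<close> at every point, because the modulus of the kernel satisfies a Harnack
  inequality; hence atomic series and reproducing integrals converge pointwise, and their sums are
  identified pointwise. The condition \<open>1 < q\<close> lets the averaging kernel beat the
  dilation norms: dilation by \<open>t\<close> has norm about
  \<open>t powr (- (1 + \<alpha>) / q)\<close>, which is integrable against
  \<open>t powr \<alpha>\<close> near zero exactly when \<open>q > 1\<close>, with room left for a
  small power from the weight. The case \<open>p = q = 2\<close> with weight one is an instance of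
  the same theory. It supplies the boundedness on \<open>L2\<close> behind the projection and the
  masses of the lattice cells. Smallness of \<open>\<delta>\<close> enters only through the relative
  size \<open>\<eta>\<close> of a cell. Its threshold depends on the operator norm of
  \<open>PP\<close>, which is fixed before the lattice is chosen, so there is no
  circularity.\<close>

lemma ennreal_powr_ennreal [simp]:
  "0 \<le> a \<Longrightarrow> ennreal_powr (ennreal a) r = ennreal (a powr r)"
  by (simp add: ennreal_powr_def)

lemma ennreal_powr_top [simp]: "ennreal_powr top r = top"
  by (simp add: ennreal_powr_def)

lemma ennreal_powr_0 [simp]: "ennreal_powr 0 r = 0"
  by (simp add: ennreal_powr_def)

lemma ennreal_powr_1 [simp]: "ennreal_powr x 1 = x"
  by (cases x) (auto simp: ennreal_powr_def)

lemma ennreal_powr_one [simp]: "ennreal_powr 1 r = 1"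
  using ennreal_powr_ennreal[of 1 r] by simp

lemma ennreal_powr_mono:
  assumes "x \<le> y" "0 \<le> r"
  shows "ennreal_powr x r \<le> ennreal_powr y r"
proof (cases y)
  case (real b)
  then obtain a where "0 \<le> a" "x = ennreal a"
    using assms(1) by (cases x) (auto simp: top_unique)
  then show ?thesis
    using real assms by (auto intro!: ennreal_leI powr_mono2)
qed simp

lemma ennreal_powr_powr:
  "ennreal_powr (ennreal_powr x r) s = ennreal_powr x (r * s)"
  by (cases x) (auto simp: powr_powr)

lemma ennreal_powr_eq_0_iff [simp]: "ennreal_powr x r = 0 \<longleftrightarrow> x = 0"
  by (cases x) (auto simp: ennreal_eq_0_iff)

lemma ennreal_powr_eq_top_iff [simp]: "ennreal_powr x r = top \<longleftrightarrow> x = top"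
  by (cases x) auto

lemma ennreal_powr_less_top_iff [simp]: "ennreal_powr x r < top \<longleftrightarrow> x < top"
  using ennreal_powr_eq_top_iff[of x r] by (metis less_top)

text \<open>Holds for every exponent because \<open>0\<close> and \<open>top\<close> are fixed by
  every power, which agrees with \<open>0 * top = 0\<close>.\<close>

lemma ennreal_powr_mult:
  "ennreal_powr (x * y) r = ennreal_powr x r * ennreal_powr y r"
proof (cases x; cases y)
  fix a b assume "0 \<le> a" "x = ennreal a" "0 \<le> b" "y = ennreal b"
  then show ?thesis
    by (simp add: ennreal_mult[symmetric] powr_mult)
next
  fix a assume *: "0 \<le> a" "x = ennreal a" "y = top"
  then show ?thesis
    by (cases "a = 0") (auto simp: ennreal_mult_top ennreal_eq_0_iff)
next
  fix a assume *: "0 \<le> a" "y = ennreal a" "x = top"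
  then show ?thesis
    by (cases "a = 0") (auto simp: ennreal_top_mult ennreal_eq_0_iff)
qed simp

lemma ennreal_powr_le_iff:
  assumes "0 < r"
  shows "ennreal_powr x r \<le> ennreal_powr y r \<longleftrightarrow> x \<le> y"
proof
  assume "ennreal_powr x r \<le> ennreal_powr y r"
  then have "ennreal_powr (ennreal_powr x r) (1 / r) \<le> ennreal_powr (ennreal_powr y r) (1 / r)"
    using assms by (rule_tac ennreal_powr_mono) auto
  moreover have "r * (1 / r) = 1" using assms by simp
  ultimately show "x \<le> y"
    unfolding ennreal_powr_powr by simp
qed (use assms in \<open>simp add: ennreal_powr_mono\<close>)

lemma borel_measurable_ennreal_powr [measurable]:
  assumes "f \<in> borel_measurable M"
  shows "(\<lambda>x. ennreal_powr (f x) r) \<in> borel_measurable M"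
  unfolding ennreal_powr_def using assms by measurable

lemma tendsto_ennreal_powr_0:
  assumes "(f \<longlongrightarrow> 0) F" "0 < r"
  shows "((\<lambda>x. ennreal_powr (f x) r) \<longlongrightarrow> 0) F"
proof (rule order_tendstoI)
  fix a :: ennreal assume "0 < a"
  show "\<forall>\<^sub>F x in F. ennreal_powr (f x) r < a"
  proof -
    have "0 < ennreal_powr a (1 / r)"
      using \<open>0 < a\<close> by (metis ennreal_powr_eq_0_iff zero_less_iff_neq_zero)
    then have "\<forall>\<^sub>F x in F. f x < ennreal_powr a (1 / r)"
      using order_tendstoD(2)[OF assms(1)] by blast
    then show ?thesis
    proof eventually_elim
      case (elim x)
      have "\<not> a \<le> ennreal_powr (f x) r"
      proof
        assume "a \<le> ennreal_powr (f x) r"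
        then have "ennreal_powr a (1 / r) \<le> ennreal_powr (ennreal_powr (f x) r) (1 / r)"
          using assms(2) by (intro ennreal_powr_mono) auto
        then show False using elim assms(2) by (simp add: ennreal_powr_powr)
      qed
      then show ?case by simp
    qed
  qed
qed simp

text \<open>Jensen's inequality for a power, with infinite values allowed. The tangent line of
  \<open>a powr p\<close> at the mean \<open>m\<close> lies below the graph, and integrating it over
  total mass one gives the claim.\<close>

lemma prob_nn_integral_powr_le:
  fixes u :: "'a \<Rightarrow> ennreal"
  assumes [measurable]: "u \<in> borel_measurable M"
    and M: "emeasure M (space M) = 1" and p: "1 < p"
  shows "ennreal_powr (\<integral>\<^sup>+x. u x \<partial>M) p \<le> (\<integral>\<^sup>+x. ennreal_powr (u x) p \<partial>M)"
proof (cases "(\<integral>\<^sup>+x. u x \<partial>M)")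
  case top
  \<comment> \<open>An infinite mean forces an infinite right-hand side, since the constant
    \<open>1\<close> has finite integral.\<close>
  have "u x \<le> 1 + ennreal_powr (u x) p" for x
  proof (cases "u x")
    case (real a)
    have "a \<le> 1 + a powr p"
    proof (cases "a \<le> 1")
      case False
      then have "a powr 1 \<le> a powr p" using p by (intro powr_mono) auto
      then show ?thesis using False by simp
    qed (use powr_ge_zero[of a p] in linarith)
    then show ?thesis using real by (metis ennreal_1 ennreal_leI ennreal_plus ennreal_powr_ennreal powr_ge_zero zero_le_one)
  qed simp
  then have "(\<integral>\<^sup>+x. u x \<partial>M) \<le> (\<integral>\<^sup>+x. 1 + ennreal_powr (u x) p \<partial>M)"
    by (intro nn_integral_mono) auto
  also have "\<dots> = 1 + (\<integral>\<^sup>+x. ennreal_powr (u x) p \<partial>M)"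
    using M by (subst nn_integral_add) auto
  finally show ?thesis using top by (simp add: top_unique)
next
  case (real m)
  show ?thesis
  proof (cases "m = 0")
    case False
    then have m: "0 < m" using real by simp
    define R where "R = m powr (p - 1)"
    have R: "0 < R" "m powr p = m * R"
      using m by (auto simp: R_def powr_diff)
    \<comment> \<open>With these coefficients \<open>a \<le> c * a powr p + d\<close> is the tangent
      line inequality at \<open>a = m\<close>; it comes from Young's inequality for \<open>a\<close>
      and \<open>m powr (p - 1)\<close>.\<close>
    define c d where "c = 1 / (p * m powr (p - 1))" and "d = m * (p - 1) / p"
    have cd: "0 < c" "0 < d" using m p by (auto simp: c_def d_def)
    have cd_R: "(c * t + d) * m powr (p - 1) = t / p + m powr p / (p / (p - 1))" for t
      using m p R by (simp add: c_def d_def field_simps flip: R_def)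
    have young: "a \<le> c * a powr p + d" if "0 \<le> a" for a
    proof -
      have e: "1 / p + 1 / (p / (p - 1)) = 1" "p / (p - 1) > 1"
        using p by (auto simp: field_simps)
      have "a * m powr (p - 1) \<le> a powr p / p + (m powr (p - 1)) powr (p / (p - 1)) / (p / (p - 1))"
        using Youngs_inequality[OF p e(2) e(1) that, of "m powr (p - 1)"] by simp
      also have "(m powr (p - 1)) powr (p / (p - 1)) = m powr p"
        using p by (simp add: powr_powr)
      finally have "a * m powr (p - 1) \<le> (c * a powr p + d) * m powr (p - 1)"
        unfolding cd_R using R by (simp add: R_def)
      then show ?thesis using m by simp
    qed
    have "u x \<le> ennreal c * ennreal_powr (u x) p + ennreal d" for x
    proof (cases "u x")
      case (real a)
      then show ?thesis using young[of a] cd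
        by (simp add: ennreal_mult[symmetric] ennreal_plus[symmetric] del: ennreal_plus)
    qed (use cd in \<open>simp add: ennreal_mult_top\<close>)
    then have "(\<integral>\<^sup>+x. u x \<partial>M) \<le> (\<integral>\<^sup>+x. ennreal c * ennreal_powr (u x) p + ennreal d \<partial>M)"
      by (intro nn_integral_mono) auto
    also have "\<dots> = ennreal c * (\<integral>\<^sup>+x. ennreal_powr (u x) p \<partial>M) + ennreal d"
      using M by (simp add: nn_integral_add nn_integral_cmult)
    finally have *: "ennreal m \<le> ennreal c * (\<integral>\<^sup>+x. ennreal_powr (u x) p \<partial>M) + ennreal d"
      using real by simp
    show ?thesis
    proof (cases "(\<integral>\<^sup>+x. ennreal_powr (u x) p \<partial>M)")
      case r: (real r)
      then have "m \<le> c * r + d"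
        using * cd by (simp add: ennreal_mult[symmetric] ennreal_plus[symmetric] del: ennreal_plus)
      then have "m powr p \<le> r"
        using m p R by (simp add: c_def d_def field_simps flip: R_def)
      then show ?thesis using real r by simp
    qed simp
  qed (use real in simp)
qed

section \<open>Minkowski's integral inequality\<close>

definition Lp_norm :: "'a measure \<Rightarrow> real \<Rightarrow> ('a \<Rightarrow> ennreal) \<Rightarrow> ennreal" where
  "Lp_norm M p f = ennreal_powr (\<integral>\<^sup>+x. ennreal_powr (f x) p \<partial>M) (1 / p)"

lemma Lp_norm_mono:
  assumes "AE x in M. f x \<le> g x" "0 < p"
  shows "Lp_norm M p f \<le> Lp_norm M p g"
  unfolding Lp_norm_def using assms
  by (intro ennreal_powr_mono nn_integral_mono_AE) (auto elim!: eventually_mono intro: ennreal_powr_mono)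

lemma Lp_norm_cmult:
  assumes "0 < p" "f \<in> borel_measurable M"
  shows "Lp_norm M p (\<lambda>x. c * f x) = c * Lp_norm M p f"
  unfolding Lp_norm_def using assms
  by (simp add: ennreal_powr_mult nn_integral_cmult ennreal_powr_powr)

lemma ennreal_powr_Lp_norm:
  assumes "0 < p"
  shows "ennreal_powr (Lp_norm M p f) p = (\<integral>\<^sup>+x. ennreal_powr (f x) p \<partial>M)"
  unfolding Lp_norm_def using assms by (simp add: ennreal_powr_powr)

text \<open>Dividing each slice by its norm \<open>a s\<close> turns the outer integral into an
  average against the probability density proportional to \<open>a s\<close>. Jensen moves the power
  inside the average, Fubini swaps the integrals, and all normalised slices obey the same
  bound.\<close>

lemma Lp_norm_integral_le:
  fixes f :: "'s \<times> 'a \<Rightarrow> ennreal"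
  assumes S: "sigma_finite_measure S" and M: "sigma_finite_measure M"
    and f [measurable]: "f \<in> borel_measurable (S \<Otimes>\<^sub>M M)" and p: "1 < p"
  shows "Lp_norm M p (\<lambda>x. \<integral>\<^sup>+s. f (s, x) \<partial>S) \<le> (\<integral>\<^sup>+s. Lp_norm M p (\<lambda>x. f (s, x)) \<partial>S)"
proof -
  interpret S: sigma_finite_measure S by fact
  interpret M: sigma_finite_measure M by fact
  interpret SM: pair_sigma_finite S M ..
  define a where "a s = Lp_norm M p (\<lambda>x. f (s, x))" for s
  have a [measurable]: "a \<in> borel_measurable S"
    unfolding a_def Lp_norm_def by measurable
  define I where "I = (\<integral>\<^sup>+s. a s \<partial>S)"
  \<comment> \<open>An integrable function that is positive everywhere: a small multiple of it,
    added to \<open>a\<close>, keeps the density \<open>b\<close> positive where a slice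
    vanishes.\<close>
  obtain h where h [measurable]: "h \<in> borel_measurable S" and hI: "(\<integral>\<^sup>+s. h s \<partial>S) \<noteq> \<infinity>"
    and hpos: "\<And>s. s \<in> space S \<Longrightarrow> 0 < h s \<and> h s < \<infinity>"
    using S.Ex_finite_integrable_function by blast
  have main: "Lp_norm M p (\<lambda>x. \<integral>\<^sup>+s. f (s, x) \<partial>S) \<le> I + ennreal e * (\<integral>\<^sup>+s. h s \<partial>S)"
    if I: "I < top" and e: "0 < e" and sp: "space S \<noteq> {}" "(\<integral>\<^sup>+s. h s \<partial>S) \<noteq> 0" for e
  proof -
    define b where "b s = a s + ennreal e * h s" for s
    have b [measurable]: "b \<in> borel_measurable S" unfolding b_def by measurable
    define J where "J = (\<integral>\<^sup>+s. b s \<partial>S)"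
    have J: "J = I + ennreal e * (\<integral>\<^sup>+s. h s \<partial>S)"
      by (simp add: J_def b_def nn_integral_add nn_integral_cmult I_def)
    have Jfin: "J < top" using I hI
      by (simp add: J ennreal_mult_less_top ennreal_add_eq_top less_top)
    have Jpos: "0 < J" using sp e by (simp add: J zero_less_iff_neq_zero)
    have "AE s in S. b s \<noteq> top"
      using Jfin unfolding J_def by (intro nn_integral_noteq_infinite[unfolded infinity_ennreal_def]) auto
    then have bfin: "AE s in S. 0 < b s \<and> b s < top"
      using hpos e by (auto simp: b_def less_top zero_less_iff_neq_zero elim!: AE_mp intro!: AE_I2)
    define \<pi> where "\<pi> = density S (\<lambda>s. b s / J)"
    have [measurable_cong]: "sets \<pi> = sets S" by (simp add: \<pi>_def)
    have prob: "emeasure \<pi> (space \<pi>) = 1"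
      unfolding \<pi>_def using Jpos Jfin
      by (subst emeasure_density) (simp_all add: nn_integral_divide J_def[symmetric] ennreal_divide_self)
    interpret \<pi>: finite_measure \<pi> using prob by (intro finite_measureI) simp
    interpret \<pi>M: pair_sigma_finite \<pi> M ..
    have f' [measurable]: "f \<in> borel_measurable (\<pi> \<Otimes>\<^sub>M M)" by measurable
    have eq: "(\<integral>\<^sup>+s. f (s, x) \<partial>S) = (\<integral>\<^sup>+s. f (s, x) * (J / b s) \<partial>\<pi>)" if "x \<in> space M" for x
    proof -
      have [measurable]: "(\<lambda>s. f (s, x)) \<in> borel_measurable S" using that by measurable
      have "(\<integral>\<^sup>+s. f (s, x) * (J / b s) \<partial>\<pi>) = (\<integral>\<^sup>+s. (b s / J) * (f (s, x) * (J / b s)) \<partial>S)"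
        unfolding \<pi>_def by (subst nn_integral_density) auto
      also have "\<dots> = (\<integral>\<^sup>+s. f (s, x) \<partial>S)"
      proof (rule nn_integral_cong_AE)
        show "AE s in S. (b s / J) * (f (s, x) * (J / b s)) = f (s, x)"
          using bfin
        proof eventually_elim
          case (elim s)
          have "(b s / J) * (f (s, x) * (J / b s)) = f (s, x) * ((b s / b s) * (J / J))"
            by (simp add: ennreal_divide_times ennreal_times_divide divide_ennreal_def mult_ac)
          moreover have "b s / b s = 1" "J / J = 1"
            using elim Jpos Jfin by (auto simp: ennreal_divide_self)
          ultimately show ?case by simp
        qed
      qed
      finally show ?thesis by simp
    qed
    \<comment> \<open>Each slice rescaled by \<open>J / b s\<close> has norm at most
      \<open>J\<close>, because \<open>a s \<le> b s\<close>.\<close>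
    have bd: "(\<integral>\<^sup>+x. ennreal_powr (f (s, x) * (J / b s)) p \<partial>M) \<le> ennreal_powr J p"
      if s: "s \<in> space S" "0 < b s" "b s < top" for s
    proof -
      have [measurable]: "(\<lambda>x. f (s, x)) \<in> borel_measurable M" using s by measurable
      have "(\<integral>\<^sup>+x. ennreal_powr (f (s, x) * (J / b s)) p \<partial>M)
          = (\<integral>\<^sup>+x. ennreal_powr (f (s, x)) p \<partial>M) * ennreal_powr (J / b s) p"
        by (simp add: ennreal_powr_mult nn_integral_multc)
      also have "\<dots> = ennreal_powr (a s * (J / b s)) p"
        unfolding a_def using p by (simp add: ennreal_powr_Lp_norm ennreal_powr_mult)
      also have "\<dots> \<le> ennreal_powr (b s * (J / b s)) p"
        using p by (intro ennreal_powr_mono mult_right_mono) (auto simp: b_def)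
      also have "b s * (J / b s) = J * (b s / b s)"
        by (simp add: divide_ennreal_def mult_ac)
      finally show ?thesis using s by (simp add: ennreal_divide_self)
    qed
    have "(\<integral>\<^sup>+x. ennreal_powr (\<integral>\<^sup>+s. f (s, x) \<partial>S) p \<partial>M)
        = (\<integral>\<^sup>+x. ennreal_powr (\<integral>\<^sup>+s. f (s, x) * (J / b s) \<partial>\<pi>) p \<partial>M)"
      by (intro nn_integral_cong) (simp add: eq)
    also have "\<dots> \<le> (\<integral>\<^sup>+x. (\<integral>\<^sup>+s. ennreal_powr (f (s, x) * (J / b s)) p \<partial>\<pi>) \<partial>M)"
      using prob p by (intro nn_integral_mono prob_nn_integral_powr_le) auto
    also have "\<dots> = (\<integral>\<^sup>+s. (\<integral>\<^sup>+x. ennreal_powr (f (s, x) * (J / b s)) p \<partial>M) \<partial>\<pi>)"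
      by (rule \<pi>M.Fubini') measurable
    also have "\<dots> \<le> (\<integral>\<^sup>+s. ennreal_powr J p \<partial>\<pi>)"
    proof (rule nn_integral_mono_AE)
      have "AE s in S. (\<integral>\<^sup>+x. ennreal_powr (f (s, x) * (J / b s)) p \<partial>M) \<le> ennreal_powr J p"
        using bfin by (rule AE_mp) (auto intro!: AE_I2 bd)
      then show "AE s in \<pi>. (\<integral>\<^sup>+x. ennreal_powr (f (s, x) * (J / b s)) p \<partial>M) \<le> ennreal_powr J p"
        unfolding \<pi>_def by (subst AE_density) (auto elim!: eventually_mono)
    qed
    also have "\<dots> = ennreal_powr J p" using prob by simp
    finally have "Lp_norm M p (\<lambda>x. \<integral>\<^sup>+s. f (s, x) \<partial>S) \<le> ennreal_powr (ennreal_powr J p) (1 / p)"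
      unfolding Lp_norm_def using p by (intro ennreal_powr_mono) auto
    then show ?thesis using p by (simp add: ennreal_powr_powr J)
  qed
  show ?thesis
  proof (cases "I = top \<or> space S = {} \<or> (\<integral>\<^sup>+s. h s \<partial>S) = 0")
    case True
    show ?thesis
    proof (cases "I = top")
      case False
      \<comment> \<open>Here a positive \<open>h\<close> has zero integral, so \<open>S\<close> is
        the null measure and the left-hand side vanishes.\<close>
      then have "(\<integral>\<^sup>+s. h s \<partial>S) = 0" using True by (auto simp: nn_integral_empty)
      then have "AE s in S. h s = 0" by (subst (asm) nn_integral_0_iff_AE) auto
      moreover have "AE s in S. 0 < h s" using hpos by (auto intro: AE_I2)
      ultimately have "AE s in S. False" by eventually_elim simp
      then have "(\<integral>\<^sup>+s. f (s, x) \<partial>S) = (\<integral>\<^sup>+s. 0 \<partial>S)" for x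
        by (intro nn_integral_cong_AE) (auto elim: eventually_mono)
      then show ?thesis by (simp add: Lp_norm_def)
    qed (simp add: I_def a_def)
  next
    case False
    then have I: "I < top" by (simp add: less_top)
    obtain c where c: "0 \<le> c" "(\<integral>\<^sup>+s. h s \<partial>S) = ennreal c"
      using hI by (cases "(\<integral>\<^sup>+s. h s \<partial>S)") auto
    have c0: "0 < c" using False c by (cases "c = 0") auto
    have "Lp_norm M p (\<lambda>x. \<integral>\<^sup>+s. f (s, x) \<partial>S) \<le> I"
    proof (rule ennreal_le_epsilon)
      fix e :: real assume "0 < e"
      then have "Lp_norm M p (\<lambda>x. \<integral>\<^sup>+s. f (s, x) \<partial>S) \<le> I + ennreal (e / c) * (\<integral>\<^sup>+s. h s \<partial>S)"
        using I False c0 by (intro main) auto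
      also have "ennreal (e / c) * (\<integral>\<^sup>+s. h s \<partial>S) = ennreal e"
        using c c0 \<open>0 < e\<close> by (simp add: ennreal_mult[symmetric])
      finally show "Lp_norm M p (\<lambda>x. \<integral>\<^sup>+s. f (s, x) \<partial>S) \<le> I + ennreal e" .
    qed
    then show ?thesis by (simp add: I_def a_def)
  qed
qed

subsection \<open>Integration over the half-plane\<close>

lemma borel_measurable_Complex [measurable]:
  assumes [measurable]: "f \<in> borel_measurable M" "g \<in> borel_measurable M"
  shows "(\<lambda>x. Complex (f x) (g x)) \<in> borel_measurable M"
proof -
  have "(\<lambda>x. Complex (f x) (g x)) = (\<lambda>x. complex_of_real (f x) + \<i> * complex_of_real (g x))"
    by (simp add: complex_eq_iff fun_eq_iff)
  then show ?thesis by simp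
qed

lemma borel_measurable_cnj [measurable]:
  "f \<in> borel_measurable M \<Longrightarrow> (\<lambda>x. cnj (f x)) \<in> borel_measurable M"
  by (rule measurable_compose[of f M borel cnj]) (auto intro!: borel_measurable_continuous_onI continuous_intros)

lemma Im_powr_measurable [measurable]:
  "(\<lambda>w. Im w powr \<alpha>) \<in> borel_measurable (restrict_space lborel A)"
  by (rule measurable_restrict_space1) measurable

lemma lborel_complex_eq:
  "(lborel :: complex measure) = distr (lborel \<Otimes>\<^sub>M lborel) borel (\<lambda>(x, y). Complex x y)"
proof (rule lborel_eqI)
  fix l u :: complex assume le: "\<And>b. b \<in> Basis \<Longrightarrow> l \<bullet> b \<le> u \<bullet> b"
  have eq: "(\<lambda>(x, y). Complex x y) -` box l u \<inter> space (lborel \<Otimes>\<^sub>M lborel)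
      = {Re l <..< Re u} \<times> {Im l <..< Im u}"
    by (auto simp: box_def Basis_complex_def space_pair_measure)
  have le': "Re l \<le> Re u" "Im l \<le> Im u"
    using le[of 1] le[of \<i>] by (auto simp: Basis_complex_def)
  show "emeasure (distr (lborel \<Otimes>\<^sub>M lborel) borel (\<lambda>(x, y). Complex x y)) (box l u)
      = (\<Prod>b\<in>Basis. (u - l) \<bullet> b)"
    using le' by (simp add: emeasure_distr eq lborel.emeasure_pair_measure_Times
        Basis_complex_def ennreal_mult)
qed simp

lemma nn_integral_lborel_complex:
  assumes [measurable]: "f \<in> borel_measurable borel"
  shows "(\<integral>\<^sup>+z. f z \<partial>(lborel :: complex measure)) = (\<integral>\<^sup>+y. (\<integral>\<^sup>+x. f (Complex x y) \<partial>lborel) \<partial>lborel)"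
proof -
  have "(\<integral>\<^sup>+z. f z \<partial>lborel) = (\<integral>\<^sup>+z. f (case z of (x, y) \<Rightarrow> Complex x y) \<partial>(lborel \<Otimes>\<^sub>M lborel))"
    by (subst lborel_complex_eq) (simp add: nn_integral_distr)
  also have "\<dots> = (\<integral>\<^sup>+y. (\<integral>\<^sup>+x. f (Complex x y) \<partial>lborel) \<partial>lborel)"
    by (subst lborel_pair.nn_integral_snd[symmetric]) auto
  finally show ?thesis .
qed

lemma open_upper_half_plane: "open upper_half_plane"
  unfolding upper_half_plane_def by (rule open_halfspace_Im_gt)

lemma upper_half_plane_borel [measurable]: "upper_half_plane \<in> sets borel"
  using open_upper_half_plane by simp

lemma sets_bergman_measure: "sets (bergman_measure \<alpha>) = sets (restrict_space borel upper_half_plane)"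
  unfolding bergman_measure_def by (simp add: sets_restrict_space)

lemma space_bergman_measure: "space (bergman_measure \<alpha>) = upper_half_plane"
  unfolding bergman_measure_def by (simp add: space_restrict_space)

lemma borel_measurable_bergman_measure:
  "f \<in> borel_measurable borel \<Longrightarrow> f \<in> borel_measurable (bergman_measure \<alpha>)"
  by (simp add: measurable_cong_sets[OF sets_bergman_measure refl] measurable_restrict_space1)

lemma nn_integral_bergman_lborel:
  assumes [measurable]: "f \<in> borel_measurable borel"
  shows "(\<integral>\<^sup>+w. f w \<partial>bergman_measure \<alpha>)
    = (\<integral>\<^sup>+w. f w * ennreal (Im w powr \<alpha>) * indicator upper_half_plane w \<partial>lborel)"
proof -
  have [measurable]: "f \<in> borel_measurable (restrict_space lborel upper_half_plane)"
    by (rule measurable_restrict_space1) simp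
  show ?thesis
    unfolding bergman_measure_def
    by (subst nn_integral_density) (auto simp: nn_integral_restrict_space mult_ac)
qed

lemma nn_integral_bergman:
  assumes [measurable]: "f \<in> borel_measurable borel"
  shows "(\<integral>\<^sup>+w. f w \<partial>bergman_measure \<alpha>)
    = (\<integral>\<^sup>+v\<in>{0<..}. (\<integral>\<^sup>+u. f (Complex u v) \<partial>lborel) * ennreal (v powr \<alpha>) \<partial>lborel)"
proof -
  have "(\<integral>\<^sup>+w. f w \<partial>bergman_measure \<alpha>)
      = (\<integral>\<^sup>+v. (\<integral>\<^sup>+u. f (Complex u v) * (ennreal (v powr \<alpha>) * indicator {0<..} v) \<partial>lborel) \<partial>lborel)"
    by (simp add: nn_integral_bergman_lborel nn_integral_lborel_complex upper_half_plane_def indicator_def mult.assoc)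
  also have "\<dots> = (\<integral>\<^sup>+v. (\<integral>\<^sup>+u. f (Complex u v) \<partial>lborel) * (ennreal (v powr \<alpha>) * indicator {0<..} v) \<partial>lborel)"
    by (intro nn_integral_cong) (simp add: nn_integral_multc)
  finally show ?thesis by (simp add: mult.assoc)
qed

lemma AE_bergman_measure:
  "(AE w in bergman_measure \<alpha>. P w) \<longleftrightarrow> (AE w in lborel. w \<in> upper_half_plane \<longrightarrow> P w)"
proof -
  have "(AE w in bergman_measure \<alpha>. P w) \<longleftrightarrow>
      (AE w in restrict_space lborel upper_half_plane. 0 < ennreal (Im w powr \<alpha>) \<longrightarrow> P w)"
    unfolding bergman_measure_def by (rule AE_density) simp
  also have "\<dots> \<longleftrightarrow> (AE w in lborel. w \<in> upper_half_plane \<longrightarrow> 0 < ennreal (Im w powr \<alpha>) \<longrightarrow> P w)"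
    by (simp add: AE_restrict_space_iff)
  also have "\<dots> \<longleftrightarrow> (AE w in lborel. w \<in> upper_half_plane \<longrightarrow> P w)"
    by (intro AE_cong) (auto simp: upper_half_plane_def)
  finally show ?thesis .
qed

lemma sigma_finite_bergman_measure: "sigma_finite_measure (bergman_measure \<alpha>)"
proof -
  have "sigma_finite_measure (restrict_space (lborel :: complex measure) upper_half_plane)"
    by (intro sigma_finite_measure_restrict_space lborel.sigma_finite_measure_axioms) simp
  then interpret sigma_finite_measure "restrict_space (lborel :: complex measure) upper_half_plane" .
  show ?thesis
    unfolding bergman_measure_def by (subst sigma_finite_iff_density_finite) auto
qed

text \<open>Because \<open>Im (z - cnj w) = Im z + Im w\<close>.\<close>

lemma upper_half_plane_norm_ge:
  assumes "z \<in> upper_half_plane" "w \<in> upper_half_plane"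
  shows "Im z \<le> norm (z - cnj w)" "Im w \<le> norm (z - cnj w)" "0 < norm (z - cnj w)"
  using abs_Im_le_cmod[of "z - cnj w"] assms by (auto simp: upper_half_plane_def)

subsection \<open>The positive Bergman operator\<close>

text \<open>The Bergman operator with the modulus of its kernel, up to the normalising constant. On
  \<open>[0,\<infinity>]\<close>-valued functions it is always defined, and its finiteness is the
  criterion for convergence.\<close>

definition PP :: "real \<Rightarrow> (complex \<Rightarrow> ennreal) \<Rightarrow> complex \<Rightarrow> ennreal" where
  "PP \<alpha> f z = (\<integral>\<^sup>+w. f w * ennreal (1 / norm (z - cnj w) powr (2 + \<alpha>)) \<partial>bergman_measure \<alpha>)"

lemma PP_measurable [measurable]:
  assumes [measurable]: "f \<in> borel_measurable borel"
  shows "PP \<alpha> f \<in> borel_measurable borel"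
proof -
  have "PP \<alpha> f = (\<lambda>z. \<integral>\<^sup>+w. f w * ennreal (1 / norm (z - cnj w) powr (2 + \<alpha>)) * ennreal (Im w powr \<alpha>)
      * indicator upper_half_plane w \<partial>lborel)"
    unfolding PP_def by (subst nn_integral_bergman_lborel) auto
  also have "\<dots> \<in> borel_measurable borel" by measurable
  finally show ?thesis .
qed

text \<open>Moving \<open>z\<close> by at most \<open>c\<close> times its height changes
  \<open>norm (z - cnj w)\<close> by a factor at most \<open>1 + c\<close>, since that distance is
  at least \<open>Im z\<close>. The factor does not depend on \<open>w\<close>, so the bound
  survives integration and summation.\<close>

lemma kernel_harnack:
  assumes z: "z \<in> upper_half_plane" and z': "z' \<in> upper_half_plane" and w: "w \<in> upper_half_plane"
    and a: "0 \<le> a" and c: "norm (z - z') \<le> c * Im z" "0 \<le> c"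
  shows "1 / norm (z - cnj w) powr a \<le> (1 + c) powr a * (1 / norm (z' - cnj w) powr a)"
proof -
  have "norm (z' - cnj w) \<le> norm (z - cnj w) + norm (z - z')"
    using norm_triangle_ineq[of "z - cnj w" "z' - z"] by (simp add: norm_minus_commute)
  also have "norm (z - z') \<le> c * norm (z - cnj w)"
    using c upper_half_plane_norm_ge(1)[OF z w] by (meson mult_left_mono order_trans)
  finally have "norm (z' - cnj w) \<le> (1 + c) * norm (z - cnj w)" by (simp add: algebra_simps)
  then have "norm (z' - cnj w) powr a \<le> ((1 + c) * norm (z - cnj w)) powr a"
    using a by (intro powr_mono2) auto
  then have "norm (z' - cnj w) powr a \<le> (1 + c) powr a * norm (z - cnj w) powr a"
    using c by (simp add: powr_mult)
  then show ?thesis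
    using upper_half_plane_norm_ge(3)[OF z w] upper_half_plane_norm_ge(3)[OF z' w]
    by (simp add: field_simps)
qed

lemma PP_harnack:
  assumes f [measurable]: "f \<in> borel_measurable borel" and \<alpha>: "-1 < \<alpha>"
    and z: "z \<in> upper_half_plane" and z': "z' \<in> upper_half_plane"
    and c: "norm (z - z') \<le> c * Im z" "0 \<le> c"
  shows "PP \<alpha> f z \<le> ennreal ((1 + c) powr (2 + \<alpha>)) * PP \<alpha> f z'"
proof -
  have "(\<lambda>w. f w * ennreal (1 / norm (z' - cnj w) powr (2 + \<alpha>))) \<in> borel_measurable (bergman_measure \<alpha>)"
    by (rule borel_measurable_bergman_measure) measurable
  then have "ennreal ((1 + c) powr (2 + \<alpha>)) * PP \<alpha> f z'
    = (\<integral>\<^sup>+w. ennreal ((1 + c) powr (2 + \<alpha>)) * (f w * ennreal (1 / norm (z' - cnj w) powr (2 + \<alpha>))) \<partial>bergman_measure \<alpha>)"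
    unfolding PP_def by (simp add: nn_integral_cmult)
  moreover have "PP \<alpha> f z \<le> \<dots>"
    unfolding PP_def
  proof (rule nn_integral_mono)
    fix w assume "w \<in> space (bergman_measure \<alpha>)"
    then have "1 / norm (z - cnj w) powr (2 + \<alpha>) \<le> (1 + c) powr (2 + \<alpha>) * (1 / norm (z' - cnj w) powr (2 + \<alpha>))"
      using assms by (intro kernel_harnack) (auto simp: space_bergman_measure)
    then have "ennreal (1 / norm (z - cnj w) powr (2 + \<alpha>))
        \<le> ennreal ((1 + c) powr (2 + \<alpha>)) * ennreal (1 / norm (z' - cnj w) powr (2 + \<alpha>))"
      by (metis ennreal_leI ennreal_mult' powr_ge_zero)
    then have "f w * ennreal (1 / norm (z - cnj w) powr (2 + \<alpha>))
        \<le> f w * (ennreal ((1 + c) powr (2 + \<alpha>)) * ennreal (1 / norm (z' - cnj w) powr (2 + \<alpha>)))"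
      by (rule mult_left_mono) simp
    then show "f w * ennreal (1 / norm (z - cnj w) powr (2 + \<alpha>))
        \<le> ennreal ((1 + c) powr (2 + \<alpha>)) * (f w * ennreal (1 / norm (z' - cnj w) powr (2 + \<alpha>)))"
      by (simp add: mult_ac)
  qed
  ultimately show ?thesis by simp
qed

text \<open>Any two points are related by \<open>PP_harnack\<close> with
  \<open>c = norm (z - z') / Im z\<close>, so one finite value is enough.\<close>

lemma PP_finite_transfer:
  assumes "f \<in> borel_measurable borel" "-1 < \<alpha>"
    and z: "z \<in> upper_half_plane" and z': "z' \<in> upper_half_plane" and "PP \<alpha> f z' < top"
  shows "PP \<alpha> f z < top"
proof -
  have "PP \<alpha> f z \<le> ennreal ((1 + norm (z - z') / Im z) powr (2 + \<alpha>)) * PP \<alpha> f z'"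
    using z by (intro PP_harnack assms) (auto simp: upper_half_plane_def)
  also have "\<dots> < top" using assms(5) by (simp add: ennreal_mult_less_top)
  finally show ?thesis .
qed

text \<open>Density of the average over dilations \<open>t\<close> and translations \<open>s\<close>
  after the substitution \<open>w = Complex (x + y * s) (t * y)\<close> for
  \<open>z = Complex x y\<close>.\<close>

definition average_kernel :: "real \<Rightarrow> real \<Rightarrow> real \<Rightarrow> ennreal" where
  "average_kernel \<alpha> t s = indicator {0<..} t * ennreal (t powr \<alpha> / norm (Complex s (1 + t)) powr (2 + \<alpha>))"

lemma average_kernel_measurable [measurable]:
  assumes [measurable]: "f \<in> borel_measurable A" "g \<in> borel_measurable A"
  shows "(\<lambda>x. average_kernel \<alpha> (f x) (g x)) \<in> borel_measurable A"
  unfolding average_kernel_def by measurable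

text \<open>The kernel is homogeneous of degree \<open>- (2 + \<alpha>)\<close>; this cancels the
  factor \<open>y powr \<alpha>\<close> from the weight and the factor \<open>y * y\<close> from the
  two substitutions, where \<open>y = Im z\<close>.\<close>

lemma PP_eq_average:
  assumes [measurable]: "f \<in> borel_measurable borel" and z: "0 < Im z"
  shows "PP \<alpha> f z = (\<integral>\<^sup>+t. (\<integral>\<^sup>+s. f (Complex (Re z + Im z * s) (t * Im z)) * average_kernel \<alpha> t s
    \<partial>lborel) \<partial>lborel)"
proof -
  define x y where "x = Re z" and "y = Im z"
  have y: "0 < y" and zxy: "z = Complex x y" using z by (auto simp: x_def y_def)
  have "PP \<alpha> f z = (\<integral>\<^sup>+v\<in>{0<..}. (\<integral>\<^sup>+u. f (Complex u v) *
      ennreal (1 / norm (z - cnj (Complex u v)) powr (2 + \<alpha>)) \<partial>lborel) * ennreal (v powr \<alpha>) \<partial>lborel)"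
    unfolding PP_def by (subst nn_integral_bergman) auto
  also have "\<dots> = ennreal \<bar>y\<bar> * (\<integral>\<^sup>+t. (\<integral>\<^sup>+u. f (Complex u (0 + y * t)) *
      ennreal (1 / norm (z - cnj (Complex u (0 + y * t))) powr (2 + \<alpha>)) \<partial>lborel) *
      ennreal ((0 + y * t) powr \<alpha>) * indicator {0<..} (0 + y * t) \<partial>lborel)"
    using y by (intro nn_integral_real_affine) auto
  also have "\<dots> = ennreal y * (\<integral>\<^sup>+t. (\<integral>\<^sup>+u. f (Complex u (y * t)) *
      ennreal (1 / norm (z - cnj (Complex u (y * t))) powr (2 + \<alpha>)) \<partial>lborel) *
      ennreal ((y * t) powr \<alpha>) * indicator {0<..} (y * t) \<partial>lborel)"
    using y by simp
  also have "\<dots> = (\<integral>\<^sup>+t. ennreal y * ((\<integral>\<^sup>+u. f (Complex u (y * t)) *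
      ennreal (1 / norm (z - cnj (Complex u (y * t))) powr (2 + \<alpha>)) \<partial>lborel) *
      ennreal ((y * t) powr \<alpha>) * indicator {0<..} (y * t)) \<partial>lborel)"
    by (rule nn_integral_cmult[symmetric]) measurable
  also have "\<dots> = (\<integral>\<^sup>+t. (\<integral>\<^sup>+s. f (Complex (x + y * s) (t * y)) * average_kernel \<alpha> t s
    \<partial>lborel) \<partial>lborel)"
  proof (rule nn_integral_cong)
    fix t :: real
    show "ennreal y * ((\<integral>\<^sup>+u. f (Complex u (y * t)) *
      ennreal (1 / norm (z - cnj (Complex u (y * t))) powr (2 + \<alpha>)) \<partial>lborel) *
      ennreal ((y * t) powr \<alpha>) * indicator {0<..} (y * t))
      = (\<integral>\<^sup>+s. f (Complex (x + y * s) (t * y)) * average_kernel \<alpha> t s \<partial>lborel)"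
    proof (cases "0 < t")
      case t: True
      have "(\<integral>\<^sup>+u. f (Complex u (y * t)) * ennreal (1 / norm (z - cnj (Complex u (y * t))) powr (2 + \<alpha>)) \<partial>lborel)
        = ennreal \<bar>y\<bar> * (\<integral>\<^sup>+s. f (Complex (x + y * s) (y * t)) *
            ennreal (1 / norm (z - cnj (Complex (x + y * s) (y * t))) powr (2 + \<alpha>)) \<partial>lborel)"
        using y by (intro nn_integral_real_affine) auto
      also have "\<dots> = ennreal y * (\<integral>\<^sup>+s. f (Complex (x + y * s) (y * t)) *
            ennreal (1 / (y powr (2 + \<alpha>) * norm (Complex s (1 + t)) powr (2 + \<alpha>))) \<partial>lborel)"
      proof -
        have "norm (z - cnj (Complex (x + y * s) (y * t))) = y * norm (Complex s (1 + t))" for s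
        proof -
          have "z - cnj (Complex (x + y * s) (y * t)) = of_real y * Complex (- s) (1 + t)"
            by (simp add: zxy complex_eq_iff algebra_simps)
          then have "norm (z - cnj (Complex (x + y * s) (y * t))) = y * norm (Complex (- s) (1 + t))"
            using y by (simp add: norm_mult)
          also have "norm (Complex (- s) (1 + t)) = norm (Complex s (1 + t))" by (simp add: cmod_def)
          finally show ?thesis .
        qed
        then show ?thesis using y by (simp add: powr_mult)
      qed
      finally have *: "(\<integral>\<^sup>+u. f (Complex u (y * t)) * ennreal (1 / norm (z - cnj (Complex u (y * t))) powr (2 + \<alpha>)) \<partial>lborel)
        = ennreal y * (\<integral>\<^sup>+s. f (Complex (x + y * s) (y * t)) *
            ennreal (1 / (y powr (2 + \<alpha>) * norm (Complex s (1 + t)) powr (2 + \<alpha>))) \<partial>lborel)" .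
      have "ennreal y * ((\<integral>\<^sup>+u. f (Complex u (y * t)) *
        ennreal (1 / norm (z - cnj (Complex u (y * t))) powr (2 + \<alpha>)) \<partial>lborel) *
        ennreal ((y * t) powr \<alpha>) * indicator {0<..} (y * t))
        = (\<integral>\<^sup>+s. f (Complex (x + y * s) (y * t)) *
            ennreal (1 / (y powr (2 + \<alpha>) * norm (Complex s (1 + t)) powr (2 + \<alpha>))) \<partial>lborel)
          * (ennreal y * ennreal y * ennreal ((y * t) powr \<alpha>))"
        using y t unfolding * by (simp add: mult_ac)
      also have "\<dots> = (\<integral>\<^sup>+s. f (Complex (x + y * s) (y * t)) *
            ennreal (1 / (y powr (2 + \<alpha>) * norm (Complex s (1 + t)) powr (2 + \<alpha>)))
            * (ennreal y * ennreal y * ennreal ((y * t) powr \<alpha>)) \<partial>lborel)"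
        by (rule nn_integral_multc[symmetric]) measurable
      also have "\<dots> = (\<integral>\<^sup>+s. f (Complex (x + y * s) (t * y)) * average_kernel \<alpha> t s \<partial>lborel)"
      proof (intro nn_integral_cong)
        fix s
        have n: "0 < norm (Complex s (1 + t))" using t by (auto simp: complex_eq_iff)
        have "1 / (y powr (2 + \<alpha>) * norm (Complex s (1 + t)) powr (2 + \<alpha>)) * (y * y * (y * t) powr \<alpha>)
          = t powr \<alpha> / norm (Complex s (1 + t)) powr (2 + \<alpha>)"
          using y t n by (simp add: powr_mult powr_add field_simps power2_eq_square powr_numeral)
        then have "ennreal (1 / (y powr (2 + \<alpha>) * norm (Complex s (1 + t)) powr (2 + \<alpha>)))
            * (ennreal y * ennreal y * ennreal ((y * t) powr \<alpha>)) = average_kernel \<alpha> t s"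
          using y t by (simp add: average_kernel_def ennreal_mult[symmetric])
        then show "f (Complex (x + y * s) (y * t)) *
            ennreal (1 / (y powr (2 + \<alpha>) * norm (Complex s (1 + t)) powr (2 + \<alpha>)))
            * (ennreal y * ennreal y * ennreal ((y * t) powr \<alpha>))
            = f (Complex (x + y * s) (t * y)) * average_kernel \<alpha> t s"
          by (simp add: mult.assoc mult.commute[of t y])
      qed
      finally show ?thesis .
    next
      case False
      then have "\<not> 0 < y * t" using y by (simp add: zero_less_mult_iff)
      then show ?thesis using False by (simp add: average_kernel_def)
    qed
  qed
  finally show ?thesis by (simp add: x_def y_def)
qed

subsection \<open>Kernel integrals\<close>

lemma nn_integral_powr_unit_finite:
  assumes "-1 < (a::real)"
  shows "(\<integral>\<^sup>+t. ennreal (t powr a) * indicator {0..1} t \<partial>lborel) < top"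
proof -
  have "((\<lambda>x. x powr a) has_integral (1 powr (a+1) / (a+1))) {0..1}"
    using assms by (intro has_integral_powr_from_0) auto
  then have "(\<integral>\<^sup>+x\<in>{0..1}. ennreal (x powr a) \<partial>lborel) = ennreal (1 powr (a+1) / (a+1))"
    by (intro nn_integral_has_integral_lebesgue') auto
  then show ?thesis by simp
qed

lemma nn_integral_powr_tail_finite:
  assumes "b < (-1::real)"
  shows "(\<integral>\<^sup>+t. ennreal (t powr b) * indicator {1..} t \<partial>lborel) < top"
proof -
  have "((\<lambda>x. x powr b) has_integral (-(1 powr (b+1)) / (b+1))) {1..}"
    using assms by (intro has_integral_powr_to_inf) auto
  then have "(\<integral>\<^sup>+x\<in>{1..}. ennreal (x powr b) \<partial>lborel) = ennreal (-(1 powr (b+1)) / (b+1))"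
    by (intro nn_integral_has_integral_lebesgue') auto
  then show ?thesis by simp
qed

lemma nn_integral_two_powers_finite:
  assumes a: "-1 < (a::real)" and b: "b < (-1::real)"
    and g: "\<And>t. 0 < t \<Longrightarrow> t \<le> 1 \<Longrightarrow> g t \<le> C * t powr a"
      "\<And>t. 1 < t \<Longrightarrow> g t \<le> C * t powr b" and C: "0 \<le> C"
  shows "(\<integral>\<^sup>+t. ennreal (g t) * indicator {0<..} t \<partial>lborel) < top"
proof -
  have "(\<integral>\<^sup>+t. ennreal (g t) * indicator {0<..} t \<partial>lborel)
      \<le> (\<integral>\<^sup>+t. ennreal C * (ennreal (t powr a) * indicator {0..1} t)
          + ennreal C * (ennreal (t powr b) * indicator {1..} t) \<partial>lborel)"
  proof (rule nn_integral_mono)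
    fix t :: real
    show "ennreal (g t) * indicator {0<..} t \<le> ennreal C * (ennreal (t powr a) * indicator {0..1} t)
          + ennreal C * (ennreal (t powr b) * indicator {1..} t)"
    proof (cases "0 < t")
      case True
      show ?thesis
      proof (cases "t \<le> 1")
        case True
        have "ennreal (g t) \<le> ennreal C * ennreal (t powr a)"
          using g(1)[OF \<open>0 < t\<close> True] C by (metis ennreal_leI ennreal_mult' )
        then show ?thesis using True \<open>0 < t\<close> by (simp add: add_increasing2)
      next
        case False
        have "ennreal (g t) \<le> ennreal C * ennreal (t powr b)"
          using g(2) False C by (metis ennreal_leI ennreal_mult' not_le)
        then show ?thesis using False \<open>0 < t\<close> by (simp add: add_increasing)
      qed
    qed simp
  qed
  also have "\<dots> = ennreal C * (\<integral>\<^sup>+t. ennreal (t powr a) * indicator {0..1} t \<partial>lborel)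
      + ennreal C * (\<integral>\<^sup>+t. ennreal (t powr b) * indicator {1..} t \<partial>lborel)"
    by (simp add: nn_integral_add nn_integral_cmult)
  also have "\<dots> < top"
    using nn_integral_powr_unit_finite[OF a] nn_integral_powr_tail_finite[OF b]
    by (simp add: ennreal_mult_less_top)
  finally show ?thesis .
qed

lemma nn_integral_kernel_line_finite:
  assumes "1 < (a::real)"
  shows "(\<integral>\<^sup>+s. ennreal (1 / norm (Complex s 1) powr a) \<partial>lborel) < top"
proof -
  define g where "g s = 1 / norm (Complex s 1) powr a" for s
  have g0: "0 \<le> g s" and gm: "g (- s) = g s" for s by (auto simp: g_def cmod_def)
  have [measurable]: "g \<in> borel_measurable borel" unfolding g_def by measurable
  have fin: "(\<integral>\<^sup>+s. ennreal (g s) * indicator {0<..} s \<partial>lborel) < top"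
  proof (rule nn_integral_two_powers_finite[where a = 0 and b = "-a" and C = 1])
    fix t :: real assume t: "0 < t" "t \<le> 1"
    have "1 \<le> norm (Complex t 1)" using abs_Im_le_cmod[of "Complex t 1"] by simp
    then show "g t \<le> 1 * t powr 0"
      using assms t by (simp add: g_def divide_le_eq ge_one_powr_ge_zero)
  next
    fix t :: real assume t: "1 < t"
    have "t \<le> norm (Complex t 1)" using abs_Re_le_cmod[of "Complex t 1"] by simp
    then have "t powr a \<le> norm (Complex t 1) powr a" using assms t by (intro powr_mono2) auto
    then have "1 / norm (Complex t 1) powr a \<le> 1 / t powr a"
      using t by (intro divide_left_mono mult_pos_pos) (auto simp: complex_eq_iff)
    then show "g t \<le> 1 * t powr - a" by (simp add: g_def powr_minus divide_inverse)
  qed (use assms in \<open>auto simp: g_def\<close>)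
  have "(\<integral>\<^sup>+s. ennreal (g s) \<partial>lborel)
    \<le> (\<integral>\<^sup>+s. ennreal (g s) * indicator {0<..} s + (ennreal (g s) * indicator {0<..} (- s)
       + indicator {0} s * ennreal (g s)) \<partial>lborel)"
    by (intro nn_integral_mono) (auto simp: indicator_def)
  also have "\<dots> = (\<integral>\<^sup>+s. ennreal (g s) * indicator {0<..} s \<partial>lborel)
    + ((\<integral>\<^sup>+s. ennreal (g s) * indicator {0<..} (- s) \<partial>lborel) + (\<integral>\<^sup>+s. indicator {0} s * ennreal (g s) \<partial>lborel))"
    by (simp add: nn_integral_add)
  also have "(\<integral>\<^sup>+s. ennreal (g s) * indicator {0<..} (- s) \<partial>lborel) = (\<integral>\<^sup>+s. ennreal (g s) * indicator {0<..} s \<partial>lborel)"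
    by (subst nn_integral_real_affine[of _ "-1" 0]) (auto simp: gm)
  also have "(\<integral>\<^sup>+s. indicator {0} s * ennreal (g s) \<partial>lborel) = (\<integral>\<^sup>+s. ennreal (g 0) * indicator {0::real} s \<partial>lborel)"
    by (intro nn_integral_cong) (auto simp: indicator_def)
  also have "\<dots> = 0"
    by (simp add: nn_integral_cmult)
  finally show ?thesis using fin by (auto simp: g_def top_unique intro: le_less_trans)
qed

lemma nn_integral_kernel_line:
  assumes t: "0 < (r::real)"
  shows "(\<integral>\<^sup>+s. ennreal (1 / norm (Complex s r) powr a) \<partial>lborel)
    = ennreal (r powr (1 - a)) * (\<integral>\<^sup>+s. ennreal (1 / norm (Complex s 1) powr a) \<partial>lborel)"
proof -
  have "(\<integral>\<^sup>+s. ennreal (1 / norm (Complex s r) powr a) \<partial>lborel)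
    = ennreal \<bar>r\<bar> * (\<integral>\<^sup>+s. ennreal (1 / norm (Complex (0 + r * s) r) powr a) \<partial>lborel)"
    using t by (intro nn_integral_real_affine) auto
  also have "(\<lambda>s. ennreal (1 / norm (Complex (0 + r * s) r) powr a))
     = (\<lambda>s. ennreal (r powr - a) * ennreal (1 / norm (Complex s 1) powr a))"
  proof
    fix s
    have "Complex (0 + r * s) r = of_real r * Complex s 1" by (simp add: complex_eq_iff)
    then have "norm (Complex (0 + r * s) r) = r * norm (Complex s 1)" using t by (simp only: norm_mult) simp
    then show "ennreal (1 / norm (Complex (0 + r * s) r) powr a)
      = ennreal (r powr - a) * ennreal (1 / norm (Complex s 1) powr a)"
      using t by (simp add: powr_mult powr_minus ennreal_mult[symmetric] divide_simps)
  qed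
  also have "ennreal \<bar>r\<bar> * (\<integral>\<^sup>+s. ennreal (r powr - a) * ennreal (1 / norm (Complex s 1) powr a) \<partial>lborel)
     = ennreal (r powr (1 - a)) * (\<integral>\<^sup>+s. ennreal (1 / norm (Complex s 1) powr a) \<partial>lborel)"
  proof -
    have "ennreal \<bar>r\<bar> * ennreal (r powr - a) = ennreal (r powr (1 - a))"
      using t by (simp add: ennreal_mult[symmetric] powr_diff powr_minus divide_inverse)
    then show ?thesis
      by (subst nn_integral_cmult) (measurable, simp add: mult.assoc[symmetric])
  qed
  finally show ?thesis .
qed

lemma nn_integral_average_kernel_line:
  "(\<integral>\<^sup>+s. average_kernel \<alpha> t s \<partial>lborel) = indicator {0<..} t * ennreal (t powr \<alpha> * (1 + t) powr (- 1 - \<alpha>))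
    * (\<integral>\<^sup>+s. ennreal (1 / norm (Complex s 1) powr (2 + \<alpha>)) \<partial>lborel)"
proof (cases "0 < t")
  case True
  have "(\<integral>\<^sup>+s. average_kernel \<alpha> t s \<partial>lborel)
    = (\<integral>\<^sup>+s. ennreal (t powr \<alpha>) * ennreal (1 / norm (Complex s (1 + t)) powr (2 + \<alpha>)) \<partial>lborel)"
    using True by (intro nn_integral_cong) (simp add: average_kernel_def ennreal_mult[symmetric])
  also have "\<dots> = ennreal (t powr \<alpha>) * (ennreal ((1 + t) powr (1 - (2 + \<alpha>)))
     * (\<integral>\<^sup>+s. ennreal (1 / norm (Complex s 1) powr (2 + \<alpha>)) \<partial>lborel))"
    using True by (subst nn_integral_kernel_line[symmetric]) (auto simp: nn_integral_cmult)
  also have "1 - (2 + \<alpha>) = - 1 - \<alpha>" by simp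
  finally show ?thesis using True by (simp add: ennreal_mult mult.assoc)
qed (simp add: average_kernel_def)

text \<open>Square integrability of the kernel with singularity at \<open>- \<i>\<close>. That
  kernel is the test function both for the integrability of the disc weight and for the uniqueness
  of the Bergman constant.\<close>

lemma nn_integral_square_kernel_finite:
  assumes \<alpha>: "-1 < \<alpha>"
  shows "(\<integral>\<^sup>+w. ennreal (1 / norm (w + \<i>) powr (4 + 2 * \<alpha>)) \<partial>bergman_measure \<alpha>) < top"
proof -
  define J where "J = (\<integral>\<^sup>+s. ennreal (1 / norm (Complex s 1) powr (4 + 2 * \<alpha>)) \<partial>lborel)"
  have J: "J < top" unfolding J_def using \<alpha> by (intro nn_integral_kernel_line_finite) auto
  have "(\<integral>\<^sup>+w. ennreal (1 / norm (w + \<i>) powr (4 + 2 * \<alpha>)) \<partial>bergman_measure \<alpha>)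
    = (\<integral>\<^sup>+v\<in>{0<..}. (\<integral>\<^sup>+u. ennreal (1 / norm (Complex u v + \<i>) powr (4 + 2 * \<alpha>)) \<partial>lborel) * ennreal (v powr \<alpha>) \<partial>lborel)"
    by (subst nn_integral_bergman) auto
  also have "\<dots> = (\<integral>\<^sup>+v. J * (ennreal ((1 + v) powr (1 - (4 + 2 * \<alpha>)) * v powr \<alpha>) * indicator {0<..} v) \<partial>lborel)"
  proof (rule nn_integral_cong)
    fix v :: real
    show "(\<integral>\<^sup>+u. ennreal (1 / norm (Complex u v + \<i>) powr (4 + 2 * \<alpha>)) \<partial>lborel) * ennreal (v powr \<alpha>) * indicator {0<..} v
      = J * (ennreal ((1 + v) powr (1 - (4 + 2 * \<alpha>)) * v powr \<alpha>) * indicator {0<..} v)"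
    proof (cases "0 < v")
      case True
      have "Complex u v + \<i> = Complex u (1 + v)" for u by (simp add: complex_eq_iff)
      then have "(\<integral>\<^sup>+u. ennreal (1 / norm (Complex u v + \<i>) powr (4 + 2 * \<alpha>)) \<partial>lborel)
        = ennreal ((1 + v) powr (1 - (4 + 2 * \<alpha>))) * J"
        unfolding J_def using True by (simp only:) (rule nn_integral_kernel_line, simp)
      then show ?thesis using True by (simp add: ennreal_mult mult_ac)
    qed simp
  qed
  also have "\<dots> = J * (\<integral>\<^sup>+v. ennreal ((1 + v) powr (1 - (4 + 2 * \<alpha>)) * v powr \<alpha>) * indicator {0<..} v \<partial>lborel)"
    by (rule nn_integral_cmult) measurable
  also have "\<dots> < top"
  proof -
    have "(\<integral>\<^sup>+v. ennreal ((1 + v) powr (1 - (4 + 2 * \<alpha>)) * v powr \<alpha>) * indicator {0<..} v \<partial>lborel) < top"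
    proof (rule nn_integral_two_powers_finite[where a = \<alpha> and b = "- 3 - \<alpha>" and C = 1])
      fix t :: real assume t: "0 < t"
      have "(1 + t) powr (1 - (4 + 2 * \<alpha>)) \<le> 1 powr (1 - (4 + 2 * \<alpha>))"
        using t \<alpha> by (intro powr_mono2') auto
      then show "(1 + t) powr (1 - (4 + 2 * \<alpha>)) * t powr \<alpha> \<le> 1 * t powr \<alpha>"
        by (intro mult_right_mono) auto
    next
      fix t :: real assume t: "1 < t"
      have "(1 + t) powr (1 - (4 + 2 * \<alpha>)) * t powr \<alpha> \<le> t powr (1 - (4 + 2 * \<alpha>)) * t powr \<alpha>"
        using t \<alpha> by (intro mult_right_mono powr_mono2') auto
      also have "\<dots> = t powr (- 3 - \<alpha>)"
      proof -
        have "1 - (4 + 2 * \<alpha>) + \<alpha> = - 3 - \<alpha>" by simp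
        then show ?thesis by (metis powr_add)
      qed
      finally show "(1 + t) powr (1 - (4 + 2 * \<alpha>)) * t powr \<alpha> \<le> 1 * t powr (- 3 - \<alpha>)" by simp
    qed (use \<alpha> in auto)
    then show ?thesis using J by (simp add: ennreal_mult_less_top)
  qed
  finally show ?thesis .
qed

subsection \<open>Weighted mixed norms\<close>

text \<open>The cut-off to the positive axis sits next to \<open>W\<close> because only this product
  is assumed measurable; \<open>W\<close> is arbitrary on the rest of the line.\<close>

definition mixed_measure :: "real \<Rightarrow> (real \<Rightarrow> real) \<Rightarrow> real measure" where
  "mixed_measure \<alpha> W = density lborel (\<lambda>y. ennreal (indicator {0<..} y * W y) * ennreal (y powr \<alpha>))"

definition mixed_norm ::
    "real \<Rightarrow> real \<Rightarrow> real \<Rightarrow> (real \<Rightarrow> real) \<Rightarrow> (complex \<Rightarrow> ennreal) \<Rightarrow> ennreal" where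
  "mixed_norm p q \<alpha> W f =
     Lp_norm (mixed_measure \<alpha> W) q (\<lambda>y. Lp_norm lborel p (\<lambda>x. f (Complex x y)))"

lemma AE_witness:
  assumes "AE x in X. P x" "\<not> (AE x in X. False)"
  shows "\<exists>x. P x"
proof (rule ccontr)
  assume "\<nexists>x. P x"
  with assms(1) have "AE x in X. False" by (auto elim: eventually_mono)
  with assms(2) show False by simp
qed

lemma lborel_nontrivial: "\<not> (AE x in (lborel :: real measure). False)"
  by (simp add: AE_iff_measurable[of UNIV])

text \<open>\<open>W_slow\<close> says that the weight varies more slowly than every power. Dilating
  back by \<open>1 / t\<close> gives the reverse comparison with the same constant, since
  \<open>max t (1 / t)\<close> is symmetric.\<close>

locale mixed_space =
  fixes p q \<alpha> :: real and W :: "real \<Rightarrow> real"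
  assumes alpha: "-1 < \<alpha>" and p: "1 < p" and q: "1 < q"
    and W_measurable: "(\<lambda>y. indicator {0<..} y * W y) \<in> borel_measurable borel"
    and W_pos: "\<And>y. 0 < y \<Longrightarrow> 0 < W y"
    and W_slow: "\<And>\<epsilon>. 0 < \<epsilon> \<Longrightarrow> \<exists>C\<ge>0. \<forall>s>0. \<forall>t>0. W (s * t) \<le> C * max t (1 / t) powr \<epsilon> * W s"
begin

abbreviation "N \<equiv> mixed_norm p q \<alpha> W"
abbreviation "M \<equiv> mixed_measure \<alpha> W"

lemma density_measurable [measurable]:
  "(\<lambda>y. ennreal (indicator {0<..} y * W y) * ennreal (y powr \<alpha>)) \<in> borel_measurable borel"
  using W_measurable by measurable

lemma sets_M [measurable_cong, simp]: "sets M = sets borel"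
  by (simp add: mixed_measure_def)

lemma sigma_finite_M: "sigma_finite_measure M"
  unfolding mixed_measure_def
  by (subst sigma_finite_measure.sigma_finite_iff_density_finite[OF lborel.sigma_finite_measure_axioms])
    (use density_measurable in \<open>auto simp: ennreal_mult_eq_top_iff\<close>)

lemma AE_M: "(AE y in M. P y) \<longleftrightarrow> (AE y in lborel. 0 < y \<longrightarrow> P y)"
proof -
  have "(AE y in M. P y) \<longleftrightarrow>
      (AE y in lborel. 0 < ennreal (indicator {0<..} y * W y) * ennreal (y powr \<alpha>) \<longrightarrow> P y)"
    unfolding mixed_measure_def using density_measurable by (intro AE_density) simp
  also have "\<dots> \<longleftrightarrow> (AE y in lborel. 0 < y \<longrightarrow> P y)"
    by (intro AE_cong) (auto simp: W_pos ennreal_zero_less_mult_iff split: split_indicator)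
  finally show ?thesis .
qed

lemma AE_M_pos: "AE y in M. 0 < y"
  by (simp add: AE_M)

lemma M_nontrivial: "\<not> (AE y in M. False)"
proof
  assume "AE y in M. False"
  then have "AE y in lborel. y \<notin> {0<..<1::real}"
    unfolding AE_M by eventually_elim auto
  then have "emeasure lborel {0<..<1::real} = 0"
    by (subst (asm) AE_iff_measurable[of "{0<..<1}"]) auto
  then show False by simp
qed

lemma nn_integral_M:
  assumes [measurable]: "g \<in> borel_measurable borel"
  shows "(\<integral>\<^sup>+y. g y \<partial>M) = (\<integral>\<^sup>+y\<in>{0<..}. g y * ennreal (W y * y powr \<alpha>) \<partial>lborel)"
proof -
  have "(\<integral>\<^sup>+y. g y \<partial>M)
      = (\<integral>\<^sup>+y. (ennreal (indicator {0<..} y * W y) * ennreal (y powr \<alpha>)) * g y \<partial>lborel)"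
    unfolding mixed_measure_def using density_measurable by (intro nn_integral_density) auto
  also have "\<dots> = (\<integral>\<^sup>+y\<in>{0<..}. g y * ennreal (W y * y powr \<alpha>) \<partial>lborel)"
    by (intro nn_integral_cong) (auto simp: ennreal_mult'' mult_ac split: split_indicator)
  finally show ?thesis .
qed

section \<open>Minkowski's inequality and dilations for the mixed norm\<close>

lemma slice_measurable [measurable]:
  assumes [measurable]: "f \<in> borel_measurable borel"
  shows "(\<lambda>y. Lp_norm lborel p (\<lambda>x. f (Complex x y))) \<in> borel_measurable borel"
  unfolding Lp_norm_def by measurable

lemma mixed_norm_powr:
  assumes [measurable]: "f \<in> borel_measurable borel"
  shows "ennreal_powr (N f) q = (\<integral>\<^sup>+y\<in>{0<..}. ennreal_powr (\<integral>\<^sup>+x. ennreal_powr (f (Complex x y)) p \<partial>lborel) (q / p)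
        * ennreal (W y * y powr \<alpha>) \<partial>lborel)"
proof -
  have "ennreal_powr (N f) q = (\<integral>\<^sup>+y. ennreal_powr (Lp_norm lborel p (\<lambda>x. f (Complex x y))) q \<partial>M)"
    unfolding mixed_norm_def using q by (intro ennreal_powr_Lp_norm) simp
  also have "\<dots> = (\<integral>\<^sup>+y\<in>{0<..}. ennreal_powr (Lp_norm lborel p (\<lambda>x. f (Complex x y))) q * ennreal (W y * y powr \<alpha>) \<partial>lborel)"
    by (intro nn_integral_M) measurable
  finally show ?thesis by (simp add: Lp_norm_def ennreal_powr_powr)
qed

lemma N_mono:
  assumes "\<And>z. z \<in> upper_half_plane \<Longrightarrow> f z \<le> g z"
  shows "N f \<le> N g"
  unfolding mixed_norm_def
proof (rule Lp_norm_mono)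
  show "AE y in M. Lp_norm lborel p (\<lambda>x. f (Complex x y)) \<le> Lp_norm lborel p (\<lambda>x. g (Complex x y))"
    using AE_M_pos
    by eventually_elim (use p in \<open>auto intro!: Lp_norm_mono assms simp: upper_half_plane_def\<close>)
qed (use q in simp)

lemma N_cong:
  assumes "\<And>z. z \<in> upper_half_plane \<Longrightarrow> f z = g z"
  shows "N f = N g"
  using assms by (intro antisym N_mono) auto

lemma N_cmult:
  assumes [measurable]: "f \<in> borel_measurable borel"
  shows "N (\<lambda>z. c * f z) = c * N f"
  unfolding mixed_norm_def using p q by (subst Lp_norm_cmult) (auto simp: Lp_norm_cmult)

text \<open>Minkowski's integral inequality twice: in \<open>x\<close> on each horizontal line, then
  in \<open>y\<close> for the resulting slice norms.\<close>

lemma N_integral_le: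
  fixes f :: "'s \<times> complex \<Rightarrow> ennreal"
  assumes S: "sigma_finite_measure S" and f [measurable]: "f \<in> borel_measurable (S \<Otimes>\<^sub>M borel)"
  shows "N (\<lambda>z. \<integral>\<^sup>+s. f (s, z) \<partial>S) \<le> (\<integral>\<^sup>+s. N (\<lambda>z. f (s, z)) \<partial>S)"
proof -
  interpret S: sigma_finite_measure S by fact
  define g where "g = (\<lambda>(s, y). Lp_norm lborel p (\<lambda>x. f (s, Complex x y)))"
  have g [measurable]: "g \<in> borel_measurable (S \<Otimes>\<^sub>M M)"
    unfolding g_def Lp_norm_def by measurable
  have "N (\<lambda>z. \<integral>\<^sup>+s. f (s, z) \<partial>S) \<le> Lp_norm M q (\<lambda>y. \<integral>\<^sup>+s. g (s, y) \<partial>S)"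
    unfolding mixed_norm_def
  proof (rule Lp_norm_mono[OF AE_I2])
    fix y
    show "Lp_norm lborel p (\<lambda>x. \<integral>\<^sup>+s. f (s, Complex x y) \<partial>S) \<le> (\<integral>\<^sup>+s. g (s, y) \<partial>S)"
      unfolding g_def
      using Lp_norm_integral_le[OF S lborel.sigma_finite_measure_axioms, of "\<lambda>(s, x). f (s, Complex x y)" p] p
      by simp
  qed (use q in simp)
  also have "\<dots> \<le> (\<integral>\<^sup>+s. Lp_norm M q (\<lambda>y. g (s, y)) \<partial>S)"
    using q by (intro Lp_norm_integral_le S sigma_finite_M g) simp
  finally show ?thesis by (simp add: mixed_norm_def g_def)
qed

lemma N_suminf_le:
  fixes f :: "nat \<Rightarrow> complex \<Rightarrow> ennreal"
  assumes [measurable]: "\<And>n. f n \<in> borel_measurable borel"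
  shows "N (\<lambda>z. \<Sum>n. f n z) \<le> (\<Sum>n. N (f n))"
  using N_integral_le[of "count_space UNIV" "\<lambda>(n, z). f n z"]
  by (simp add: nn_integral_count_space_nat sigma_finite_measure_count_space)

text \<open>On a fixed line the shift by \<open>Im z * s\<close> is a translation, which the inner
  norm ignores. What remains is the substitution \<open>t * y\<close> in the outer integral: it
  produces \<open>t powr (- 1 - \<alpha>)\<close> and a comparison of \<open>W y\<close> with
  \<open>W (t * y)\<close>. The root \<open>1 / q\<close> comes from the outer exponent.\<close>

lemma N_dilation:
  assumes [measurable]: "f \<in> borel_measurable borel" and t: "0 < t"
    and C: "0 \<le> C" "\<And>s t. 0 < s \<Longrightarrow> 0 < t \<Longrightarrow> W (s * t) \<le> C * max t (1 / t) powr \<epsilon> * W s"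
  shows "N (\<lambda>z. f (Complex (Re z + Im z * s) (t * Im z)))
    \<le> ennreal ((C * max t (1 / t) powr \<epsilon> * t powr (- 1 - \<alpha>)) powr (1 / q)) * N f"
proof -
  define B where "B = C * max t (1 / t) powr \<epsilon> * t powr (- 1 - \<alpha>)"
  have B: "0 \<le> B" using C by (simp add: B_def)
  define G where "G y = ennreal_powr (Lp_norm lborel p (\<lambda>x. f (Complex x y))) q" for y
  have G [measurable]: "G \<in> borel_measurable borel" unfolding G_def by measurable
  define gg where "gg y = G y * (ennreal (indicator {0<..} y * W y) * ennreal (y powr \<alpha>))" for y
  have gg [measurable]: "gg \<in> borel_measurable borel" unfolding gg_def by measurable
  have inner: "Lp_norm lborel p (\<lambda>x. f (Complex (x + y * s) (t * y))) = Lp_norm lborel p (\<lambda>x. f (Complex x (t * y)))" for y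
    unfolding Lp_norm_def
    by (subst (2) nn_integral_real_affine[where c = 1 and t = "y * s"]) (auto simp: add.commute)
  have "ennreal_powr (N (\<lambda>z. f (Complex (Re z + Im z * s) (t * Im z)))) q = (\<integral>\<^sup>+y. G (t * y) \<partial>M)"
    unfolding mixed_norm_def using q by (subst ennreal_powr_Lp_norm) (auto simp: inner G_def)
  also have "\<dots> = (\<integral>\<^sup>+y\<in>{0<..}. G (t * y) * ennreal (W y * y powr \<alpha>) \<partial>lborel)"
    by (rule nn_integral_M) measurable
  also have "\<dots> \<le> (\<integral>\<^sup>+y. ennreal B * (ennreal \<bar>t\<bar> * gg (0 + t * y)) \<partial>lborel)"
  proof (rule nn_integral_mono)
    fix y :: real
    show "G (t * y) * ennreal (W y * y powr \<alpha>) * indicator {0<..} y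
      \<le> ennreal B * (ennreal \<bar>t\<bar> * gg (0 + t * y))"
    proof (cases "0 < y")
      case y: True
      \<comment> \<open>The weight at \<open>y\<close> is compared with the weight at
        \<open>t * y\<close>, hence a dilation by \<open>1 / t\<close>.\<close>
      have "W y = W (t * y * (1 / t))" using t by simp
      also have "\<dots> \<le> C * max (1 / t) (1 / (1 / t)) powr \<epsilon> * W (t * y)"
        using y t by (intro C) auto
      also have "max (1 / t) (1 / (1 / t)) = max t (1 / t)" by (simp add: max.commute)
      finally have "W y * y powr \<alpha> \<le> C * max t (1 / t) powr \<epsilon> * W (t * y) * y powr \<alpha>"
        by (intro mult_right_mono) auto
      also have "\<dots> = B * (t * (W (t * y) * (t * y) powr \<alpha>))"
        using t y by (simp add: B_def powr_mult powr_diff powr_minus field_simps)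
      finally have "ennreal (W y * y powr \<alpha>) \<le> ennreal (B * (t * (W (t * y) * (t * y) powr \<alpha>)))"
        by (rule ennreal_leI)
      also have "\<dots> = ennreal B * (ennreal \<bar>t\<bar> * (ennreal (W (t * y)) * ennreal ((t * y) powr \<alpha>)))"
        using B t y W_pos[of "t * y"] by (simp add: ennreal_mult)
      finally have "G (t * y) * ennreal (W y * y powr \<alpha>)
        \<le> G (t * y) * (ennreal B * (ennreal \<bar>t\<bar> * (ennreal (W (t * y)) * ennreal ((t * y) powr \<alpha>))))"
        by (rule mult_left_mono) simp
      then show ?thesis using y t by (simp add: gg_def mult_ac)
    qed simp
  qed
  also have "\<dots> = ennreal B * (ennreal \<bar>t\<bar> * (\<integral>\<^sup>+y. gg (0 + t * y) \<partial>lborel))"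
    by (simp add: nn_integral_cmult)
  also have "ennreal \<bar>t\<bar> * (\<integral>\<^sup>+y. gg (0 + t * y) \<partial>lborel)
    = (\<integral>\<^sup>+y. gg y \<partial>lborel)"
    using t by (intro nn_integral_real_affine[symmetric]) auto
  also have "\<dots> = (\<integral>\<^sup>+y. G y \<partial>M)"
    unfolding mixed_measure_def gg_def using density_measurable
    by (subst nn_integral_density) (auto simp: mult.commute)
  also have "\<dots> = ennreal_powr (N f) q"
    unfolding mixed_norm_def G_def[abs_def] using q by (subst ennreal_powr_Lp_norm) auto
  also have "ennreal B * \<dots> = ennreal_powr (ennreal (B powr (1 / q)) * N f) q"
    using B q by (simp add: ennreal_powr_mult powr_powr)
  finally show ?thesis unfolding B_def using q by (subst (asm) ennreal_powr_le_iff) auto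
qed

theorem PP_bounded:
  "\<exists>K::real. 0 < K \<and> (\<forall>f. f \<in> borel_measurable borel \<longrightarrow> N (PP \<alpha> f) \<le> ennreal K * N f)"
proof -
  \<comment> \<open>The two bounds on \<open>\<epsilon>\<close> make the averaging integral
    converge: \<open>\<epsilon> < (1 + \<alpha>) * (q - 1)\<close> gives the exponent
    \<open>(- 1 - \<alpha> - \<epsilon>) / q + \<alpha> > - 1\<close> at zero, and
    \<open>\<epsilon> < 1 + \<alpha>\<close> gives
    \<open>(\<epsilon> - 1 - \<alpha>) / q - 1 < - 1\<close> at infinity.\<close>
  have "0 < min (1 + \<alpha>) ((1 + \<alpha>) * (q - 1))" using alpha q by simp
  then obtain \<epsilon> where "0 < \<epsilon>" "\<epsilon> < min (1 + \<alpha>) ((1 + \<alpha>) * (q - 1))"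
    using dense by blast
  then have eps: "0 < \<epsilon>" "\<epsilon> < 1 + \<alpha>" "\<epsilon> < (1 + \<alpha>) * (q - 1)" by auto
  obtain C where C: "0 \<le> C" "\<And>s t. 0 < s \<Longrightarrow> 0 < t \<Longrightarrow> W (s * t) \<le> C * max t (1 / t) powr \<epsilon> * W s"
    using W_slow[OF eps(1)] by blast
  define D where "D t = (C * max t (1 / t) powr \<epsilon> * t powr (- 1 - \<alpha>)) powr (1 / q)" for t :: real
  have D [measurable]: "D \<in> borel_measurable borel" unfolding D_def by measurable
  define J where "J = (\<integral>\<^sup>+s. ennreal (1 / norm (Complex s 1) powr (2 + \<alpha>)) \<partial>lborel)"
  have J: "J < top" unfolding J_def using alpha by (intro nn_integral_kernel_line_finite) simp
  \<comment> \<open>The norm bounds \<open>D t\<close> of the translated dilates, integrated against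
    the averaging kernel.\<close>
  define K where "K = (\<integral>\<^sup>+t. (\<integral>\<^sup>+s. ennreal (D t) * average_kernel \<alpha> t s \<partial>lborel) \<partial>lborel)"
  have "K = (\<integral>\<^sup>+t. (ennreal (D t * (t powr \<alpha> * (1 + t) powr (- 1 - \<alpha>))) * indicator {0<..} t) * J \<partial>lborel)"
    unfolding K_def
  proof (rule nn_integral_cong)
    fix t :: real
    have "(\<integral>\<^sup>+s. ennreal (D t) * average_kernel \<alpha> t s \<partial>lborel) = ennreal (D t) * (\<integral>\<^sup>+s. average_kernel \<alpha> t s \<partial>lborel)"
      by (rule nn_integral_cmult) measurable
    moreover have "0 \<le> D t" by (simp add: D_def)
    ultimately show "(\<integral>\<^sup>+s. ennreal (D t) * average_kernel \<alpha> t s \<partial>lborel)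
      = ennreal (D t * (t powr \<alpha> * (1 + t) powr (- 1 - \<alpha>))) * indicator {0<..} t * J"
      by (cases "0 < t") (simp_all add: nn_integral_average_kernel_line J_def ennreal_mult mult_ac)
  qed
  also have "\<dots> = (\<integral>\<^sup>+t. ennreal (D t * (t powr \<alpha> * (1 + t) powr (- 1 - \<alpha>))) * indicator {0<..} t \<partial>lborel) * J"
    by (rule nn_integral_multc) measurable
  also have "\<dots> < top"
  proof -
    have "(\<integral>\<^sup>+t. ennreal (D t * (t powr \<alpha> * (1 + t) powr (- 1 - \<alpha>))) * indicator {0<..} t \<partial>lborel) < top"
    proof (rule nn_integral_two_powers_finite[where a = "(- 1 - \<alpha> - \<epsilon>) / q + \<alpha>" and b = "(\<epsilon> - 1 - \<alpha>) / q - 1"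
          and C = "C powr (1 / q)"])
      have "(1 + \<alpha> + \<epsilon>) / q < 1 + \<alpha>" using eps q by (simp add: field_simps)
      then show "- 1 < (- 1 - \<alpha> - \<epsilon>) / q + \<alpha>"
      proof -
        have "(- 1 - \<alpha> - \<epsilon>) / q = - ((1 + \<alpha> + \<epsilon>) / q)"
          by (simp only: minus_divide_left) simp
        then show ?thesis using \<open>(1 + \<alpha> + \<epsilon>) / q < 1 + \<alpha>\<close> by linarith
      qed
      show "(\<epsilon> - 1 - \<alpha>) / q - 1 < - 1" using eps q by (simp add: field_simps)
    next
      fix t :: real assume t: "0 < t" "t \<le> 1"
      have m: "max t (1 / t) = 1 / t"
      proof -
        have "1 \<le> 1 / t" using t by simp
        then show ?thesis using t by (intro max_absorb2) linarith
      qed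
      have "D t = (C * t powr (- 1 - \<alpha> - \<epsilon>)) powr (1 / q)"
      proof -
        have "(1 / t) powr \<epsilon> = t powr (- \<epsilon>)" using t by (simp add: powr_divide powr_minus_divide)
        moreover have "t powr (- \<epsilon>) * t powr (- 1 - \<alpha>) = t powr (- 1 - \<alpha> - \<epsilon>)"
          by (subst powr_add[symmetric]) (simp add: algebra_simps)
        ultimately show ?thesis by (simp add: D_def m mult.assoc)
      qed
      also have "\<dots> = C powr (1 / q) * t powr ((- 1 - \<alpha> - \<epsilon>) / q)"
        using t C by (simp add: powr_mult powr_powr)
      finally have Dt: "D t = C powr (1 / q) * t powr ((- 1 - \<alpha> - \<epsilon>) / q)" .
      have "(1 + t) powr (- 1 - \<alpha>) \<le> 1 powr (- 1 - \<alpha>)"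
        using t alpha by (intro powr_mono2') auto
      then have "D t * (t powr \<alpha> * (1 + t) powr (- 1 - \<alpha>)) \<le> D t * (t powr \<alpha> * 1)"
        by (intro mult_left_mono) (auto simp: D_def)
      then show "D t * (t powr \<alpha> * (1 + t) powr (- 1 - \<alpha>)) \<le> C powr (1 / q) * t powr ((- 1 - \<alpha> - \<epsilon>) / q + \<alpha>)"
        by (simp add: Dt powr_add mult.assoc)
    next
      fix t :: real assume t: "1 < t"
      have m: "max t (1 / t) = t"
      proof -
        have "1 / t \<le> 1" using t by simp
        then show ?thesis using t by (intro max_absorb1) linarith
      qed
      have "D t = (C * t powr (\<epsilon> - 1 - \<alpha>)) powr (1 / q)"
      proof -
        have "t powr \<epsilon> * t powr (- 1 - \<alpha>) = t powr (\<epsilon> - 1 - \<alpha>)"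
          by (subst powr_add[symmetric]) (simp add: algebra_simps)
        then show ?thesis by (simp add: D_def m mult.assoc)
      qed
      also have "\<dots> = C powr (1 / q) * t powr ((\<epsilon> - 1 - \<alpha>) / q)"
        using t C by (simp add: powr_mult powr_powr)
      finally have Dt: "D t = C powr (1 / q) * t powr ((\<epsilon> - 1 - \<alpha>) / q)" .
      have "(1 + t) powr (- 1 - \<alpha>) \<le> t powr (- 1 - \<alpha>)"
        using t alpha by (intro powr_mono2') auto
      then have "D t * (t powr \<alpha> * (1 + t) powr (- 1 - \<alpha>)) \<le> D t * (t powr \<alpha> * t powr (- 1 - \<alpha>))"
        by (intro mult_left_mono) (auto simp: D_def)
      also have "\<dots> = C powr (1 / q) * (t powr ((\<epsilon> - 1 - \<alpha>) / q) * t powr (- 1))"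
        using t by (simp add: Dt powr_add[symmetric])
      also have "t powr ((\<epsilon> - 1 - \<alpha>) / q) * t powr (- 1) = t powr ((\<epsilon> - 1 - \<alpha>) / q - 1)"
        by (subst powr_add[symmetric]) simp
      finally show "D t * (t powr \<alpha> * (1 + t) powr (- 1 - \<alpha>)) \<le> C powr (1 / q) * t powr ((\<epsilon> - 1 - \<alpha>) / q - 1)" .
    qed auto
    then show ?thesis using J by (simp add: ennreal_mult_less_top)
  qed
  finally have K: "K < top" .
  have main: "N (PP \<alpha> f) \<le> K * N f" if f [measurable]: "f \<in> borel_measurable borel" for f
  proof -
    define h where "h x = f (Complex (Re (snd x) + Im (snd x) * snd (fst x)) (fst (fst x) * Im (snd x)))
      * average_kernel \<alpha> (fst (fst x)) (snd (fst x))" for x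
    have h [measurable]: "h \<in> borel_measurable ((lborel \<Otimes>\<^sub>M lborel) \<Otimes>\<^sub>M borel)"
      unfolding h_def by measurable
    have "N (PP \<alpha> f) = N (\<lambda>z. \<integral>\<^sup>+ts. h (ts, z) \<partial>(lborel \<Otimes>\<^sub>M lborel))"
    proof (rule N_cong)
      fix z assume "z \<in> upper_half_plane"
      then have "PP \<alpha> f z = (\<integral>\<^sup>+t. (\<integral>\<^sup>+s. h ((t, s), z) \<partial>lborel) \<partial>lborel)"
        by (simp add: PP_eq_average upper_half_plane_def h_def)
      also have "\<dots> = (\<integral>\<^sup>+ts. h (ts, z) \<partial>(lborel \<Otimes>\<^sub>M lborel))"
        by (rule lborel.nn_integral_fst) measurable
      finally show "PP \<alpha> f z = (\<integral>\<^sup>+ts. h (ts, z) \<partial>(lborel \<Otimes>\<^sub>M lborel))" .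
    qed
    also have "\<dots> \<le> (\<integral>\<^sup>+ts. N (\<lambda>z. h (ts, z)) \<partial>(lborel \<Otimes>\<^sub>M lborel))"
      by (intro N_integral_le h lborel_pair.sigma_finite_measure_axioms)
    also have "\<dots> \<le> (\<integral>\<^sup>+ts. (case ts of (t, s) \<Rightarrow> ennreal (D t) * average_kernel \<alpha> t s * N f) \<partial>(lborel \<Otimes>\<^sub>M lborel))"
    proof (rule nn_integral_mono)
      fix ts :: "real \<times> real"
      obtain t s where ts: "ts = (t, s)" by force
      show "N (\<lambda>z. h (ts, z)) \<le> (case ts of (t, s) \<Rightarrow> ennreal (D t) * average_kernel \<alpha> t s * N f)"
      proof (cases "0 < t")
        case True
        have "N (\<lambda>z. h (ts, z)) = N (\<lambda>z. average_kernel \<alpha> t s * f (Complex (Re z + Im z * s) (t * Im z)))"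
          by (simp add: h_def ts mult.commute)
        also have "\<dots> = average_kernel \<alpha> t s * N (\<lambda>z. f (Complex (Re z + Im z * s) (t * Im z)))"
          by (rule N_cmult) measurable
        also have "\<dots> \<le> average_kernel \<alpha> t s * (ennreal (D t) * N f)"
          unfolding D_def using True C by (intro mult_left_mono N_dilation) auto
        finally show ?thesis by (simp add: ts mult_ac)
      next
        case False
        then have "(\<lambda>z. h (ts, z)) = (\<lambda>z. 0 * 0)" by (simp add: h_def ts average_kernel_def)
        then show ?thesis using N_cmult[of "\<lambda>_. 0" 0] by simp
      qed
    qed
    also have "\<dots> = (\<integral>\<^sup>+ts. (case ts of (t, s) \<Rightarrow> ennreal (D t) * average_kernel \<alpha> t s) * N f \<partial>(lborel \<Otimes>\<^sub>M lborel))"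
      by (simp add: split_def)
    also have "\<dots> = (\<integral>\<^sup>+ts. (case ts of (t, s) \<Rightarrow> ennreal (D t) * average_kernel \<alpha> t s) \<partial>(lborel \<Otimes>\<^sub>M lborel)) * N f"
      by (rule nn_integral_multc) measurable
    also have "(\<integral>\<^sup>+ts. (case ts of (t, s) \<Rightarrow> ennreal (D t) * average_kernel \<alpha> t s) \<partial>(lborel \<Otimes>\<^sub>M lborel)) = K"
      unfolding K_def by (subst lborel.nn_integral_fst[symmetric]) auto
    finally show ?thesis .
  qed
  obtain k where k: "0 \<le> k" "K = ennreal k" using K by (cases K) auto
  \<comment> \<open>\<open>k + 1\<close> instead of \<open>k\<close> because the constant has to be
    positive.\<close>
  have "N (PP \<alpha> f) \<le> ennreal (k + 1) * N f" if "f \<in> borel_measurable borel" for f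
  proof -
    have "N (PP \<alpha> f) \<le> K * N f" using main[OF that] .
    also have "\<dots> \<le> ennreal (k + 1) * N f" unfolding k(2) by (intro mult_right_mono ennreal_leI) auto
    finally show ?thesis .
  qed
  then show ?thesis using k(1) by (intro exI[of _ "k + 1"]) auto
qed

text \<open>Boundedness makes \<open>N (PP \<alpha> f)\<close> finite, so some line and some point
  on it carry a finite value, and \<open>PP_finite_transfer\<close> takes finiteness to every
  point.\<close>

lemma PP_finite:
  assumes f [measurable]: "f \<in> borel_measurable borel" and Nf: "N f < top" and z: "z \<in> upper_half_plane"
  shows "PP \<alpha> f z < top"
proof -
  obtain K :: real where "N (PP \<alpha> f) \<le> ennreal K * N f" using PP_bounded f by blast
  also have "\<dots> < top" using Nf by (simp add: ennreal_mult_less_top)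
  finally have "ennreal_powr (N (PP \<alpha> f)) q < top" by simp
  then have "(\<integral>\<^sup>+y. ennreal_powr (Lp_norm lborel p (\<lambda>x. PP \<alpha> f (Complex x y))) q \<partial>M) < top"
    unfolding mixed_norm_def using q by (subst (asm) ennreal_powr_Lp_norm) auto
  then have "AE y in M. ennreal_powr (Lp_norm lborel p (\<lambda>x. PP \<alpha> f (Complex x y))) q \<noteq> \<infinity>"
    by (intro nn_integral_noteq_infinite) auto
  then have "AE y in M. Lp_norm lborel p (\<lambda>x. PP \<alpha> f (Complex x y)) \<noteq> top \<and> 0 < y"
    using AE_M_pos by eventually_elim auto
  then obtain y where y: "Lp_norm lborel p (\<lambda>x. PP \<alpha> f (Complex x y)) \<noteq> top" "0 < y"
    using AE_witness[OF _ M_nontrivial] by blast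
  then have "(\<integral>\<^sup>+x. ennreal_powr (PP \<alpha> f (Complex x y)) p \<partial>lborel) \<noteq> \<infinity>"
    by (simp add: Lp_norm_def)
  then have "AE x in lborel. ennreal_powr (PP \<alpha> f (Complex x y)) p \<noteq> \<infinity>"
    by (intro nn_integral_noteq_infinite) auto
  then obtain x where "ennreal_powr (PP \<alpha> f (Complex x y)) p \<noteq> \<infinity>"
    using AE_witness[OF _ lborel_nontrivial] by blast
  then have "PP \<alpha> f (Complex x y) < top" by (simp add: less_top)
  then show ?thesis
    using y z by (intro PP_finite_transfer[OF f alpha z, of "Complex x y"]) (auto simp: upper_half_plane_def)
qed

text \<open>Dominated convergence on each line whose slice norm is finite, then dominated
  convergence in \<open>y\<close> with the full slice norms as majorant.\<close>

lemma N_tail_tendsto_0: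
  assumes f [measurable]: "f \<in> borel_measurable borel" and Nf: "N f < top"
    and A [measurable]: "\<And>n. A n \<in> sets borel" and dec: "decseq A" "(\<Inter>n. A n) = {}"
  shows "(\<lambda>n. N (\<lambda>z. f z * indicator (A n) z)) \<longlonglongrightarrow> 0"
proof -
  have lim0: "(\<lambda>n. (\<integral>\<^sup>+x. g n x \<partial>X)) \<longlonglongrightarrow> 0"
    if [measurable]: "\<And>n. g n \<in> borel_measurable X" "h \<in> borel_measurable X" and bd: "\<And>n x. g n x \<le> h x" and fin: "(\<integral>\<^sup>+x. h x \<partial>X) < \<infinity>"
      and lim: "AE x in X. (\<lambda>n. g n x) \<longlonglongrightarrow> 0" for X :: "real measure" and g h
    using nn_integral_dominated_convergence[OF that(1), of "\<lambda>_. 0" h] that by simp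
  have ev: "\<forall>\<^sub>F n in sequentially. z \<notin> A n" for z
  proof -
    obtain m where "z \<notin> A m" using dec(2) by blast
    then have "z \<notin> A n" if "m \<le> n" for n using that dec(1) by (auto simp: decseq_def)
    then show ?thesis unfolding eventually_sequentially by blast
  qed
  define G where "G n y = Lp_norm lborel p (\<lambda>x. f (Complex x y) * indicator (A n) (Complex x y))" for n y
  define H where "H y = Lp_norm lborel p (\<lambda>x. f (Complex x y))" for y
  have [measurable]: "G n \<in> borel_measurable M" for n unfolding G_def Lp_norm_def by measurable
  have [measurable]: "H \<in> borel_measurable M" unfolding H_def Lp_norm_def by measurable
  have GH: "G n y \<le> H y" for n y
    unfolding G_def H_def using p by (intro Lp_norm_mono) (auto split: split_indicator)
  have HI: "(\<integral>\<^sup>+y. ennreal_powr (H y) q \<partial>M) < \<infinity>"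
    using Nf ennreal_powr_less_top_iff[of "N f" q] unfolding mixed_norm_def H_def
    using q by (subst (asm) ennreal_powr_Lp_norm) auto
  have "(\<lambda>n. \<integral>\<^sup>+y. ennreal_powr (G n y) q \<partial>M) \<longlonglongrightarrow> 0"
  proof (rule lim0[where h = "\<lambda>y. ennreal_powr (H y) q"])
    have "AE y in M. ennreal_powr (H y) q \<noteq> \<infinity>"
      using HI by (intro nn_integral_noteq_infinite) auto
    then show "AE y in M. (\<lambda>n. ennreal_powr (G n y) q) \<longlonglongrightarrow> 0"
    proof eventually_elim
      case (elim y)
      then have fin: "(\<integral>\<^sup>+x. ennreal_powr (f (Complex x y)) p \<partial>lborel) < \<infinity>"
        by (simp add: H_def Lp_norm_def less_top)
      have "(\<lambda>n. \<integral>\<^sup>+x. ennreal_powr (f (Complex x y) * indicator (A n) (Complex x y)) p \<partial>lborel) \<longlonglongrightarrow> 0"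
      proof (rule lim0[OF _ _ _ fin])
        show "AE x in lborel. (\<lambda>n. ennreal_powr (f (Complex x y) * indicator (A n) (Complex x y)) p) \<longlonglongrightarrow> 0"
        proof (intro AE_I2 tendsto_eventually)
          fix x
          show "\<forall>\<^sub>F n in sequentially. ennreal_powr (f (Complex x y) * indicator (A n) (Complex x y)) p = 0"
            using ev[of "Complex x y"] by eventually_elim simp
        qed
      qed (use p in \<open>auto intro!: ennreal_powr_mono split: split_indicator\<close>)
      then show ?case unfolding G_def Lp_norm_def using p q
        by (intro tendsto_ennreal_powr_0) auto
    qed
  qed (use HI q in \<open>auto intro!: ennreal_powr_mono GH\<close>)
  then have "(\<lambda>n. ennreal_powr (\<integral>\<^sup>+y. ennreal_powr (G n y) q \<partial>M) (1 / q)) \<longlonglongrightarrow> 0"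
    using q by (intro tendsto_ennreal_powr_0) auto
  then show ?thesis by (simp add: mixed_norm_def Lp_norm_def[of M] G_def)
qed

end

subsection \<open>Conformal change of variables\<close>

text \<open>The change of variables theorem of the library is stated on \<open>real ^ 2\<close>.\<close>

definition vec_of_complex :: "complex \<Rightarrow> real ^ 2" where
  "vec_of_complex z = vector [Re z, Im z]"

definition complex_of_vec :: "real ^ 2 \<Rightarrow> complex" where
  "complex_of_vec v = Complex (v $ 1) (v $ 2)"

lemma complex_of_vec_inverse [simp]:
  "complex_of_vec (vec_of_complex z) = z" "vec_of_complex (complex_of_vec v) = v"
  by (auto simp: vec_of_complex_def complex_of_vec_def vec_eq_iff forall_2)

lemma bounded_linear_vec_of_complex: "bounded_linear vec_of_complex"
  unfolding linear_conv_bounded_linear[symmetric]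
  by (intro linearI) (auto simp: vec_of_complex_def vec_eq_iff forall_2)

lemma bounded_linear_complex_of_vec: "bounded_linear complex_of_vec"
  unfolding linear_conv_bounded_linear[symmetric]
  by (intro linearI) (auto simp: complex_of_vec_def complex_eq_iff)

lemma complex_of_vec_measurable [measurable]: "complex_of_vec \<in> borel \<rightarrow>\<^sub>M borel"
  by (intro borel_measurable_continuous_onI linear_continuous_on bounded_linear_complex_of_vec)

lemma prod_Basis_vec:
  fixes w :: "real ^ 'n"
  shows "(\<Prod>b\<in>Basis. w \<bullet> b) = (\<Prod>i\<in>UNIV. w $ i)"
proof -
  have B: "(Basis :: (real ^ 'n) set) = range (\<lambda>i. axis i 1)" by (auto simp: Basis_vec_def)
  have "inj (\<lambda>i::'n. axis i (1::real))" by (simp add: inj_on_def axis_eq_axis)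
  then show ?thesis
    unfolding B by (subst prod.reindex) (auto simp: inner_axis)
qed

lemma lborel_complex_vec: "(lborel :: complex measure) = distr (lborel :: (real ^ 2) measure) borel complex_of_vec"
proof (rule lborel_eqI)
  fix l u :: complex assume le: "\<And>b. b \<in> Basis \<Longrightarrow> l \<bullet> b \<le> u \<bullet> b"
  have le': "Re l \<le> Re u" "Im l \<le> Im u"
    using le[of 1] le[of \<i>] by (auto simp: Basis_complex_def)
  have eq: "complex_of_vec -` box l u = box (vec_of_complex l) (vec_of_complex u)"
    by (auto simp: mem_box_cart forall_2 vec_of_complex_def complex_of_vec_def in_box_complex_iff)
  have "vec_of_complex l $ i \<le> vec_of_complex u $ i" for i
    using exhaust_2[of i] le' by (auto simp: vec_of_complex_def)
  then have "emeasure lborel (box (vec_of_complex l) (vec_of_complex u)) = ennreal (\<Prod>i\<in>UNIV. (vec_of_complex u - vec_of_complex l) $ i)"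
    unfolding prod_Basis_vec[symmetric]
    by (intro emeasure_lborel_box) (auto simp: Basis_vec_def inner_axis)
  also have "(\<Prod>i\<in>UNIV. (vec_of_complex u - vec_of_complex l) $ i) = (\<Prod>b\<in>Basis. (u - l) \<bullet> b)"
    by (simp add: UNIV_2 vec_of_complex_def Basis_complex_def)
  finally show "emeasure (distr lborel borel complex_of_vec) (box l u) = (\<Prod>b\<in>Basis. (u - l) \<bullet> b)"
    by (simp add: emeasure_distr eq)
qed simp

lemma det_complex_mult: "det (matrix (\<lambda>v. vec_of_complex (a * complex_of_vec v))) = (norm a)\<^sup>2"
  unfolding cmod_power2
  by (simp add: det_2 matrix_def vec_of_complex_def complex_of_vec_def axis_def power2_eq_square)

text \<open>The image is Borel because it is a preimage under the continuous inverse of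
  \<open>g\<close> on the open image of \<open>D\<close>. The formula is the real change of
  variables; by the Cauchy-Riemann equations its determinant is the squared modulus of
  \<open>deriv g\<close>.\<close>

lemma conformal_emeasure:
  assumes D: "open D" and g: "g holomorphic_on D" and inj: "inj_on g D"
    and A [measurable]: "A \<in> sets borel" and AD: "A \<subseteq> D"
  shows "g ` A \<in> sets borel"
    and "emeasure lborel (g ` A) = (\<integral>\<^sup>+\<zeta>. ennreal ((norm (deriv g \<zeta>))\<^sup>2) * indicator A \<zeta> \<partial>lborel)"
proof -
  obtain h where h: "h holomorphic_on (g ` D)" "\<And>z. z \<in> D \<Longrightarrow> h (g z) = z"
    using holomorphic_has_inverse[OF g D inj] by metis
  have op: "open (g ` D)" by (rule open_mapping_thm3[OF g D inj])
  have "h \<in> restrict_space borel (g ` D) \<rightarrow>\<^sub>M borel"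
    using h(1) by (intro borel_measurable_continuous_on_restrict holomorphic_on_imp_continuous_on)
  then have "h -` A \<inter> (g ` D) \<in> sets (restrict_space borel (g ` D))"
    using measurable_sets[OF _ A, of h "restrict_space borel (g ` D)"] by (simp add: space_restrict_space)
  then have "h -` A \<inter> (g ` D) \<in> sets borel"
    using op by (subst (asm) sets_restrict_space_iff) auto
  moreover have "h -` A \<inter> (g ` D) = g ` A"
    using AD h(2) by (auto simp: image_iff)
  ultimately show gA: "g ` A \<in> sets borel" by simp
  define S where "S = complex_of_vec -` A"
  have S [measurable]: "S \<in> sets borel"
    using measurable_sets[OF complex_of_vec_measurable A] by (simp add: S_def)
  define G where "G = (\<lambda>x. vec_of_complex (g (complex_of_vec x)))"
  define \<rho> where "\<rho> x = (norm (deriv g (complex_of_vec x)))\<^sup>2" for x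
  have der: "(G has_derivative (\<lambda>v. vec_of_complex (deriv g (complex_of_vec x) * complex_of_vec v))) (at x within S)"
    if "x \<in> S" for x
  proof -
    have "complex_of_vec x \<in> D" using that AD by (auto simp: S_def)
    then have "(g has_derivative (*) (deriv g (complex_of_vec x))) (at (complex_of_vec x))"
      using g D by (intro has_field_derivative_imp_has_derivative holomorphic_derivI)
    from has_derivative_compose[OF bounded_linear_imp_has_derivative[OF bounded_linear_complex_of_vec] this]
    have "((\<lambda>x. g (complex_of_vec x)) has_derivative (\<lambda>v. deriv g (complex_of_vec x) * complex_of_vec v)) (at x)" .
    from has_derivative_compose[OF this bounded_linear_imp_has_derivative[OF bounded_linear_vec_of_complex]]
    show ?thesis unfolding G_def by (rule has_derivative_at_withinI)
  qed
  have injG: "inj_on G S"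
  proof (rule inj_onI)
    fix x y assume "x \<in> S" "y \<in> S" "G x = G y"
    then have "g (complex_of_vec x) = g (complex_of_vec y)"
      unfolding G_def by (metis complex_of_vec_inverse(1))
    then have "complex_of_vec x = complex_of_vec y"
      using inj \<open>x \<in> S\<close> \<open>y \<in> S\<close> AD by (auto simp: S_def inj_on_def)
    then show "x = y" by (metis complex_of_vec_inverse(2))
  qed
  have GS: "G ` S = complex_of_vec -` (g ` A)"
  proof (intro set_eqI iffI)
    fix v assume "v \<in> complex_of_vec -` (g ` A)"
    then obtain a where a: "a \<in> A" "complex_of_vec v = g a" by auto
    then have "v = G (vec_of_complex a)" unfolding G_def by (metis complex_of_vec_inverse)
    then show "v \<in> G ` S" using a by (auto simp: S_def)
  qed (auto simp: G_def S_def)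
  have GSb: "G ` S \<in> sets borel"
    using measurable_sets[OF complex_of_vec_measurable gA] by (simp add: GS)
  have em: "emeasure lborel (g ` A) = emeasure lborel (G ` S)"
    using gA by (subst lborel_complex_vec) (simp add: emeasure_distr GS)
  have Sl: "S \<in> sets lebesgue" using S by simp
  note key = has_measure_differentiable_image[OF Sl der injG, unfolded det_complex_mult]
  define I where "I = (\<integral>\<^sup>+\<zeta>. ennreal ((norm (deriv g \<zeta>))\<^sup>2) * indicator A \<zeta> \<partial>lborel)"
  have derm: "(\<lambda>\<zeta>. indicator A \<zeta> *\<^sub>R (norm (deriv g \<zeta>))\<^sup>2) \<in> borel_measurable borel"
  proof (rule borel_measurable_continuous_on_indicator)
    have "continuous_on A (deriv g)"
      using holomorphic_deriv[OF g D] AD holomorphic_on_imp_continuous_on continuous_on_subset by blast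
    then show "continuous_on A (\<lambda>\<zeta>. (norm (deriv g \<zeta>))\<^sup>2)" by (intro continuous_intros)
  qed simp
  then have [measurable]: "(\<lambda>\<zeta>. ennreal ((norm (deriv g \<zeta>))\<^sup>2) * indicator A \<zeta>) \<in> borel_measurable borel"
  proof -
    have "(\<lambda>\<zeta>. ennreal ((norm (deriv g \<zeta>))\<^sup>2) * indicator A \<zeta>) = (\<lambda>\<zeta>. ennreal (indicator A \<zeta> *\<^sub>R (norm (deriv g \<zeta>))\<^sup>2))"
      by (auto simp: fun_eq_iff split: split_indicator)
    then show ?thesis using derm by simp
  qed
  have rhom [measurable]: "(\<lambda>x. indicator S x *\<^sub>R \<rho> x) \<in> borel_measurable borel"
  proof -
    have "(\<lambda>x. indicator S x *\<^sub>R \<rho> x) = (\<lambda>x. indicator A (complex_of_vec x) *\<^sub>R (norm (deriv g (complex_of_vec x)))\<^sup>2)"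
      by (auto simp: \<rho>_def S_def fun_eq_iff split: split_indicator)
    then show ?thesis using measurable_compose[OF complex_of_vec_measurable derm] by simp
  qed
  have I: "I = (\<integral>\<^sup>+x. ennreal (\<rho> x) * indicator S x \<partial>lborel)"
    unfolding I_def by (subst lborel_complex_vec)
      (simp add: nn_integral_distr \<rho>_def S_def indicator_vimage)
  \<comment> \<open>The equivalence \<open>key\<close> concerns finite values. \<open>i1\<close> and
    \<open>i2\<close> together also settle infinite ones, because finiteness of either side forces
    that of the other.\<close>
  have i1: "emeasure lborel (G ` S) = I" if "emeasure lborel (G ` S) < top"
  proof -
    have "G ` S \<in> lmeasurable" using that GSb by (intro fmeasurableI) auto
    then have *: "(\<rho> has_integral measure lebesgue (G ` S)) S"
      using key by (auto simp: \<rho>_def[abs_def])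
    have "I = ennreal (measure lebesgue (G ` S))"
      unfolding I by (rule nn_integral_has_integral_lebesgue'[OF _ *]) (simp add: \<rho>_def)
    then show ?thesis using that GSb by (simp add: measure_def less_top)
  qed
  have i2: "emeasure lborel (G ` S) < top" if "I < top"
  proof -
    obtain r where r: "0 \<le> r" "I = ennreal r" using \<open>I < top\<close> by (cases I) auto
    have eq: "(\<lambda>x. ennreal (indicator S x *\<^sub>R \<rho> x)) = (\<lambda>x. ennreal (\<rho> x) * indicator S x)"
      by (auto simp: fun_eq_iff split: split_indicator)
    have "((\<lambda>x. indicator S x *\<^sub>R \<rho> x) has_integral r) UNIV"
    proof (rule nn_integral_has_integral)
      show "(\<integral>\<^sup>+x. ennreal (indicator S x *\<^sub>R \<rho> x) \<partial>lborel) = ennreal r"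
        using r(2) unfolding eq I .
    qed (use r rhom in \<open>auto simp: \<rho>_def\<close>)
    also have "(\<lambda>x. indicator S x *\<^sub>R \<rho> x) = (\<lambda>x. if x \<in> S then \<rho> x else 0)"
      by (auto simp: fun_eq_iff)
    finally have "(\<rho> has_integral r) S" by (simp only: has_integral_restrict_UNIV)
    then have "G ` S \<in> lmeasurable" using key by (auto simp: \<rho>_def[abs_def])
    then show ?thesis using GSb by (auto simp: fmeasurable_def)
  qed
  show "emeasure lborel (g ` A) = (\<integral>\<^sup>+\<zeta>. ennreal ((norm (deriv g \<zeta>))\<^sup>2) * indicator A \<zeta> \<partial>lborel)"
    unfolding em I_def[symmetric] using i1 i2 by (metis less_top)
qed

text \<open>Lebesgue measure on the image of \<open>D\<close> is the push-forward under
  \<open>g\<close> of the measure on \<open>D\<close> whose density is the squared modulus of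
  \<open>deriv g\<close>. This equality of measures settles integrability and the value of the
  integral at once.\<close>

lemma conformal_integral:
  fixes f :: "complex \<Rightarrow> complex"
  assumes D: "open D" and g: "g holomorphic_on D" and inj: "inj_on g D"
    and f: "(\<lambda>w. indicator (g ` D) w *\<^sub>R f w) \<in> borel_measurable borel"
  shows "integrable lborel (\<lambda>w. indicator (g ` D) w *\<^sub>R f w) \<longleftrightarrow>
      integrable lborel (\<lambda>\<zeta>. indicator D \<zeta> *\<^sub>R ((norm (deriv g \<zeta>))\<^sup>2 *\<^sub>R f (g \<zeta>)))" (is ?A)
    and "(\<integral>w. indicator (g ` D) w *\<^sub>R f w \<partial>lborel)
      = (\<integral>\<zeta>. indicator D \<zeta> *\<^sub>R ((norm (deriv g \<zeta>))\<^sup>2 *\<^sub>R f (g \<zeta>)) \<partial>lborel)" (is ?B)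
proof -
  have op: "open (g ` D)" by (rule open_mapping_thm3[OF g D inj])
  \<comment> \<open>Extension of \<open>g\<close> by zero, which is Borel measurable on the whole
    plane; the density \<open>\<rho>\<close> vanishes off \<open>D\<close>, so the values there have
    no influence.\<close>
  define k where "k \<zeta> = indicator D \<zeta> *\<^sub>R g \<zeta>" for \<zeta>
  define \<rho> where "\<rho> \<zeta> = indicator D \<zeta> *\<^sub>R (norm (deriv g \<zeta>))\<^sup>2" for \<zeta>
  have k [measurable]: "k \<in> borel_measurable borel"
    unfolding k_def using D g
    by (intro borel_measurable_continuous_on_indicator) (auto intro: holomorphic_on_imp_continuous_on)
  have rho [measurable]: "\<rho> \<in> borel_measurable borel"
    unfolding \<rho>_def using D g
    by (intro borel_measurable_continuous_on_indicator)
      (auto intro!: continuous_intros holomorphic_on_imp_continuous_on holomorphic_deriv)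
  have eq: "density lborel (\<lambda>w. ennreal (indicator (g ` D) w)) = distr (density lborel (\<lambda>\<zeta>. ennreal (\<rho> \<zeta>))) borel k"
  proof (rule measure_eqI)
    fix B assume "B \<in> sets (density lborel (\<lambda>w. ennreal (indicator (g ` D) w)))"
    then have B [measurable]: "B \<in> sets borel" by simp
    define A where "A = D \<inter> k -` B"
    have A: "A \<in> sets borel" unfolding A_def
      using D measurable_sets[OF k B] by (intro sets.Int) auto
    have gA: "g ` A = g ` D \<inter> B" by (auto simp: A_def k_def)
    have "emeasure (density lborel (\<lambda>w. ennreal (indicator (g ` D) w))) B = emeasure lborel (g ` A)"
      using op by (simp add: emeasure_density gA ennreal_indicator indicator_inter_arith[symmetric] sets.Int)
    also have "\<dots> = (\<integral>\<^sup>+\<zeta>. ennreal ((norm (deriv g \<zeta>))\<^sup>2) * indicator A \<zeta> \<partial>lborel)"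
      by (rule conformal_emeasure(2)[OF D g inj A]) (auto simp: A_def)
    also have "\<dots> = (\<integral>\<^sup>+\<zeta>. ennreal (\<rho> \<zeta>) * indicator (k -` B) \<zeta> \<partial>lborel)"
      by (intro nn_integral_cong) (auto simp: \<rho>_def A_def split: split_indicator)
    also have "\<dots> = emeasure (density lborel (\<lambda>\<zeta>. ennreal (\<rho> \<zeta>))) (k -` B)"
      using measurable_sets[OF k B] by (intro emeasure_density[symmetric]) auto
    also have "\<dots> = emeasure (distr (density lborel (\<lambda>\<zeta>. ennreal (\<rho> \<zeta>))) borel k) B"
      by (simp add: emeasure_distr)
    finally show "emeasure (density lborel (\<lambda>w. ennreal (indicator (g ` D) w))) B
      = emeasure (distr (density lborel (\<lambda>\<zeta>. ennreal (\<rho> \<zeta>))) borel k) B" .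
  qed simp
  define f0 where "f0 w = indicator (g ` D) w *\<^sub>R f w" for w
  have f0 [measurable]: "f0 \<in> borel_measurable borel" using f unfolding f0_def[abs_def] .
  have e1: "(\<lambda>w. indicator (g ` D) w *\<^sub>R f0 w) = f0" by (auto simp: f0_def fun_eq_iff split: split_indicator)
  have e2: "(\<lambda>\<zeta>. \<rho> \<zeta> *\<^sub>R f0 (k \<zeta>)) = (\<lambda>\<zeta>. indicator D \<zeta> *\<^sub>R ((norm (deriv g \<zeta>))\<^sup>2 *\<^sub>R f (g \<zeta>)))"
    by (auto simp: \<rho>_def f0_def k_def fun_eq_iff split: split_indicator)
  have pos: "AE \<zeta> in lborel. 0 \<le> \<rho> \<zeta>" by (simp add: \<rho>_def)
  have [measurable]: "g ` D \<in> sets borel" using op by simp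
  have "integrable lborel f0 \<longleftrightarrow> integrable (density lborel (\<lambda>w. ennreal (indicator (g ` D) w))) f0"
    by (subst integrable_density) (auto simp: e1)
  also have "\<dots> \<longleftrightarrow> integrable (density lborel (\<lambda>\<zeta>. ennreal (\<rho> \<zeta>))) (\<lambda>\<zeta>. f0 (k \<zeta>))"
    unfolding eq by (rule integrable_distr_eq) auto
  also have "\<dots> \<longleftrightarrow> integrable lborel (\<lambda>\<zeta>. \<rho> \<zeta> *\<^sub>R f0 (k \<zeta>))"
    by (intro integrable_density pos) auto
  finally show ?A by (simp add: e2 f0_def[symmetric])
  have "integral\<^sup>L lborel f0 = integral\<^sup>L (density lborel (\<lambda>w. ennreal (indicator (g ` D) w))) f0"
    by (subst integral_density) (auto simp: e1)
  also have "\<dots> = integral\<^sup>L (density lborel (\<lambda>\<zeta>. ennreal (\<rho> \<zeta>))) (\<lambda>\<zeta>. f0 (k \<zeta>))"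
    unfolding eq by (rule integral_distr) auto
  also have "\<dots> = integral\<^sup>L lborel (\<lambda>\<zeta>. \<rho> \<zeta> *\<^sub>R f0 (k \<zeta>))"
    by (intro integral_density pos) auto
  finally show ?B by (simp add: e2 f0_def[symmetric])
qed

subsection \<open>The mean value property on the disc\<close>

text \<open>Cauchy's integral formula at the centre for \<open>u \<mapsto> G (u * \<zeta>)\<close>.
  The circle is written as the set of rotations of one point \<open>\<zeta>\<close>, the form needed
  for averaging over rotations.\<close>

lemma circle_mean_value:
  assumes G: "G holomorphic_on ball 0 1" and \<zeta>: "norm \<zeta> < 1"
  shows "(\<integral>\<theta>. indicator {0..1} \<theta> *\<^sub>R G (exp (2 * of_real pi * \<i> * of_real \<theta>) * \<zeta>) \<partial>lborel) = G 0"
proof -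
  define f where "f u = G (u * \<zeta>)" for u
  have sub: "(\<lambda>u. u * \<zeta>) ` cball 0 1 \<subseteq> ball 0 1"
  proof -
    have "norm u * norm \<zeta> < 1" if "norm u \<le> 1" for u :: complex
      using that \<zeta> mult_right_mono[of "norm u" 1 "norm \<zeta>"] by simp
    then show ?thesis by (auto simp: norm_mult)
  qed
  have "(G \<circ> (\<lambda>u. u * \<zeta>)) holomorphic_on cball 0 1"
    using G sub by (intro holomorphic_on_compose_gen[of _ _ G "ball 0 1"]) (auto intro!: holomorphic_intros)
  then have f: "f holomorphic_on cball 0 1" by (simp add: f_def[abs_def] o_def)
  have "((\<lambda>u. f u / (u - 0)) has_contour_integral (2 * of_real pi * \<i> * f 0)) (circlepath 0 1)"
    using Cauchy_integral_circlepath_simple[OF f, of 0] by simp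
  then have "((\<lambda>x. f (circlepath 0 1 x) / circlepath 0 1 x * (2 * of_real pi * \<i> * exp (2 * of_real pi * \<i> * of_real x)))
      has_integral (2 * of_real pi * \<i> * f 0)) {0..1}"
    by (simp add: has_contour_integral vector_derivative_circlepath)
  then have "((\<lambda>x. 2 * of_real pi * \<i> * f (exp (2 * of_real pi * \<i> * of_real x))) has_integral (2 * of_real pi * \<i> * f 0)) {0..1}"
    by (simp add: circlepath mult_ac)
  then have *: "((\<lambda>x. f (exp (2 * of_real pi * \<i> * of_real x))) has_integral f 0) {0..1}"
    by (subst (asm) has_integral_mult_right_iff) auto
  have cont: "continuous_on {0..1} (\<lambda>x::real. f (exp (2 * of_real pi * \<i> * of_real x)))"
    by (rule continuous_on_compose2[OF holomorphic_on_imp_continuous_on[OF f]])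
      (auto intro!: continuous_intros)
  then have "set_integrable lborel {0..1} (\<lambda>x. f (exp (2 * of_real pi * \<i> * of_real x)))"
    by (rule borel_integrable_atLeastAtMost')
  from set_borel_integral_eq_integral(2)[OF this] integral_unique[OF *]
  show ?thesis by (simp add: f_def set_lebesgue_integral_def)
qed

definition disc_mass :: "real \<Rightarrow> real" where
  "disc_mass \<alpha> = (\<integral>\<zeta>. indicator (ball 0 1) \<zeta> *\<^sub>R (1 - (norm \<zeta>)\<^sup>2) powr \<alpha> \<partial>(lborel :: complex measure))"

text \<open>A rotation is conformal with derivative of modulus one and maps the unit disc onto
  itself; the support condition confines the change of variables to that disc.\<close>

lemma rotation_integral:
  fixes f :: "complex \<Rightarrow> complex"
  assumes u: "norm u = 1" and f: "f \<in> borel_measurable borel" and supp: "\<And>\<zeta>. 1 \<le> norm \<zeta> \<Longrightarrow> f \<zeta> = 0"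
  shows "integrable lborel (\<lambda>\<zeta>. f (u * \<zeta>)) \<longleftrightarrow> integrable lborel f"
    and "(\<integral>\<zeta>. f (u * \<zeta>) \<partial>lborel) = (\<integral>\<zeta>. f \<zeta> \<partial>lborel)"
proof -
  have img: "(\<lambda>\<zeta>. u * \<zeta>) ` ball 0 1 = ball 0 1"
  proof (intro equalityI subsetI)
    fix x :: complex assume "x \<in> ball 0 1"
    then have "x = u * (x / u)" "x / u \<in> ball 0 1" using u by (auto simp: norm_divide)
    then show "x \<in> (\<lambda>\<zeta>. u * \<zeta>) ` ball 0 1" by blast
  qed (auto simp: norm_mult u)
  have inj: "inj_on (\<lambda>\<zeta>. u * \<zeta>) (ball 0 1)" using u by (auto simp: inj_on_def)
  have hol: "(\<lambda>\<zeta>. u * \<zeta>) holomorphic_on ball 0 1" by (intro holomorphic_intros)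
  have "deriv (\<lambda>\<zeta>. u * \<zeta>) \<zeta> = u" for \<zeta>
    by (rule DERIV_imp_deriv) (auto intro!: derivative_eq_intros)
  then have eq: "(\<lambda>\<zeta>. indicator (ball 0 1) \<zeta> *\<^sub>R ((norm (deriv (\<lambda>\<zeta>. u * \<zeta>) \<zeta>))\<^sup>2 *\<^sub>R f (u * \<zeta>))) = (\<lambda>\<zeta>. f (u * \<zeta>))"
    by (auto simp: fun_eq_iff u supp norm_mult split: split_indicator)
  have eq': "(\<lambda>w. indicator (ball 0 1) w *\<^sub>R f w) = f"
    by (auto simp: fun_eq_iff supp split: split_indicator)
  have m: "(\<lambda>w. indicator ((\<lambda>\<zeta>. u * \<zeta>) ` ball 0 1) w *\<^sub>R f w) \<in> borel_measurable borel"
    unfolding img eq' by (rule f)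
  note c = conformal_integral[OF open_ball hol inj m, unfolded img eq eq']
  show "integrable lborel (\<lambda>\<zeta>. f (u * \<zeta>)) \<longleftrightarrow> integrable lborel f"
    "(\<integral>\<zeta>. f (u * \<zeta>) \<partial>lborel) = (\<integral>\<zeta>. f \<zeta> \<partial>lborel)"
    using c by auto
qed

text \<open>Averaging the integrand over all rotations preserves its integral, since the weight is
  radial and Lebesgue measure is rotation invariant. After exchanging the integrals, the average of
  \<open>G\<close> over each circle is \<open>G 0\<close>.\<close>

lemma disc_mean_value:
  assumes G: "G holomorphic_on ball 0 1"
    and weight: "integrable lborel (\<lambda>\<zeta>::complex. indicator (ball 0 1) \<zeta> *\<^sub>R (1 - (norm \<zeta>)\<^sup>2) powr \<alpha>)"
    and int: "integrable lborel (\<lambda>\<zeta>. indicator (ball 0 1) \<zeta> *\<^sub>R ((1 - (norm \<zeta>)\<^sup>2) powr \<alpha> *\<^sub>R G \<zeta>))"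
  shows "(\<integral>\<zeta>. indicator (ball 0 1) \<zeta> *\<^sub>R ((1 - (norm \<zeta>)\<^sup>2) powr \<alpha> *\<^sub>R G \<zeta>) \<partial>lborel) = disc_mass \<alpha> *\<^sub>R G 0"
proof -
  define H where "H \<zeta> = indicator (ball 0 1) \<zeta> *\<^sub>R ((1 - (norm \<zeta>)\<^sup>2) powr \<alpha> *\<^sub>R G \<zeta>)" for \<zeta>
  define e where "e \<theta> = exp (2 * of_real pi * \<i> * of_real \<theta>)" for \<theta> :: real
  have ne: "norm (e \<theta>) = 1" for \<theta>
    unfolding e_def using norm_exp_i_times[of "2 * pi * \<theta>"] by (simp add: mult_ac)
  have e [measurable]: "e \<in> borel_measurable borel"
    unfolding e_def by (intro borel_measurable_continuous_onI continuous_intros)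
  have H [measurable]: "H \<in> borel_measurable borel" and intH: "integrable lborel H"
    using int borel_measurable_integrable[OF int] by (simp_all add: H_def[abs_def])
  have rot: "integrable lborel (\<lambda>\<zeta>. H (e \<theta> * \<zeta>)) \<and> (\<integral>\<zeta>. H (e \<theta> * \<zeta>) \<partial>lborel) = (\<integral>\<zeta>. H \<zeta> \<partial>lborel)" for \<theta>
    using rotation_integral[OF ne H, of \<theta>] intH by (simp add: H_def)
  define J where "J = (\<lambda>\<theta> \<zeta>. indicator {0..1::real} \<theta> *\<^sub>R H (e \<theta> * \<zeta>))"
  have J [measurable]: "case_prod J \<in> borel_measurable (lborel \<Otimes>\<^sub>M lborel)"
    unfolding J_def by measurable
  have nH: "(\<integral>\<zeta>. norm (H (e \<theta> * \<zeta>)) \<partial>lborel) = (\<integral>\<zeta>. norm (H \<zeta>) \<partial>lborel)" for \<theta>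
  proof -
    have "(\<integral>\<zeta>. of_real (norm (H (e \<theta> * \<zeta>))) \<partial>lborel) = (\<integral>\<zeta>. complex_of_real (norm (H \<zeta>)) \<partial>lborel)"
      by (rule rotation_integral(2)[OF ne, of "\<lambda>\<zeta>. complex_of_real (norm (H \<zeta>))"]) (measurable, simp add: H_def)
    then show ?thesis by (simp only: integral_complex_of_real of_real_eq_iff)
  qed
  have intJ: "integrable (lborel \<Otimes>\<^sub>M lborel) (case_prod J)"
  proof (rule lborel_pair.Fubini_integrable[OF J])
    have "(\<lambda>\<theta>. \<integral>\<zeta>. norm (case_prod J (\<theta>, \<zeta>)) \<partial>lborel) = (\<lambda>\<theta>. indicator {0..1} \<theta> * (\<integral>\<zeta>. norm (H \<zeta>) \<partial>lborel))"
      by (auto simp: J_def fun_eq_iff nH)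
    then show "integrable lborel (\<lambda>\<theta>. \<integral>\<zeta>. norm (case_prod J (\<theta>, \<zeta>)) \<partial>lborel)"
      by simp
    show "AE \<theta> in lborel. integrable lborel (\<lambda>\<zeta>. case_prod J (\<theta>, \<zeta>))"
      using rot by (auto simp: J_def)
  qed
  have "(\<integral>\<theta>. (\<integral>\<zeta>. J \<theta> \<zeta> \<partial>lborel) \<partial>lborel) = (\<integral>\<theta>. indicator {0..1::real} \<theta> *\<^sub>R (\<integral>\<zeta>. H \<zeta> \<partial>lborel) \<partial>lborel)"
    by (rule Bochner_Integration.integral_cong[OF refl]) (use rot in \<open>simp add: J_def\<close>)
  also have "\<dots> = (\<integral>\<zeta>. H \<zeta> \<partial>lborel)" by (subst integral_scaleR_left) simp_all
  finally have "(\<integral>\<zeta>. H \<zeta> \<partial>lborel) = (\<integral>\<zeta>. (\<integral>\<theta>. J \<theta> \<zeta> \<partial>lborel) \<partial>lborel)"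
    using lborel_pair.Fubini_integral[OF intJ] by simp
  also have "\<dots> = (\<integral>\<zeta>. (indicator (ball (0::complex) 1) \<zeta> *\<^sub>R (1 - (norm \<zeta>)\<^sup>2) powr \<alpha>) *\<^sub>R G 0 \<partial>lborel)"
  proof (rule Bochner_Integration.integral_cong[OF refl])
    fix \<zeta> :: complex
    show "(\<integral>\<theta>. J \<theta> \<zeta> \<partial>lborel) = (indicator (ball 0 1) \<zeta> *\<^sub>R (1 - (norm \<zeta>)\<^sup>2) powr \<alpha>) *\<^sub>R G 0"
    proof (cases "norm \<zeta> < 1")
      case True
      have "(\<integral>\<theta>. J \<theta> \<zeta> \<partial>lborel) = (\<integral>\<theta>. (1 - (norm \<zeta>)\<^sup>2) powr \<alpha> *\<^sub>R (indicator {0..1} \<theta> *\<^sub>R G (e \<theta> * \<zeta>)) \<partial>lborel)"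
        using True by (intro Bochner_Integration.integral_cong) (auto simp: J_def H_def norm_mult ne)
      also have "\<dots> = (1 - (norm \<zeta>)\<^sup>2) powr \<alpha> *\<^sub>R (\<integral>\<theta>. indicator {0..1} \<theta> *\<^sub>R G (e \<theta> * \<zeta>) \<partial>lborel)"
        by (rule integral_scaleR_right)
      also have "(\<integral>\<theta>. indicator {0..1} \<theta> *\<^sub>R G (e \<theta> * \<zeta>) \<partial>lborel) = G 0"
        using circle_mean_value[OF G True] by (simp add: e_def)
      finally show ?thesis using True by simp
    qed (simp add: J_def H_def norm_mult ne)
  qed
  also have "\<dots> = disc_mass \<alpha> *\<^sub>R G 0"
    unfolding disc_mass_def using weight by (intro integral_scaleR_left) simp
  finally show ?thesis by (simp add: H_def)
qed

subsection \<open>The Cayley transform\<close>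

text \<open>The conformal map of the unit disc onto the half-plane with
  \<open>cayley z 0 = z\<close>; its inverse is \<open>(w - z) / (w - cnj z)\<close>.\<close>

definition cayley :: "complex \<Rightarrow> complex \<Rightarrow> complex" where
  "cayley z \<zeta> = (z - cnj z * \<zeta>) / (1 - \<zeta>)"

lemma cayley_props:
  assumes z: "z \<in> upper_half_plane" and \<zeta>: "norm \<zeta> < 1"
  shows "Im (cayley z \<zeta>) = Im z * (1 - (norm \<zeta>)\<^sup>2) / (norm (1 - \<zeta>))\<^sup>2"
    and "cayley z \<zeta> \<in> upper_half_plane"
    and "z - cnj (cayley z \<zeta>) = (2 * \<i> * of_real (Im z)) * inverse (1 - cnj \<zeta>)"
    and "(cayley z has_field_derivative (2 * \<i> * of_real (Im z)) / (1 - \<zeta>)\<^sup>2) (at \<zeta>)"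
    and "1 - \<zeta> \<noteq> 0" "0 < Re (1 - \<zeta>)"
proof -
  have re: "Re \<zeta> < 1" using \<zeta> complex_Re_le_cmod[of \<zeta>] by linarith
  then show n: "1 - \<zeta> \<noteq> 0" "0 < Re (1 - \<zeta>)" by (auto simp: complex_eq_iff)
  have "cayley z \<zeta> = (z - cnj z * \<zeta>) * cnj (1 - \<zeta>) / of_real ((norm (1 - \<zeta>))\<^sup>2)"
    unfolding cayley_def by (subst complex_div_cnj) simp
  then have "Im (cayley z \<zeta>) = Im ((z - cnj z * \<zeta>) * cnj (1 - \<zeta>)) / (norm (1 - \<zeta>))\<^sup>2"
    by (simp only: Im_divide_of_real)
  also have "Im ((z - cnj z * \<zeta>) * cnj (1 - \<zeta>)) = Im z * (1 - (norm \<zeta>)\<^sup>2)"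
    unfolding cmod_power2 by (simp add: algebra_simps power2_eq_square)
  finally show im: "Im (cayley z \<zeta>) = Im z * (1 - (norm \<zeta>)\<^sup>2) / (norm (1 - \<zeta>))\<^sup>2" .
  have "(norm \<zeta>)\<^sup>2 < 1" using \<zeta> by (simp add: power_less_one_iff abs_square_less_1)
  then show "cayley z \<zeta> \<in> upper_half_plane"
    using z n by (simp add: upper_half_plane_def im)
  have "1 - cnj \<zeta> \<noteq> 0" using n(1) by (metis complex_cnj_cnj complex_cnj_diff complex_cnj_one complex_cnj_zero)
  then have "z - (cnj z - z * cnj \<zeta>) / (1 - cnj \<zeta>) = (z - cnj z) / (1 - cnj \<zeta>)"
    by (simp add: field_simps)
  moreover have "z - cnj z = 2 * \<i> * of_real (Im z)" by (simp add: complex_eq_iff)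
  moreover have "cnj (cayley z \<zeta>) = (cnj z - z * cnj \<zeta>) / (1 - cnj \<zeta>)" by (simp add: cayley_def)
  ultimately show "z - cnj (cayley z \<zeta>) = (2 * \<i> * of_real (Im z)) * inverse (1 - cnj \<zeta>)"
    by (simp only: divide_inverse)
  have "(cayley z has_field_derivative ((- cnj z) * (1 - \<zeta>) - (z - cnj z * \<zeta>) * (-1)) / ((1 - \<zeta>) * (1 - \<zeta>))) (at \<zeta>)"
    unfolding cayley_def[abs_def] using n(1) by (auto intro!: derivative_eq_intros)
  also have "((- cnj z) * (1 - \<zeta>) - (z - cnj z * \<zeta>) * (-1)) / ((1 - \<zeta>) * (1 - \<zeta>)) = (z - cnj z) / (1 - \<zeta>)\<^sup>2"
    by (simp add: algebra_simps power2_eq_square)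
  also have "z - cnj z = 2 * \<i> * of_real (Im z)" by (simp add: complex_eq_iff)
  finally show "(cayley z has_field_derivative (2 * \<i> * of_real (Im z)) / (1 - \<zeta>)\<^sup>2) (at \<zeta>)" .
qed

lemma cayley_bij:
  assumes z: "z \<in> upper_half_plane"
  shows "inj_on (cayley z) (ball 0 1)" "cayley z ` ball 0 1 = upper_half_plane"
    "cayley z holomorphic_on ball 0 1"
proof -
  have iz: "0 < Im z" using z by (simp add: upper_half_plane_def)
  have zz: "z - cnj z \<noteq> 0" using iz by (simp add: complex_eq_iff)
  show "inj_on (cayley z) (ball 0 1)"
  proof (rule inj_onI)
    fix a b assume ab: "a \<in> ball 0 1" "b \<in> ball 0 1" "cayley z a = cayley z b"
    have n: "1 - a \<noteq> 0" "1 - b \<noteq> 0" using cayley_props(5)[OF z] ab by auto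
    have "(z - cnj z * a) * (1 - b) = (z - cnj z * b) * (1 - a)"
      using ab(3) n unfolding cayley_def by (simp add: frac_eq_eq)
    then have "(z - cnj z) * (a - b) = 0" by (simp add: algebra_simps)
    then show "a = b" using zz by simp
  qed
  show "cayley z ` ball 0 1 = upper_half_plane"
  proof (intro equalityI subsetI)
    fix w assume w: "w \<in> upper_half_plane"
    have n: "w - cnj z \<noteq> 0" using upper_half_plane_norm_ge(3)[OF w z] by auto
    define \<zeta> where "\<zeta> = (w - z) / (w - cnj z)"
    have "(norm (w - z))\<^sup>2 < (norm (w - cnj z))\<^sup>2"
      using iz w mult_pos_pos[of "Im z" "Im w"] unfolding cmod_power2
      by (simp add: upper_half_plane_def power2_eq_square algebra_simps)
    then have "norm (w - z) < norm (w - cnj z)" by (rule power_less_imp_less_base) simp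
    then have "norm \<zeta> < 1" using n by (simp add: \<zeta>_def norm_divide)
    moreover have "1 - \<zeta> = (z - cnj z) / (w - cnj z)" using n by (simp add: \<zeta>_def field_simps)
    moreover have "z - cnj z * \<zeta> = w * (z - cnj z) / (w - cnj z)"
      using n by (simp add: \<zeta>_def field_simps)
    ultimately have "cayley z \<zeta> = w" "\<zeta> \<in> ball 0 1" using zz n by (simp_all add: cayley_def)
    then show "w \<in> cayley z ` ball 0 1" by blast
  qed (use cayley_props(2)[OF z] in auto)
  show "cayley z holomorphic_on ball 0 1"
    using cayley_props(5)[OF z] unfolding cayley_def[abs_def] by (intro holomorphic_intros) auto
qed

text \<open>\<open>a\<close> has argument \<open>pi / 2\<close> and \<open>u\<close> has argument
  strictly between \<open>- pi / 2\<close> and \<open>pi / 2\<close>, so the sum of their principal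
  logarithms is again a principal logarithm.\<close>

lemma powr_mult_real_part_pos:
  assumes a: "0 < Im a" and b: "Re a = 0" and u: "0 < Re u"
  shows "(a * u) powr s = a powr s * u powr s"
proof -
  have n: "a \<noteq> 0" "u \<noteq> 0" using a u by auto
  have "a = of_real (Im a) * \<i>" using b by (simp add: complex_eq_iff)
  then have "Ln a = Ln (of_real (Im a) * \<i>)" by (rule arg_cong)
  also have "\<dots> = of_real (ln (Im a)) + Ln \<i>" using a by (simp add: Ln_times_of_real Ln_of_real)
  finally have "Ln a = of_real (ln (Im a)) + Ln \<i>" .
  then have "Im (Ln a) = pi / 2" by simp
  moreover have "\<bar>Im (Ln u)\<bar> < pi / 2" using Re_Ln_pos_lt_imp[OF u] .
  ultimately have "Ln (a * u) = Ln a + Ln u"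
    using n by (intro Ln_times_simple) (auto simp: abs_less_iff)
  then show ?thesis using n by (simp add: powr_def exp_add[symmetric] algebra_simps)
qed

text \<open>The antiholomorphic factor \<open>(1 - cnj \<zeta>) powr (2 + \<alpha>)\<close> from the
  kernel meets \<open>norm (1 - \<zeta>) powr (- 4 - 2 * \<alpha>)\<close> from the Jacobian and the
  height; what is left is \<open>1 / (1 - \<zeta>) powr (2 + \<alpha>)\<close>, which is
  holomorphic. All powers of \<open>Im z\<close> cancel.\<close>

lemma bergman_kernel_cayley:
  assumes z: "z \<in> upper_half_plane" and \<zeta>: "norm \<zeta> < 1"
  shows "(norm (deriv (cayley z) \<zeta>))\<^sup>2 *\<^sub>R
      (Im (cayley z \<zeta>) powr \<alpha> *\<^sub>R (F / (z - cnj (cayley z \<zeta>)) powr of_real (2 + \<alpha>)))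
    = (4 / (2 * \<i>) powr of_real (2 + \<alpha>)) *
      ((1 - (norm \<zeta>)\<^sup>2) powr \<alpha> *\<^sub>R (F / (1 - \<zeta>) powr of_real (2 + \<alpha>)))"
proof -
  define y where "y = Im z"
  define s where "s = complex_of_real (2 + \<alpha>)"
  define N where "N = norm (1 - \<zeta>)"
  define R where "R = 1 - (norm \<zeta>)\<^sup>2"
  note cp = cayley_props[OF z \<zeta>]
  have y: "0 < y" using z by (simp add: y_def upper_half_plane_def)
  have N: "0 < N" using cp(5) by (simp add: N_def)
  have R: "0 < R" using \<zeta> by (simp add: R_def power_less_one_iff abs_square_less_1)
  have d: "(norm (deriv (cayley z) \<zeta>))\<^sup>2 = 4 * y\<^sup>2 / N ^ 4"
    using y by (simp add: DERIV_imp_deriv[OF cp(4)] norm_divide norm_mult norm_power N_def y_def[symmetric] power_divide power_mult_distrib)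
  have im: "Im (cayley z \<zeta>) powr \<alpha> = y powr \<alpha> * R powr \<alpha> / N powr (2 * \<alpha>)"
    using y R N unfolding cp(1) y_def[symmetric] R_def[symmetric] N_def[symmetric]
    by (simp add: powr_divide powr_mult powr_powr flip: powr_numeral)
  define u where "u = inverse (1 - cnj \<zeta>)"
  have c1: "1 - cnj \<zeta> = cnj (1 - \<zeta>)" by simp
  have re1: "0 < Re (1 - cnj \<zeta>)" using cp(6) by simp
  have reu: "0 < Re u"
    using re1 by (auto simp: u_def inverse_complex.sel intro!: divide_pos_pos add_pos_nonneg)
  have "(z - cnj (cayley z \<zeta>)) powr s = (2 * \<i> * of_real y) powr s * u powr s"
    unfolding cp(3) y_def[symmetric] u_def[symmetric] using y reu by (intro powr_mult_real_part_pos) auto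
  also have "(2 * \<i> * of_real y) powr s = (2 * \<i>) powr s * of_real (y powr (2 + \<alpha>))"
  proof -
    have "(2 * \<i> * of_real y) powr s = (2 * \<i>) powr s * of_real y powr s"
      using y by (intro powr_mult_real_part_pos) auto
    then show ?thesis using y by (simp add: s_def powr_of_real del: of_real_add)
  qed
  also have "u powr s = inverse ((1 - cnj \<zeta>) powr s)"
  proof -
    have n: "1 - cnj \<zeta> \<noteq> 0" using re1 by auto
    have "Ln u = - Ln (1 - cnj \<zeta>)" unfolding u_def
      using re1 by (intro Ln_inverse) (auto simp: complex_nonpos_Reals_iff)
    then show ?thesis using n by (simp add: powr_def u_def exp_minus)
  qed
  finally have k: "(z - cnj (cayley z \<zeta>)) powr s
    = (2 * \<i>) powr s * of_real (y powr (2 + \<alpha>)) * inverse ((1 - cnj \<zeta>) powr s)" .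
  have "(1 - cnj \<zeta>) powr s = cnj ((1 - \<zeta>) powr s)"
    unfolding c1 s_def using cp(6) by (subst cnj_powr) auto
  then have "(1 - cnj \<zeta>) powr s * (1 - \<zeta>) powr s = (1 - \<zeta>) powr s * cnj ((1 - \<zeta>) powr s)"
    by (simp only: mult.commute)
  also have "\<dots> = of_real ((norm ((1 - \<zeta>) powr s))\<^sup>2)" by (rule complex_norm_square[symmetric])
  also have "norm ((1 - \<zeta>) powr s) = N powr (2 + \<alpha>)"
    unfolding N_def s_def by (subst norm_powr_real_powr') auto
  also have "(N powr (2 + \<alpha>))\<^sup>2 = N ^ 4 * N powr (2 * \<alpha>)"
    using N by (simp add: power2_eq_square powr_add[symmetric] flip: powr_numeral)
  finally have cc: "(1 - cnj \<zeta>) powr s * (1 - \<zeta>) powr s = of_real (N ^ 4 * N powr (2 * \<alpha>))" .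
  have n: "(1 - \<zeta>) powr s \<noteq> 0" "(2 * \<i>) powr s \<noteq> 0" "(1 - cnj \<zeta>) powr s \<noteq> 0"
    using cp(5) re1 by (auto simp: powr_def)
  have c2: "(1 - cnj \<zeta>) powr s = of_real (N ^ 4 * N powr (2 * \<alpha>)) / (1 - \<zeta>) powr s"
    using cc n by (simp add: field_simps)
  have ys: "y powr (2 + \<alpha>) = y\<^sup>2 * y powr \<alpha>" using y by (simp add: powr_add)
  show ?thesis
    unfolding s_def[symmetric] R_def[symmetric] d im k c2 ys
    using n y N R by (simp add: field_simps scaleR_conv_of_real)
qed


subsection \<open>The reproducing formula\<close>

lemma bergman_measurable_iff:
  fixes f :: "complex \<Rightarrow> complex"
  shows "f \<in> borel_measurable (bergman_measure \<alpha>)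
    \<longleftrightarrow> (\<lambda>w. indicator upper_half_plane w *\<^sub>R f w) \<in> borel_measurable borel"
  by (simp add: measurable_cong_sets[OF sets_bergman_measure refl] borel_measurable_restrict_space_iff mult.commute)

lemma bergman_integral_lborel:
  fixes f :: "complex \<Rightarrow> complex"
  assumes f: "f \<in> borel_measurable (bergman_measure \<alpha>)"
  shows "integrable (bergman_measure \<alpha>) f
      \<longleftrightarrow> integrable lborel (\<lambda>w. indicator upper_half_plane w *\<^sub>R (Im w powr \<alpha> *\<^sub>R f w))" (is ?A)
    and "(LINT w|bergman_measure \<alpha>. f w)
      = (\<integral>w. indicator upper_half_plane w *\<^sub>R (Im w powr \<alpha> *\<^sub>R f w) \<partial>lborel)" (is ?B)
proof -
  have f': "f \<in> borel_measurable (restrict_space lborel upper_half_plane)"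
    using f unfolding bergman_measure_def by simp
  have g: "(\<lambda>w. Im w powr \<alpha>) \<in> borel_measurable (restrict_space lborel upper_half_plane)" by measurable
  show ?A unfolding bergman_measure_def
    by (subst integrable_density[OF f' g]) (auto simp: integrable_restrict_space)
  show ?B unfolding bergman_measure_def
    by (subst integral_density[OF f' g]) (auto simp: integral_restrict_space)
qed

lemma holomorphic_bergman_measurable:
  assumes "F holomorphic_on upper_half_plane"
  shows "F \<in> borel_measurable (bergman_measure \<alpha>)"
  using assms by (simp add: measurable_cong_sets[OF sets_bergman_measure refl]
      borel_measurable_continuous_on_restrict holomorphic_on_imp_continuous_on)

lemma kernel_arg:
  assumes "z \<in> upper_half_plane" "w \<in> upper_half_plane"
  shows "z - cnj w \<in> upper_half_plane" "z - cnj w \<notin> \<real>\<^sub>\<le>\<^sub>0" "z - cnj w \<noteq> 0" "(z - cnj w) powr s \<noteq> 0"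
  using assms by (auto simp: upper_half_plane_def complex_nonpos_Reals_iff powr_def)

lemma norm_powr_real: "norm (z powr complex_of_real s) = norm z powr s"
  by (subst norm_powr_real_powr') auto

lemma kernel_bergman_measurable:
  assumes z: "z \<in> upper_half_plane"
  shows "(\<lambda>w. 1 / (z - cnj w) powr of_real s) \<in> borel_measurable (bergman_measure \<alpha>)"
proof -
  have "continuous_on upper_half_plane (\<lambda>w. 1 / (z - cnj w) powr of_real s)"
    using z by (intro continuous_intros) (auto simp: upper_half_plane_def complex_eq_iff[of _ "cnj _"] complex_nonpos_Reals_iff)
  then show ?thesis
    by (simp add: measurable_cong_sets[OF sets_bergman_measure refl] borel_measurable_continuous_on_restrict)
qed

lemma bergman_cayley:
  fixes \<alpha> :: real and F :: "complex \<Rightarrow> complex" and z :: complex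
  assumes F: "F holomorphic_on upper_half_plane" and z: "z \<in> upper_half_plane"
  defines "\<psi> \<equiv> (\<lambda>w. F w / (z - cnj w) powr of_real (2 + \<alpha>))"
  defines "G \<equiv> (\<lambda>\<zeta>. F (cayley z \<zeta>) / (1 - \<zeta>) powr of_real (2 + \<alpha>))"
  shows "integrable (bergman_measure \<alpha>) \<psi> \<longleftrightarrow>
      integrable lborel (\<lambda>\<zeta>. indicator (ball 0 1) \<zeta> *\<^sub>R ((1 - (norm \<zeta>)\<^sup>2) powr \<alpha> *\<^sub>R G \<zeta>))" (is ?A)
    and "(LINT w|bergman_measure \<alpha>. \<psi> w) = 4 / (2 * \<i>) powr of_real (2 + \<alpha>) *
      (\<integral>\<zeta>. indicator (ball 0 1) \<zeta> *\<^sub>R ((1 - (norm \<zeta>)\<^sup>2) powr \<alpha> *\<^sub>R G \<zeta>) \<partial>lborel)" (is ?B)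
proof -
  have psi: "\<psi> \<in> borel_measurable (bergman_measure \<alpha>)"
    unfolding \<psi>_def
    using borel_measurable_times[OF holomorphic_bergman_measurable[OF F] kernel_bergman_measurable[OF z, of "2 + \<alpha>"]]
    by simp
  define \<psi>' where "\<psi>' w = Im w powr \<alpha> *\<^sub>R \<psi> w" for w
  have psi': "(\<lambda>w. indicator (cayley z ` ball 0 1) w *\<^sub>R \<psi>' w) \<in> borel_measurable borel"
  proof -
    have "(\<lambda>w. Im w powr \<alpha> *\<^sub>R (indicator upper_half_plane w *\<^sub>R \<psi> w)) \<in> borel_measurable borel"
      using psi unfolding bergman_measurable_iff by measurable
    then show ?thesis by (simp add: cayley_bij(2)[OF z] \<psi>'_def mult.commute)
  qed
  define c where "c = 4 / (2 * \<i>) powr of_real (2 + \<alpha>)"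
  have c: "c \<noteq> 0" by (simp add: c_def powr_def)
  define g where "g \<zeta> = indicator (ball 0 1) \<zeta> *\<^sub>R ((1 - (norm \<zeta>)\<^sup>2) powr \<alpha> *\<^sub>R G \<zeta>)" for \<zeta>
  have eq: "(\<lambda>\<zeta>. indicator (ball 0 1) \<zeta> *\<^sub>R ((norm (deriv (cayley z) \<zeta>))\<^sup>2 *\<^sub>R \<psi>' (cayley z \<zeta>)))
      = (\<lambda>\<zeta>. c * g \<zeta>)"
  proof
    fix \<zeta> :: complex
    show "indicator (ball 0 1) \<zeta> *\<^sub>R ((norm (deriv (cayley z) \<zeta>))\<^sup>2 *\<^sub>R \<psi>' (cayley z \<zeta>)) = c * g \<zeta>"
    proof (cases "norm \<zeta> < 1")
      case True
      then show ?thesis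
        using bergman_kernel_cayley[OF z True, of \<alpha> "F (cayley z \<zeta>)"]
        unfolding \<psi>'_def \<psi>_def g_def G_def c_def by simp
    qed (simp add: g_def)
  qed
  note ci = conformal_integral[OF open_ball cayley_bij(3)[OF z] cayley_bij(1)[OF z] psi', unfolded eq cayley_bij(2)[OF z]]
  note bi = bergman_integral_lborel[OF psi]
  have "integrable lborel (\<lambda>\<zeta>. c * g \<zeta>) \<longleftrightarrow> integrable lborel g"
  proof
    assume "integrable lborel (\<lambda>\<zeta>. c * g \<zeta>)"
    from integrable_mult_right[OF this, of "inverse c"]
    have "integrable lborel (\<lambda>\<zeta>. inverse c * (c * g \<zeta>))" .
    moreover have "inverse c * (c * g \<zeta>) = g \<zeta>" for \<zeta> using c by simp
    ultimately show "integrable lborel g" by simp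
  qed (intro integrable_mult_right)
  then show ?A unfolding g_def[symmetric] bi(1) using ci(1) unfolding \<psi>'_def by simp
  show ?B unfolding g_def[symmetric] bi(2) c_def[symmetric] using ci(2) unfolding \<psi>'_def by simp
qed

text \<open>For \<open>z = \<i>\<close> and \<open>F w = 1 / (w + \<i>) powr (2 + \<alpha>)\<close>
  the pulled back function is the constant \<open>1 / (2 * \<i>) powr (2 + \<alpha>)\<close>.
  Integrability of the weight on the disc is therefore the square integrability of the kernel on the
  half-plane.\<close>

lemma integrable_disc_weight:
  assumes \<alpha>: "-1 < \<alpha>"
  shows "integrable lborel (\<lambda>\<zeta>::complex. indicator (ball 0 1) \<zeta> *\<^sub>R (1 - (norm \<zeta>)\<^sup>2) powr \<alpha>)"
proof -
  have i: "\<i> \<in> upper_half_plane" by (simp add: upper_half_plane_def)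
  define s where "s = complex_of_real (2 + \<alpha>)"
  define F where "F w = 1 / ((w + \<i>) powr s)" for w
  have arg: "w + \<i> = w - cnj \<i>" for w by simp
  have F: "F holomorphic_on upper_half_plane"
    unfolding F_def[abs_def] arg using kernel_arg[OF _ i] by (intro holomorphic_intros) auto
  have "integrable (bergman_measure \<alpha>) (\<lambda>w. F w / (\<i> - cnj w) powr s)"
  proof (rule integrableI_bounded)
    show "(\<lambda>w. F w / (\<i> - cnj w) powr s) \<in> borel_measurable (bergman_measure \<alpha>)"
      using borel_measurable_times[OF holomorphic_bergman_measurable[OF F] kernel_bergman_measurable[OF i, of "2 + \<alpha>"]]
      by (simp add: s_def)
    have "norm (\<i> - cnj w) = norm (w + \<i>)" for w
      using complex_mod_cnj[of "w + \<i>"] by (simp add: norm_minus_commute)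
    then have "norm (F w / (\<i> - cnj w) powr s) = 1 / norm (w + \<i>) powr (4 + 2 * \<alpha>)" for w
      unfolding F_def s_def norm_divide norm_powr_real norm_one by (simp add: powr_add[symmetric])
    then show "(\<integral>\<^sup>+w. ennreal (norm (F w / (\<i> - cnj w) powr s)) \<partial>bergman_measure \<alpha>) < \<infinity>"
      using nn_integral_square_kernel_finite[OF \<alpha>] by simp
  qed
  then have int: "integrable lborel (\<lambda>\<zeta>. indicator (ball 0 1) \<zeta> *\<^sub>R ((1 - (norm \<zeta>)\<^sup>2) powr \<alpha> *\<^sub>R (F (cayley \<i> \<zeta>) / (1 - \<zeta>) powr s)))"
    unfolding s_def by (subst (asm) bergman_cayley(1)[OF F i])
  have eq: "F (cayley \<i> \<zeta>) / (1 - \<zeta>) powr s = 1 / (2 * \<i>) powr s" if \<zeta>: "norm \<zeta> < 1" for \<zeta>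
  proof -
    note cp = cayley_props[OF i \<zeta>]
    have "cayley \<i> \<zeta> + \<i> = (2 * \<i>) * inverse (1 - \<zeta>)"
      using cp(5) by (simp add: cayley_def field_simps)
    moreover have "(2 * \<i> * inverse (1 - \<zeta>)) powr s = (2 * \<i>) powr s * inverse (1 - \<zeta>) powr s"
      using cp(6) by (intro powr_mult_real_part_pos) (auto simp: inverse_complex.sel intro!: divide_pos_pos add_pos_nonneg)
    moreover have "inverse (1 - \<zeta>) powr s = inverse ((1 - \<zeta>) powr s)"
    proof -
      have "Ln (inverse (1 - \<zeta>)) = - Ln (1 - \<zeta>)"
        using cp(6) by (intro Ln_inverse) (auto simp: complex_nonpos_Reals_iff)
      then show ?thesis using cp(5) by (simp add: powr_def exp_minus)
    qed
    moreover have "(1 - \<zeta>) powr s \<noteq> 0" using cp(5) by (simp add: powr_def)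
    ultimately show ?thesis by (simp add: F_def)
  qed
  have "(\<lambda>\<zeta>. indicator (ball 0 1) \<zeta> *\<^sub>R ((1 - (norm \<zeta>)\<^sup>2) powr \<alpha> *\<^sub>R (F (cayley \<i> \<zeta>) / (1 - \<zeta>) powr s)))
    = (\<lambda>\<zeta>. (indicator (ball 0 1) \<zeta> *\<^sub>R (1 - (norm \<zeta>)\<^sup>2) powr \<alpha>) *\<^sub>R (1 / (2 * \<i>) powr s))"
    by (auto simp: fun_eq_iff eq split: split_indicator)
  with int have "integrable lborel (\<lambda>\<zeta>::complex. (indicator (ball 0 1) \<zeta> *\<^sub>R (1 - (norm \<zeta>)\<^sup>2) powr \<alpha>) *\<^sub>R (1 / (2 * \<i>) powr s))"
    by simp
  from integrable_norm[OF integrable_mult_left[OF this, of "(2 * \<i>) powr s"]] show ?thesis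
    by (simp add: powr_def)
qed

lemma disc_mass_pos:
  assumes "-1 < \<alpha>"
  shows "0 < disc_mass \<alpha>"
proof -
  define f where "f \<zeta> = indicator (ball 0 1) \<zeta> *\<^sub>R (1 - (norm \<zeta>)\<^sup>2) powr \<alpha>" for \<zeta> :: complex
  have int: "integrable lborel f" using integrable_disc_weight[OF assms] by (simp add: f_def[abs_def])
  have pos: "0 \<le> f \<zeta>" for \<zeta> by (simp add: f_def)
  have "disc_mass \<alpha> \<noteq> 0"
  proof
    assume "disc_mass \<alpha> = 0"
    then have "AE \<zeta> in lborel. f \<zeta> = 0"
      using integral_nonneg_eq_0_iff_AE[OF int] pos by (simp add: disc_mass_def f_def[abs_def])
    then have "AE \<zeta> in lborel. \<zeta> \<notin> ball (0::complex) 1"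
    proof eventually_elim
      case (elim \<zeta>)
      show ?case
      proof
        assume "\<zeta> \<in> ball 0 1"
        then have "(norm \<zeta>)\<^sup>2 < 1" by (simp add: abs_square_less_1)
        then show False using elim \<open>\<zeta> \<in> ball 0 1\<close> by (simp add: f_def)
      qed
    qed
    then have "emeasure lborel (ball (0::complex) 1) = 0"
      by (subst (asm) AE_iff_measurable[of "ball 0 1"]) auto
    moreover have "emeasure lborel (ball (0::complex) 1) \<noteq> 0"
      using content_ball_pos[of 1 "0::complex"] by (auto simp: measure_def)
    ultimately show False by simp
  qed
  moreover have "0 \<le> disc_mass \<alpha>"
    unfolding disc_mass_def by (rule integral_nonneg_AE) simp
  ultimately show ?thesis by simp
qed

text \<open>For \<open>\<alpha> > -1\<close> the disc mass equals
  \<open>pi / (1 + \<alpha>)\<close>, so this is the classical constant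
  \<open>(1 + \<alpha>) * (2 * \<i>) powr (2 + \<alpha>) / (4 * pi)\<close>, for instance
  \<open>- 1 / pi\<close> when \<open>\<alpha> = 0\<close>.\<close>

definition reproducing_const :: "real \<Rightarrow> complex" where
  "reproducing_const \<alpha> = (2 * \<i>) powr of_real (2 + \<alpha>) / (4 * of_real (disc_mass \<alpha>))"

text \<open>The mean value property at the centre of the disc, where \<open>G 0 = F z\<close>.
  Absolute convergence at the single point \<open>z\<close> is the whole growth hypothesis, so the
  formula applies to \<open>bergman_A2\<close> and to the mixed norm spaces alike.\<close>

theorem reproducing_formula:
  assumes \<alpha>: "-1 < \<alpha>" and F: "F holomorphic_on upper_half_plane" and z: "z \<in> upper_half_plane"
    and fin: "PP \<alpha> (\<lambda>w. ennreal (norm (F w))) z < top"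
  shows "integrable (bergman_measure \<alpha>) (\<lambda>w. F w / (z - cnj w) powr of_real (2 + \<alpha>))"
    and "F z = reproducing_const \<alpha> * (LINT w|bergman_measure \<alpha>. F w / (z - cnj w) powr of_real (2 + \<alpha>))"
proof -
  define s where "s = complex_of_real (2 + \<alpha>)"
  show int: "integrable (bergman_measure \<alpha>) (\<lambda>w. F w / (z - cnj w) powr of_real (2 + \<alpha>))"
  proof (rule integrableI_bounded)
    show "(\<lambda>w. F w / (z - cnj w) powr of_real (2 + \<alpha>)) \<in> borel_measurable (bergman_measure \<alpha>)"
      using borel_measurable_times[OF holomorphic_bergman_measurable[OF F] kernel_bergman_measurable[OF z, of "2 + \<alpha>"]]
      by simp
    show "(\<integral>\<^sup>+w. ennreal (norm (F w / (z - cnj w) powr of_real (2 + \<alpha>))) \<partial>bergman_measure \<alpha>) < \<infinity>"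
      using fin unfolding PP_def norm_divide norm_powr_real
      by (simp add: ennreal_mult[symmetric])
  qed
  define G where "G \<zeta> = F (cayley z \<zeta>) / (1 - \<zeta>) powr s" for \<zeta>
  have G: "G holomorphic_on ball 0 1"
  proof -
    have "(F \<circ> cayley z) holomorphic_on ball 0 1"
      using F cayley_bij[OF z] by (intro holomorphic_on_compose) auto
    moreover have "1 - \<zeta> \<notin> \<real>\<^sub>\<le>\<^sub>0" "(1 - \<zeta>) powr s \<noteq> 0" if "\<zeta> \<in> ball 0 1" for \<zeta>
      using cayley_props(5,6)[OF z, of \<zeta>] that by (auto simp: complex_nonpos_Reals_iff powr_def)
    ultimately show ?thesis unfolding G_def[abs_def]
      by (intro holomorphic_intros) (auto simp: o_def)
  qed
  have "(LINT w|bergman_measure \<alpha>. F w / (z - cnj w) powr s)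
    = 4 / (2 * \<i>) powr s * (disc_mass \<alpha> *\<^sub>R G 0)"
    using bergman_cayley[OF F z, of \<alpha>] int disc_mean_value[OF G integrable_disc_weight[OF \<alpha>]]
    by (simp add: G_def[abs_def] s_def scaleR_conv_of_real)
  moreover have "G 0 = F z" by (simp add: G_def cayley_def)
  ultimately show "F z = reproducing_const \<alpha> * (LINT w|bergman_measure \<alpha>. F w / (z - cnj w) powr of_real (2 + \<alpha>))"
    using disc_mass_pos[OF \<alpha>] by (simp add: reproducing_const_def s_def scaleR_conv_of_real powr_def)
qed

subsection \<open>Holomorphic dependence of integrals on a parameter\<close>

text \<open>Differentiation under the integral. Domination is asked of \<open>k\<close> itself;
  Cauchy's inequality turns it into a bound for the derivative and hence for the difference
  quotients, as dominated convergence requires.\<close>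

lemma holomorphic_integral:
  fixes k :: "complex \<Rightarrow> 'a \<Rightarrow> complex"
  assumes U: "open U"
    and hol: "\<And>w. w \<in> space M \<Longrightarrow> (\<lambda>z. k z w) holomorphic_on U"
    and meas: "\<And>z. z \<in> U \<Longrightarrow> k z \<in> borel_measurable M"
    and dom: "\<And>z0. z0 \<in> U \<Longrightarrow> \<exists>r>0. \<exists>g. integrable M g \<and> ball z0 r \<subseteq> U \<and>
        (\<forall>z\<in>ball z0 r. \<forall>w\<in>space M. norm (k z w) \<le> g w)"
  shows "(\<lambda>z. LINT w|M. k z w) holomorphic_on U"
proof -
  have "\<exists>D. ((\<lambda>z. LINT w|M. k z w) has_field_derivative D) (at z0)" if z0: "z0 \<in> U" for z0
  proof -
    obtain r g where r: "0 < r" and g: "integrable M g" and bU: "ball z0 r \<subseteq> U"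
      and le: "\<And>z w. z \<in> ball z0 r \<Longrightarrow> w \<in> space M \<Longrightarrow> norm (k z w) \<le> g w"
      using dom[OF z0] by metis
    define d where "d w = deriv (\<lambda>z. k z w) z0" for w
    have derb: "norm (deriv (\<lambda>z. k z w) z) \<le> g w / (r / 4)" if z: "z \<in> ball z0 (r / 2)" and w: "w \<in> space M" for z w
    proof -
      have sub: "cball z (r / 4) \<subseteq> ball z0 r"
      proof
        fix x assume "x \<in> cball z (r / 4)"
        then show "x \<in> ball z0 r" using z r dist_triangle[of z0 x z] by simp
      qed
      have h: "(\<lambda>z. k z w) holomorphic_on cball z (r / 4)"
        using hol[OF w] sub bU by (meson holomorphic_on_subset order_trans)
      have "norm ((deriv ^^ 1) (\<lambda>z. k z w) z) \<le> (fact 1) * g w / (r / 4) ^ 1"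
      proof (rule Cauchy_inequality)
        show "(\<lambda>z. k z w) holomorphic_on ball z (r / 4)"
          using h by (rule holomorphic_on_subset) auto
        show "continuous_on (cball z (r / 4)) (\<lambda>z. k z w)"
          using h by (rule holomorphic_on_imp_continuous_on)
        show "norm (k x w) \<le> g w" if "norm (z - x) = r / 4" for x
          using that sub w r by (intro le) (auto simp: dist_norm)
      qed (use r in auto)
      then show ?thesis by simp
    qed
    have lip: "norm (k x w - k z0 w) \<le> g w / (r / 4) * norm (x - z0)" if x: "x \<in> ball z0 (r / 2)" and w: "w \<in> space M" for x w
    proof (rule field_differentiable_bound[where S = "ball z0 (r / 2)"])
      show "((\<lambda>z. k z w) has_field_derivative deriv (\<lambda>z. k z w) z) (at z within ball z0 (r / 2))"
        if "z \<in> ball z0 (r / 2)" for z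
      proof -
        have "z \<in> U" using that r bU by (auto simp: dist_norm)
        then show ?thesis
          using holomorphic_derivI[OF hol[OF w] U] has_field_derivative_at_within by blast
      qed
      show "norm (deriv (\<lambda>z. k z w) z) \<le> g w / (r / 4)" if "z \<in> ball z0 (r / 2)" for z
        by (rule derb[OF that w])
    qed (use x r in auto)
    have "((\<lambda>h. ((LINT w|M. k (z0 + h) w) - (LINT w|M. k z0 w)) / h) \<longlongrightarrow> (LINT w|M. d w)) (at 0)"
      unfolding tendsto_at_iff_sequentially
    proof (intro allI impI)
      fix X :: "nat \<Rightarrow> complex" assume X: "\<forall>i. X i \<in> UNIV - {0}" "X \<longlonglongrightarrow> 0"
      then have ev: "\<forall>\<^sub>F n in sequentially. norm (X n) < r / 2"
        using r by (intro order_tendstoD(2)[OF tendsto_norm_zero[OF X(2)]]) simp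
      then obtain m where m: "\<And>n. m \<le> n \<Longrightarrow> norm (X n) < r / 2"
        unfolding eventually_sequentially by blast
      \<comment> \<open>Dropping the first \<open>m\<close> terms puts every \<open>z0 + Y n\<close>
        in the half ball, where the Lipschitz bound \<open>lip\<close> holds.\<close>
      define Y where "Y n = X (n + m)" for n
      have Y: "Y n \<noteq> 0" "norm (Y n) < r / 2" "Y \<longlonglongrightarrow> 0" for n
        using X m LIMSEQ_ignore_initial_segment[OF X(2), of m] by (auto simp: Y_def[abs_def])
      have inb: "z0 + Y n \<in> ball z0 (r / 2)" "z0 + Y n \<in> ball z0 r" "z0 \<in> ball z0 r" for n
      proof -
        have "norm (Y n) < r" using Y(2)[of n] r by linarith
        then show "z0 + Y n \<in> ball z0 (r / 2)" "z0 + Y n \<in> ball z0 r" "z0 \<in> ball z0 r"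
          using Y(2)[of n] r by (auto simp: dist_norm)
      qed
      have qm: "(\<lambda>w. (k (z0 + Y n) w - k z0 w) / Y n) \<in> borel_measurable M" for n
      proof -
        have "z0 + Y n \<in> U" using inb(2) bU by blast
        then show ?thesis using z0 by (intro borel_measurable_divide borel_measurable_diff meas) auto
      qed
      have lim: "(\<lambda>n. (k (z0 + Y n) w - k z0 w) / Y n) \<longlonglongrightarrow> d w" if w: "w \<in> space M" for w
      proof -
        have "((\<lambda>z. k z w) has_field_derivative d w) (at z0)"
          unfolding d_def using hol[OF w] U z0 by (rule holomorphic_derivI)
        then have "((\<lambda>h. (k (z0 + h) w - k z0 w) / h) \<longlongrightarrow> d w) (at 0)"
          by (simp add: DERIV_def)
        then show ?thesis
          using Y unfolding tendsto_at_iff_sequentially by (auto simp: o_def)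
      qed
      have dm: "d \<in> borel_measurable M"
        using qm lim by (rule borel_measurable_LIMSEQ_metric)
      have "(\<lambda>n. LINT w|M. (k (z0 + Y n) w - k z0 w) / Y n) \<longlonglongrightarrow> (LINT w|M. d w)"
      proof (rule integral_dominated_convergence[OF dm qm])
        show "integrable M (\<lambda>w. g w / (r / 4))" using g by simp
        show "AE w in M. norm ((k (z0 + Y n) w - k z0 w) / Y n) \<le> g w / (r / 4)" for n
          using lip[OF inb(1)[of n]] Y(1)[of n] by (intro AE_I2) (simp add: norm_divide pos_divide_le_eq)
      qed (use lim in \<open>auto intro!: AE_I2\<close>)
      moreover have "(LINT w|M. (k (z0 + Y n) w - k z0 w) / Y n)
        = ((LINT w|M. k (z0 + Y n) w) - (LINT w|M. k z0 w)) / Y n" for n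
      proof -
        have int: "integrable M (k x)" if "x \<in> ball z0 r" for x
          using that bU le by (intro Bochner_Integration.integrable_bound[OF g] meas AE_I2) force+
        show ?thesis using int[OF inb(2)] int[OF inb(3)] by simp
      qed
      ultimately have "(\<lambda>n. ((LINT w|M. k (z0 + Y n) w) - (LINT w|M. k z0 w)) / Y n) \<longlonglongrightarrow> (LINT w|M. d w)"
        by (simp only:)
      then have "(\<lambda>n. ((LINT w|M. k (z0 + X (n + m)) w) - (LINT w|M. k z0 w)) / X (n + m)) \<longlonglongrightarrow> (LINT w|M. d w)"
        unfolding Y_def .
      from LIMSEQ_offset[OF this]
      show "((\<lambda>h. ((LINT w|M. k (z0 + h) w) - (LINT w|M. k z0 w)) / h) \<circ> X) \<longlonglongrightarrow> (LINT w|M. d w)"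
        by (simp add: o_def)
    qed
    then show ?thesis unfolding DERIV_def by blast
  qed
  then show ?thesis using U by (simp add: holomorphic_on_open)
qed

subsection \<open>The Bergman projection\<close>

text \<open>Cut off outside the half-plane, where the functions under study carry arbitrary values;
  the result is Borel measurable on the whole plane.\<close>

definition hnorm :: "(complex \<Rightarrow> complex) \<Rightarrow> complex \<Rightarrow> ennreal" where
  "hnorm f w = indicator upper_half_plane w * ennreal (norm (f w))"

lemma hnorm_measurable:
  assumes "f \<in> borel_measurable (bergman_measure \<alpha>)"
  shows "hnorm f \<in> borel_measurable borel"
proof -
  have "(\<lambda>w. ennreal (norm (indicator upper_half_plane w *\<^sub>R f w))) \<in> borel_measurable borel"
    using assms unfolding bergman_measurable_iff by measurable
  also have "(\<lambda>w. ennreal (norm (indicator upper_half_plane w *\<^sub>R f w))) = hnorm f"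
    by (auto simp: hnorm_def fun_eq_iff split: split_indicator)
  finally show ?thesis .
qed

lemma PP_hnorm: "PP \<alpha> (hnorm f) z = PP \<alpha> (\<lambda>w. ennreal (norm (f w))) z"
  unfolding PP_def by (intro nn_integral_cong) (simp add: space_bergman_measure hnorm_def)

text \<open>The extension by zero is Borel on the plane, so
  \<open>kernel_fun \<alpha> (z - cnj w)\<close> is jointly measurable in \<open>z\<close> and
  \<open>w\<close>, as Fubini requires.\<close>

definition kernel_fun :: "real \<Rightarrow> complex \<Rightarrow> complex" where
  "kernel_fun \<alpha> \<xi> = indicator upper_half_plane \<xi> *\<^sub>R (1 / \<xi> powr of_real (2 + \<alpha>))"

lemma kernel_fun_measurable [measurable]: "kernel_fun \<alpha> \<in> borel_measurable borel"
proof -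
  have "continuous_on upper_half_plane (\<lambda>\<xi>. 1 / \<xi> powr of_real (2 + \<alpha>))"
    by (intro continuous_intros) (auto simp: upper_half_plane_def complex_nonpos_Reals_iff)
  then show ?thesis unfolding kernel_fun_def[abs_def]
    by (intro borel_measurable_continuous_on_indicator) simp
qed

lemma kernel_fun_eq:
  assumes "z \<in> upper_half_plane" "w \<in> upper_half_plane"
  shows "1 / (z - cnj w) powr of_real (2 + \<alpha>) = kernel_fun \<alpha> (z - cnj w)"
  using kernel_arg(1)[OF assms] by (simp add: kernel_fun_def)

lemma kernel_fun_norm:
  assumes "z \<in> upper_half_plane" "w \<in> upper_half_plane"
  shows "norm (kernel_fun \<alpha> (z - cnj w)) = 1 / norm (z - cnj w) powr (2 + \<alpha>)"
  unfolding kernel_fun_eq[OF assms, symmetric] norm_divide norm_powr_real by simp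

text \<open>The integral operator with constant one. Every candidate for the projection is a
  multiple of it, which reduces the description of \<open>bergman_const\<close> to the choice of a
  scalar.\<close>

definition bergman_op :: "real \<Rightarrow> (complex \<Rightarrow> complex) \<Rightarrow> complex \<Rightarrow> complex" where
  "bergman_op \<alpha> f z = (LINT w|bergman_measure \<alpha>. f w / (z - cnj w) powr of_real (2 + \<alpha>))"

lemma bergman_op_kernel:
  "(LINT w|bergman_measure \<alpha>. kernel_with_const c \<alpha> z w * f w) = c * bergman_op \<alpha> f z"
proof -
  have "(\<lambda>w. kernel_with_const c \<alpha> z w * f w) = (\<lambda>w. c * (f w / (z - cnj w) powr of_real (2 + \<alpha>)))"
    by (auto simp: kernel_with_const_def)
  then show ?thesis by (simp only: bergman_op_def integral_mult_right_zero)
qed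

lemma bergman_op_integrable:
  assumes f: "f \<in> borel_measurable (bergman_measure \<alpha>)" and z: "z \<in> upper_half_plane"
    and fin: "PP \<alpha> (hnorm f) z < top"
  shows "integrable (bergman_measure \<alpha>) (\<lambda>w. f w / (z - cnj w) powr of_real (2 + \<alpha>))"
proof (rule integrableI_bounded)
  show "(\<lambda>w. f w / (z - cnj w) powr of_real (2 + \<alpha>)) \<in> borel_measurable (bergman_measure \<alpha>)"
    using borel_measurable_times[OF f kernel_bergman_measurable[OF z, of "2 + \<alpha>"]] by simp
  show "(\<integral>\<^sup>+w. ennreal (norm (f w / (z - cnj w) powr of_real (2 + \<alpha>))) \<partial>bergman_measure \<alpha>) < \<infinity>"
    using fin unfolding PP_hnorm unfolding PP_def norm_divide norm_powr_real
    by (simp add: ennreal_mult[symmetric])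
qed

lemma bergman_op_norm_le:
  assumes f: "f \<in> borel_measurable (bergman_measure \<alpha>)" and z: "z \<in> upper_half_plane"
    and fin: "PP \<alpha> (hnorm f) z < top"
  shows "ennreal (norm (bergman_op \<alpha> f z)) \<le> PP \<alpha> (hnorm f) z"
proof -
  have "ennreal (norm (bergman_op \<alpha> f z))
    \<le> (\<integral>\<^sup>+w. ennreal (norm (f w / (z - cnj w) powr of_real (2 + \<alpha>))) \<partial>bergman_measure \<alpha>)"
    unfolding bergman_op_def by (intro integral_norm_bound_ennreal bergman_op_integrable assms)
  also have "\<dots> = PP \<alpha> (hnorm f) z"
    unfolding PP_hnorm unfolding PP_def norm_divide norm_powr_real by (simp add: ennreal_mult[symmetric])
  finally show ?thesis .
qed

lemma bergman_op_holomorphic: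
  assumes \<alpha>: "-1 < \<alpha>" and f: "f \<in> borel_measurable (bergman_measure \<alpha>)"
    and fin: "\<And>z. z \<in> upper_half_plane \<Longrightarrow> PP \<alpha> (hnorm f) z < top"
  shows "bergman_op \<alpha> f holomorphic_on upper_half_plane"
  unfolding bergman_op_def[abs_def]
proof (rule holomorphic_integral[OF open_upper_half_plane])
  fix w assume "w \<in> space (bergman_measure \<alpha>)"
  then have w: "w \<in> upper_half_plane" by (simp add: space_bergman_measure)
  show "(\<lambda>z. f w / (z - cnj w) powr of_real (2 + \<alpha>)) holomorphic_on upper_half_plane"
    using kernel_arg[OF _ w] by (intro holomorphic_intros) auto
next
  fix z assume z: "z \<in> upper_half_plane"
  show "(\<lambda>w. f w / (z - cnj w) powr of_real (2 + \<alpha>)) \<in> borel_measurable (bergman_measure \<alpha>)"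
    using borel_measurable_times[OF f kernel_bergman_measurable[OF z, of "2 + \<alpha>"]] by simp
next
  fix z0 assume z0: "z0 \<in> upper_half_plane"
  \<comment> \<open>On this ball \<open>Im z \<ge> Im z0 / 2\<close>, so
    \<open>norm (z - z0) \<le> Im z\<close> and the kernel comparison holds with factor
    \<open>2 powr (2 + \<alpha>)\<close>.\<close>
  define r where "r = Im z0 / 2"
  have r: "0 < r" using z0 by (simp add: r_def upper_half_plane_def)
  have near: "z \<in> upper_half_plane \<and> norm (z - z0) \<le> 1 * Im z" if "z \<in> ball z0 r" for z
  proof -
    have "norm (z - z0) < r" using that by (simp add: dist_norm norm_minus_commute)
    moreover have "\<bar>Im (z - z0)\<bar> \<le> norm (z - z0)" by (rule abs_Im_le_cmod)
    ultimately show ?thesis using r by (auto simp: r_def upper_half_plane_def)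
  qed
  define g where "g w = 2 powr (2 + \<alpha>) * norm (f w / (z0 - cnj w) powr of_real (2 + \<alpha>))" for w
  have "integrable (bergman_measure \<alpha>) g"
    unfolding g_def by (intro integrable_mult_right integrable_norm bergman_op_integrable f z0 fin)
  moreover have "norm (f w / (z - cnj w) powr of_real (2 + \<alpha>)) \<le> g w"
    if "z \<in> ball z0 r" "w \<in> space (bergman_measure \<alpha>)" for z w
  proof -
    have "1 / norm (z - cnj w) powr (2 + \<alpha>) \<le> (1 + 1) powr (2 + \<alpha>) * (1 / norm (z0 - cnj w) powr (2 + \<alpha>))"
      using near[OF that(1)] that(2) z0 \<alpha>
      by (intro kernel_harnack) (auto simp: space_bergman_measure)
    then have "norm (f w) * (1 / norm (z - cnj w) powr (2 + \<alpha>)) \<le> norm (f w) * ((1 + 1) powr (2 + \<alpha>) * (1 / norm (z0 - cnj w) powr (2 + \<alpha>)))"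
      by (rule mult_left_mono) simp
    then show ?thesis unfolding g_def norm_divide norm_powr_real by (simp add: mult_ac)
  qed
  ultimately show "\<exists>r>0. \<exists>g. integrable (bergman_measure \<alpha>) g \<and> ball z0 r \<subseteq> upper_half_plane \<and>
        (\<forall>z\<in>ball z0 r. \<forall>w\<in>space (bergman_measure \<alpha>). norm (f w / (z - cnj w) powr of_real (2 + \<alpha>)) \<le> g w)"
    using r near by (intro exI[of _ r] conjI exI[of _ g]) auto
qed

text \<open>With exponents two and weight one the mixed norm is the norm of \<open>L2\<close>, so
  the boundedness theorem covers the Bergman projection.\<close>

lemma mixed_space_unit:
  assumes "-1 < \<alpha>"
  shows "mixed_space 2 2 \<alpha> (\<lambda>_. 1)"
proof
  fix \<epsilon> :: real assume "0 < \<epsilon>"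
  have "1 \<le> 1 * max t (1 / t) powr \<epsilon> * 1" if "0 < t" for t :: real
  proof -
    have "1 \<le> max t (1 / t)" using that by (cases "t \<le> 1") (auto simp: le_max_iff_disj)
    then show ?thesis using \<open>0 < \<epsilon>\<close> by (simp add: ge_one_powr_ge_zero)
  qed
  then show "\<exists>C\<ge>0. \<forall>s>0::real. \<forall>t>0. 1 \<le> C * max t (1 / t) powr \<epsilon> * (1::real)"
    by (intro exI[of _ 1]) auto
qed (use assms in auto)

lemma mixed_norm_unit:
  assumes \<alpha>: "-1 < \<alpha>" and [measurable]: "f \<in> borel_measurable borel"
  shows "ennreal_powr (mixed_norm 2 2 \<alpha> (\<lambda>_. 1) f) 2 = (\<integral>\<^sup>+w. ennreal_powr (f w) 2 \<partial>bergman_measure \<alpha>)"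
proof -
  interpret mixed_space 2 2 \<alpha> "\<lambda>_. 1" by (rule mixed_space_unit[OF \<alpha>])
  show ?thesis
    by (subst mixed_norm_powr) (auto simp: nn_integral_bergman)
qed

lemma square_integrable_props:
  assumes \<alpha>: "-1 < \<alpha>" and f: "square_integrable_fun (bergman_measure \<alpha>) f"
  shows "mixed_norm 2 2 \<alpha> (\<lambda>_. 1) (hnorm f) < top"
    and "z \<in> upper_half_plane \<Longrightarrow> PP \<alpha> (hnorm f) z < top"
    and "(\<integral>\<^sup>+z. ennreal_powr (PP \<alpha> (hnorm f) z) 2 \<partial>bergman_measure \<alpha>) < top"
proof -
  interpret mixed_space 2 2 \<alpha> "\<lambda>_. 1" by (rule mixed_space_unit[OF \<alpha>])
  have fm: "f \<in> borel_measurable (bergman_measure \<alpha>)" and fi: "integrable (bergman_measure \<alpha>) (\<lambda>w. (norm (f w))\<^sup>2)"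
    using f by (auto simp: square_integrable_fun_def)
  note [measurable] = hnorm_measurable[OF fm]
  have "(\<integral>\<^sup>+w. ennreal_powr (hnorm f w) 2 \<partial>bergman_measure \<alpha>) = (\<integral>\<^sup>+w. ennreal ((norm (f w))\<^sup>2) \<partial>bergman_measure \<alpha>)"
    by (intro nn_integral_cong) (simp add: space_bergman_measure hnorm_def)
  also have "\<dots> < top"
    using fi unfolding integrable_iff_bounded by simp
  finally have "ennreal_powr (N (hnorm f)) 2 < top"
    by (subst mixed_norm_unit[OF \<alpha>]) auto
  then show N: "N (hnorm f) < top" by simp
  then show "z \<in> upper_half_plane \<Longrightarrow> PP \<alpha> (hnorm f) z < top"
    by (intro PP_finite) auto
  obtain K :: real where "N (PP \<alpha> (hnorm f)) \<le> ennreal K * N (hnorm f)" using PP_bounded hnorm_measurable[OF fm] by blast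
  also have "\<dots> < top" using N by (simp add: ennreal_mult_less_top)
  finally have "ennreal_powr (N (PP \<alpha> (hnorm f))) 2 < top" by simp
  then show "(\<integral>\<^sup>+z. ennreal_powr (PP \<alpha> (hnorm f) z) 2 \<partial>bergman_measure \<alpha>) < top"
    by (subst (asm) mixed_norm_unit[OF \<alpha>]) auto
qed

lemma bergman_op_A2:
  assumes \<alpha>: "-1 < \<alpha>" and f: "square_integrable_fun (bergman_measure \<alpha>) f"
  shows "(\<lambda>z. c * bergman_op \<alpha> f z) \<in> bergman_A2 \<alpha>"
proof -
  have fm: "f \<in> borel_measurable (bergman_measure \<alpha>)" using f by (auto simp: square_integrable_fun_def)
  note sp = square_integrable_props[OF \<alpha> f]
  have hol: "bergman_op \<alpha> f holomorphic_on upper_half_plane"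
    by (rule bergman_op_holomorphic[OF \<alpha> fm sp(2)])
  have m: "bergman_op \<alpha> f \<in> borel_measurable (bergman_measure \<alpha>)"
    by (rule holomorphic_bergman_measurable[OF hol])
  have "integrable (bergman_measure \<alpha>) (\<lambda>z. (norm (bergman_op \<alpha> f z))\<^sup>2)"
  proof (rule integrableI_bounded)
    show "(\<lambda>z. (norm (bergman_op \<alpha> f z))\<^sup>2) \<in> borel_measurable (bergman_measure \<alpha>)"
      using m by measurable
    have "(\<integral>\<^sup>+z. ennreal (norm ((norm (bergman_op \<alpha> f z))\<^sup>2)) \<partial>bergman_measure \<alpha>)
      \<le> (\<integral>\<^sup>+z. ennreal_powr (PP \<alpha> (hnorm f) z) 2 \<partial>bergman_measure \<alpha>)"
    proof (rule nn_integral_mono)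
      fix z assume "z \<in> space (bergman_measure \<alpha>)"
      then have z: "z \<in> upper_half_plane" by (simp add: space_bergman_measure)
      have "ennreal_powr (ennreal (norm (bergman_op \<alpha> f z))) 2 \<le> ennreal_powr (PP \<alpha> (hnorm f) z) 2"
        by (intro ennreal_powr_mono bergman_op_norm_le fm z sp(2)) simp
      then show "ennreal (norm ((norm (bergman_op \<alpha> f z))\<^sup>2)) \<le> ennreal_powr (PP \<alpha> (hnorm f) z) 2"
        by simp
    qed
    also have "\<dots> < \<infinity>" using sp(3) by simp
    finally show "(\<integral>\<^sup>+z. ennreal (norm ((norm (bergman_op \<alpha> f z))\<^sup>2)) \<partial>bergman_measure \<alpha>) < \<infinity>" .
  qed
  then have "integrable (bergman_measure \<alpha>) (\<lambda>z. (norm (c * bergman_op \<alpha> f z))\<^sup>2)"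
    by (simp add: norm_mult power_mult_distrib)
  then show ?thesis
    using m hol by (auto simp: bergman_A2_def square_integrable_fun_def intro!: holomorphic_intros)
qed

section \<open>Self-adjointness of the projection and the value of its constant\<close>

lemma A2_reproducing:
  assumes \<alpha>: "-1 < \<alpha>" and g: "g \<in> bergman_A2 \<alpha>" and z: "z \<in> upper_half_plane"
  shows "g z = reproducing_const \<alpha> * bergman_op \<alpha> g z"
  unfolding bergman_op_def
  using g z square_integrable_props(2)[OF \<alpha>, of g z]
  by (intro reproducing_formula(2)[OF \<alpha>]) (auto simp: bergman_A2_def PP_hnorm)

text \<open>The identity \<open>(2 * \<i>) powr s / \<xi> powr s = 2 powr s / (- \<i> * \<xi>) powr
  s\<close> moves the power to the right half-plane, where the principal branch commutes with
  conjugation; and conjugation exchanges \<open>z\<close> and \<open>w\<close> in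
  \<open>- \<i> * (z - cnj w)\<close>.\<close>

lemma reproducing_kernel_hermitian:
  assumes z: "z \<in> upper_half_plane" and w: "w \<in> upper_half_plane"
  shows "cnj (reproducing_const \<alpha> * kernel_fun \<alpha> (z - cnj w)) = reproducing_const \<alpha> * kernel_fun \<alpha> (w - cnj z)"
proof -
  define s where "s = complex_of_real (2 + \<alpha>)"
  have eq: "(2 * \<i>) powr s / \<xi> powr s = 2 powr s / (- \<i> * \<xi>) powr s" if "0 < Im \<xi>" for \<xi>
  proof -
    have "(\<i> * (- \<i> * \<xi>)) powr s = \<i> powr s * (- \<i> * \<xi>) powr s"
      using that by (intro powr_mult_real_part_pos) auto
    moreover have "(\<i> * 2) powr s = \<i> powr s * 2 powr s"
      by (intro powr_mult_real_part_pos) auto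
    moreover have "\<i> powr s \<noteq> 0" by (simp add: powr_def)
    ultimately show ?thesis by (simp add: mult.commute[of 2] mult.assoc[symmetric])
  qed
  have im: "0 < Im (z - cnj w)" "0 < Im (w - cnj z)" using z w by (auto simp: upper_half_plane_def)
  have "cnj ((- \<i> * (z - cnj w)) powr s) = cnj (- \<i> * (z - cnj w)) powr cnj s"
    using im by (intro cnj_powr) auto
  also have "cnj (- \<i> * (z - cnj w)) = - \<i> * (w - cnj z)" by (simp add: algebra_simps)
  also have "cnj s = s" by (simp add: s_def)
  finally have "cnj ((2 * \<i>) powr s / (z - cnj w) powr s) = cnj (2 powr s) / (- \<i> * (w - cnj z)) powr s"
    unfolding eq[OF im(1)] by simp
  also have "cnj (2 powr s) = 2 powr s" by (subst cnj_powr) (auto simp: s_def)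
  finally have "cnj ((2 * \<i>) powr s / (z - cnj w) powr s) = (2 * \<i>) powr s / (w - cnj z) powr s"
    unfolding eq[OF im(2)] .
  then have main: "cnj ((2 * \<i>) powr s / (z - cnj w) powr s / of_real (4 * disc_mass \<alpha>))
      = (2 * \<i>) powr s / (w - cnj z) powr s / of_real (4 * disc_mass \<alpha>)"
    unfolding complex_cnj_divide[of _ "of_real (4 * disc_mass \<alpha>)"] by (simp only: complex_cnj_complex_of_real)
  have "reproducing_const \<alpha> * kernel_fun \<alpha> (z - cnj w)
      = ((2 * \<i>) powr s / (z - cnj w) powr s) / of_real (4 * disc_mass \<alpha>)"
    "reproducing_const \<alpha> * kernel_fun \<alpha> (w - cnj z)
      = ((2 * \<i>) powr s / (w - cnj z) powr s) / of_real (4 * disc_mass \<alpha>)"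
    using kernel_fun_eq[OF z w, of \<alpha>, symmetric] kernel_fun_eq[OF w z, of \<alpha>, symmetric]
    by (simp_all add: reproducing_const_def s_def)
  then show ?thesis by (simp only: main)
qed

lemma integrable_mult_cnj:
  assumes f: "square_integrable_fun M f" and g: "square_integrable_fun M g"
  shows "integrable M (\<lambda>w. f w * cnj (g w))"
proof (rule Bochner_Integration.integrable_bound[where f = "\<lambda>w. (norm (f w))\<^sup>2 + (norm (g w))\<^sup>2"])
  show "integrable M (\<lambda>w. (norm (f w))\<^sup>2 + (norm (g w))\<^sup>2)"
    using f g by (auto simp: square_integrable_fun_def)
  show "(\<lambda>w. f w * cnj (g w)) \<in> borel_measurable M"
    using f g by (auto simp: square_integrable_fun_def)
  show "AE w in M. norm (f w * cnj (g w)) \<le> norm ((norm (f w))\<^sup>2 + (norm (g w))\<^sup>2)"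
  proof (rule AE_I2)
    fix w
    have "2 * (norm (f w) * norm (g w)) \<le> (norm (f w))\<^sup>2 + (norm (g w))\<^sup>2"
      using sum_squares_bound[of "norm (f w)" "norm (g w)"] by (simp add: mult.assoc)
    moreover have "0 \<le> norm (f w) * norm (g w)" by simp
    ultimately have "norm (f w) * norm (g w) \<le> (norm (f w))\<^sup>2 + (norm (g w))\<^sup>2" by linarith
    then show "norm (f w * cnj (g w)) \<le> norm ((norm (f w))\<^sup>2 + (norm (g w))\<^sup>2)"
      by (simp add: norm_mult)
  qed
qed

lemma ennreal_mult_le_squares: "(x::ennreal) * y \<le> ennreal_powr x 2 + ennreal_powr y 2"
proof (cases x; cases y)
  fix a b assume ab: "0 \<le> a" "x = ennreal a" "0 \<le> b" "y = ennreal b"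
  have "2 * (a * b) \<le> a\<^sup>2 + b\<^sup>2" using sum_squares_bound[of a b] by (simp add: mult.assoc)
  moreover have "0 \<le> a * b" using ab by simp
  ultimately have "a * b \<le> a\<^sup>2 + b\<^sup>2" by linarith
  then show ?thesis using ab
    by (simp add: ennreal_mult[symmetric] ennreal_plus[symmetric] del: ennreal_plus)
qed auto

text \<open>By Hermitian symmetry of the kernel the operator moves from \<open>f\<close> to
  \<open>g\<close>, and it fixes \<open>g\<close> by the reproducing formula. Fubini is justified by
  the square integrability of \<open>PP \<alpha> (hnorm f)\<close>.\<close>

lemma bergman_op_adjoint:
  assumes \<alpha>: "-1 < \<alpha>" and f: "square_integrable_fun (bergman_measure \<alpha>) f" and g: "g \<in> bergman_A2 \<alpha>"
  shows "(LINT z|bergman_measure \<alpha>. (reproducing_const \<alpha> * bergman_op \<alpha> f z) * cnj (g z))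
    = (LINT w|bergman_measure \<alpha>. f w * cnj (g w))"
proof -
  define B where "B = bergman_measure \<alpha>"
  define c where "c = reproducing_const \<alpha>"
  interpret B: sigma_finite_measure B unfolding B_def by (rule sigma_finite_bergman_measure)
  interpret BB: pair_sigma_finite B B ..
  have gs: "square_integrable_fun B g" using g by (simp add: bergman_A2_def B_def)
  have fm [measurable]: "f \<in> borel_measurable B" and gm [measurable]: "g \<in> borel_measurable B"
    using f gs by (auto simp: square_integrable_fun_def B_def)
  have idm [measurable]: "(\<lambda>w. w) \<in> B \<rightarrow>\<^sub>M borel"
    unfolding B_def by (rule borel_measurable_bergman_measure) simp
  have sB: "space B = upper_half_plane" by (simp add: B_def space_bergman_measure)
  note sp = square_integrable_props[OF \<alpha> f]
  define J where "J z w = c * kernel_fun \<alpha> (z - cnj w) * f w * cnj (g z)" for z w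
  have J [measurable]: "case_prod J \<in> borel_measurable (B \<Otimes>\<^sub>M B)"
  proof -
    have [measurable]: "(\<lambda>x. fst x) \<in> B \<Otimes>\<^sub>M B \<rightarrow>\<^sub>M borel" "(\<lambda>x. snd x) \<in> B \<Otimes>\<^sub>M B \<rightarrow>\<^sub>M borel"
      using measurable_compose[OF measurable_fst idm] measurable_compose[OF measurable_snd idm] by auto
    show ?thesis unfolding J_def split_def by measurable
  qed
  have intJ: "integrable (B \<Otimes>\<^sub>M B) (case_prod J)"
  proof (rule integrableI_bounded[OF J])
    have cfm [measurable]: "hnorm f \<in> borel_measurable B"
      unfolding B_def using hnorm_measurable[OF fm[unfolded B_def]] by (rule borel_measurable_bergman_measure)
    have PPm: "PP \<alpha> (hnorm f) \<in> borel_measurable B"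
      unfolding B_def using hnorm_measurable[OF fm[unfolded B_def]]
      by (intro borel_measurable_bergman_measure PP_measurable)
    have "(\<integral>\<^sup>+x. ennreal (norm (case_prod J x)) \<partial>(B \<Otimes>\<^sub>M B)) = (\<integral>\<^sup>+z. (\<integral>\<^sup>+w. ennreal (norm (J z w)) \<partial>B) \<partial>B)"
      by (subst B.nn_integral_fst[symmetric]) auto
    also have "\<dots> = (\<integral>\<^sup>+z. ennreal (norm c * norm (g z)) * PP \<alpha> (hnorm f) z \<partial>B)"
    proof (rule nn_integral_cong)
      fix z assume z: "z \<in> space B"
      have "(\<integral>\<^sup>+w. ennreal (norm (J z w)) \<partial>B)
        = (\<integral>\<^sup>+w. ennreal (norm c * norm (g z)) * (hnorm f w * ennreal (1 / norm (z - cnj w) powr (2 + \<alpha>))) \<partial>B)"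
      proof (rule nn_integral_cong)
        fix w assume w: "w \<in> space B"
        show "ennreal (norm (J z w)) = ennreal (norm c * norm (g z)) * (hnorm f w * ennreal (1 / norm (z - cnj w) powr (2 + \<alpha>)))"
          using z w unfolding sB
          by (simp add: J_def hnorm_def norm_mult kernel_fun_norm ennreal_mult[symmetric] mult_ac)
      qed
      also have "\<dots> = ennreal (norm c * norm (g z)) * (\<integral>\<^sup>+w. hnorm f w * ennreal (1 / norm (z - cnj w) powr (2 + \<alpha>)) \<partial>B)"
        by (rule nn_integral_cmult) measurable
      finally show "(\<integral>\<^sup>+w. ennreal (norm (J z w)) \<partial>B) = ennreal (norm c * norm (g z)) * PP \<alpha> (hnorm f) z"
        by (simp add: PP_def B_def)
    qed
    also have "\<dots> \<le> (\<integral>\<^sup>+z. ennreal_powr (ennreal (norm c * norm (g z))) 2 + ennreal_powr (PP \<alpha> (hnorm f) z) 2 \<partial>B)"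
      by (intro nn_integral_mono ennreal_mult_le_squares)
    also have "\<dots> = (\<integral>\<^sup>+z. ennreal ((norm c)\<^sup>2 * (norm (g z))\<^sup>2) \<partial>B) + (\<integral>\<^sup>+z. ennreal_powr (PP \<alpha> (hnorm f) z) 2 \<partial>B)"
      using PPm by (subst nn_integral_add) (auto simp: power_mult_distrib)
    also have "\<dots> < \<infinity>"
    proof -
      have "integrable B (\<lambda>z. (norm c)\<^sup>2 * (norm (g z))\<^sup>2)" using gs by (auto simp: square_integrable_fun_def)
      then show ?thesis using sp(3) unfolding integrable_iff_bounded B_def by simp
    qed
    finally show "(\<integral>\<^sup>+x. ennreal (norm (case_prod J x)) \<partial>(B \<Otimes>\<^sub>M B)) < \<infinity>" .
  qed
  have "(LINT z|B. (c * bergman_op \<alpha> f z) * cnj (g z)) = (LINT z|B. (LINT w|B. J z w))"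
  proof (rule Bochner_Integration.integral_cong[OF refl])
    fix z assume z: "z \<in> space B"
    have "(LINT w|B. J z w) = (LINT w|B. (c * cnj (g z)) * (f w / (z - cnj w) powr of_real (2 + \<alpha>)))"
      using z kernel_fun_eq[of z _ \<alpha>]
      by (intro Bochner_Integration.integral_cong[OF refl]) (auto simp: J_def sB mult_ac simp flip: kernel_fun_eq)
    also have "\<dots> = (c * cnj (g z)) * bergman_op \<alpha> f z"
      unfolding bergman_op_def B_def by (rule integral_mult_right_zero)
    finally show "(c * bergman_op \<alpha> f z) * cnj (g z) = (LINT w|B. J z w)"
      by (simp add: mult_ac)
  qed
  also have "\<dots> = (LINT w|B. (LINT z|B. J z w))"
    using BB.Fubini_integral[OF intJ] by simp
  also have "\<dots> = (LINT w|B. f w * cnj (g w))"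
  proof (rule Bochner_Integration.integral_cong[OF refl])
    fix w assume w: "w \<in> space B"
    have "(LINT z|B. J z w) = (LINT z|B. f w * cnj (c * (g z / (w - cnj z) powr of_real (2 + \<alpha>))))"
    proof (rule Bochner_Integration.integral_cong[OF refl])
      fix z assume z: "z \<in> space B"
      have "c * kernel_fun \<alpha> (z - cnj w) = cnj (c * kernel_fun \<alpha> (w - cnj z))"
        using reproducing_kernel_hermitian[of w z \<alpha>] z w by (simp add: c_def sB)
      also have "kernel_fun \<alpha> (w - cnj z) = 1 / (w - cnj z) powr of_real (2 + \<alpha>)"
        using kernel_fun_eq[of w z \<alpha>] z w by (simp add: sB)
      finally show "J z w = f w * cnj (c * (g z / (w - cnj z) powr of_real (2 + \<alpha>)))"
        unfolding J_def by simp
    qed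
    also have "\<dots> = f w * cnj (LINT z|B. c * (g z / (w - cnj z) powr of_real (2 + \<alpha>)))"
      by (simp only: integral_mult_right_zero Bochner_Integration.integral_cnj)
    also have "(LINT z|B. c * (g z / (w - cnj z) powr of_real (2 + \<alpha>))) = g w"
      using A2_reproducing[OF \<alpha> g, of w] w by (simp only: integral_mult_right_zero) (simp add: bergman_op_def B_def c_def sB[unfolded B_def])
    finally show "(LINT z|B. J z w) = f w * cnj (g w)" .
  qed
  finally show ?thesis by (simp add: B_def c_def)
qed

lemma reproducing_const_nonzero:
  assumes "-1 < \<alpha>" shows "reproducing_const \<alpha> \<noteq> 0"
  using disc_mass_pos[OF assms] by (simp add: reproducing_const_def powr_def)

theorem bergman_const_eq:
  assumes \<alpha>: "-1 < \<alpha>"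
  shows "bergman_const \<alpha> = reproducing_const \<alpha>"
  unfolding bergman_const_def bergman_op_kernel
proof (rule the_equality)
  show "is_bergman_projection \<alpha> (\<lambda>f z. reproducing_const \<alpha> * bergman_op \<alpha> f z)"
    unfolding is_bergman_projection_def
  proof (intro allI impI conjI ballI)
    fix f assume f: "square_integrable_fun (bergman_measure \<alpha>) f"
    show A2: "(\<lambda>z. reproducing_const \<alpha> * bergman_op \<alpha> f z) \<in> bergman_A2 \<alpha>"
      by (rule bergman_op_A2[OF \<alpha> f])
    fix g assume g: "g \<in> bergman_A2 \<alpha>"
    have gs: "square_integrable_fun (bergman_measure \<alpha>) g" using g by (simp add: bergman_A2_def)
    have Ps: "square_integrable_fun (bergman_measure \<alpha>) (\<lambda>z. reproducing_const \<alpha> * bergman_op \<alpha> f z)"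
      using A2 by (simp add: bergman_A2_def)
    show "(LINT w|bergman_measure \<alpha>. (f w - reproducing_const \<alpha> * bergman_op \<alpha> f w) * cnj (g w)) = 0"
      using integrable_mult_cnj[OF f gs] integrable_mult_cnj[OF Ps gs] bergman_op_adjoint[OF \<alpha> f g]
      by (simp add: left_diff_distrib)
  qed
next
  \<comment> \<open>Uniqueness: for a \<open>g\<close> in \<open>bergman_A2 \<alpha>\<close> of
    positive norm, \<open>g - c * bergman_op \<alpha> g\<close> equals
    \<open>(1 - c / c0) * g\<close>, and orthogonality to \<open>g\<close> itself forces
    \<open>c = c0\<close>.\<close>
  fix c assume c: "is_bergman_projection \<alpha> (\<lambda>f z. c * bergman_op \<alpha> f z)"
  define c0 where "c0 = reproducing_const \<alpha>"
  have c0: "c0 \<noteq> 0" using reproducing_const_nonzero[OF \<alpha>] by (simp add: c0_def)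
  define g where "g z = 1 / (z + \<i>) powr of_real (2 + \<alpha>)" for z
  have i: "\<i> \<in> upper_half_plane" by (simp add: upper_half_plane_def)
  have arg: "z + \<i> = z - cnj \<i>" for z by simp
  have ghol: "g holomorphic_on upper_half_plane"
    unfolding g_def[abs_def] arg using kernel_arg[OF _ i] by (intro holomorphic_intros) auto
  have gnorm: "(norm (g z))\<^sup>2 = 1 / norm (z + \<i>) powr (4 + 2 * \<alpha>)" for z
    unfolding g_def norm_divide norm_powr_real norm_one
    by (simp add: power2_eq_square powr_add[symmetric])
  have gint: "integrable (bergman_measure \<alpha>) (\<lambda>z. (norm (g z))\<^sup>2)"
  proof (rule integrableI_bounded)
    show "(\<lambda>z. (norm (g z))\<^sup>2) \<in> borel_measurable (bergman_measure \<alpha>)"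
      using holomorphic_bergman_measurable[OF ghol] by measurable
    show "(\<integral>\<^sup>+z. ennreal (norm ((norm (g z))\<^sup>2)) \<partial>bergman_measure \<alpha>) < \<infinity>"
      using nn_integral_square_kernel_finite[OF \<alpha>] by (simp add: gnorm)
  qed
  then have gA: "g \<in> bergman_A2 \<alpha>"
    using ghol holomorphic_bergman_measurable[OF ghol] by (simp add: bergman_A2_def square_integrable_fun_def)
  then have gs: "square_integrable_fun (bergman_measure \<alpha>) g" by (simp add: bergman_A2_def)
  have "(LINT w|bergman_measure \<alpha>. (g w - c * bergman_op \<alpha> g w) * cnj (g w)) = 0"
    using c gs gA unfolding is_bergman_projection_def by blast
  also have "(LINT w|bergman_measure \<alpha>. (g w - c * bergman_op \<alpha> g w) * cnj (g w))
    = (LINT w|bergman_measure \<alpha>. (1 - c / c0) * of_real ((norm (g w))\<^sup>2))"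
  proof (rule Bochner_Integration.integral_cong[OF refl])
    fix w assume "w \<in> space (bergman_measure \<alpha>)"
    then have "g w = c0 * bergman_op \<alpha> g w"
      using A2_reproducing[OF \<alpha> gA] by (simp add: c0_def space_bergman_measure)
    then have "g w - c * bergman_op \<alpha> g w = (1 - c / c0) * g w"
      using c0 by (simp add: field_simps)
    then show "(g w - c * bergman_op \<alpha> g w) * cnj (g w) = (1 - c / c0) * of_real ((norm (g w))\<^sup>2)"
      by (simp only: complex_norm_square mult.assoc)
  qed
  also have "\<dots> = (1 - c / c0) * of_real (LINT w|bergman_measure \<alpha>. (norm (g w))\<^sup>2)"
    by (simp only: integral_mult_right_zero integral_complex_of_real)
  finally have "1 - c / c0 = 0 \<or> (LINT w|bergman_measure \<alpha>. (norm (g w))\<^sup>2) = 0" by simp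
  moreover have "(LINT w|bergman_measure \<alpha>. (norm (g w))\<^sup>2) \<noteq> 0"
  proof
    assume "(LINT w|bergman_measure \<alpha>. (norm (g w))\<^sup>2) = 0"
    then have "AE w in bergman_measure \<alpha>. (norm (g w))\<^sup>2 = 0"
      using integral_nonneg_eq_0_iff_AE[OF gint] by simp
    moreover have "AE w in bergman_measure \<alpha>. (norm (g w))\<^sup>2 \<noteq> 0"
      using kernel_arg(4)[OF _ i, of _ "of_real (2 + \<alpha>)"] by (intro AE_I2) (simp add: g_def space_bergman_measure)
    ultimately have "AE w in bergman_measure \<alpha>. False" by eventually_elim simp
    then have "AE w in lborel. w \<notin> upper_half_plane" by (simp add: AE_bergman_measure)
    then have "AE w in lborel. w \<notin> ball \<i> 1"
    proof eventually_elim
      case (elim w)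
      then show ?case using abs_Im_le_cmod[of "\<i> - w"] by (auto simp: upper_half_plane_def dist_norm)
    qed
    then have "emeasure lborel (ball \<i> 1) = 0"
      by (subst (asm) AE_iff_measurable[of "ball \<i> 1"]) auto
    then show False using content_ball_pos[of 1 \<i>] by (auto simp: measure_def)
  qed
  ultimately have "1 - c / c0 = 0" by blast
  then show "c = reproducing_const \<alpha>" using c0 by (simp add: c0_def)
qed

subsection \<open>Sums over the lattice\<close>

text \<open>Both sides are the supremum of the finite partial sums, compared along an enumeration of
  the integers. This links the sums in \<open>coeff_norm_pow\<close> to integrals over counting
  measure, where Fubini is available.\<close>

lemma nn_integral_count_space_infsum:
  fixes f :: "int \<Rightarrow> ennreal"
  shows "(\<integral>\<^sup>+i. f i \<partial>count_space UNIV) = (\<Sum>\<^sub>\<infinity>i\<in>UNIV. f i)"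
proof -
  define e where "e = from_nat_into (UNIV :: int set)"
  have e: "bij_betw e UNIV UNIV"
    unfolding e_def by (rule bij_betw_from_nat_into) (auto simp: infinite_UNIV_int)
  have inf: "(\<Sum>\<^sub>\<infinity>i\<in>UNIV. f i) = (SUP F\<in>{F. finite F \<and> F \<subseteq> UNIV}. sum f F)"
    by (rule nonneg_infsum_complete) auto
  have "(\<integral>\<^sup>+i. f i \<partial>count_space UNIV) = (\<integral>\<^sup>+n. f (e n) \<partial>count_space UNIV)"
    by (rule nn_integral_bij_count_space[OF e, symmetric])
  also have "\<dots> = (SUP n. \<Sum>i<n. f (e i))"
    by (simp add: nn_integral_count_space_nat suminf_eq_SUP)
  also have "\<dots> = (\<Sum>\<^sub>\<infinity>i\<in>UNIV. f i)"
  proof (rule antisym)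
    show "(SUP n. \<Sum>i<n. f (e i)) \<le> (\<Sum>\<^sub>\<infinity>i\<in>UNIV. f i)"
    proof (rule SUP_least)
      fix n
      have "(\<Sum>i<n. f (e i)) = sum f (e ` {..<n})"
        using e by (subst sum.reindex) (auto simp: bij_betw_def inj_on_def)
      then show "(\<Sum>i<n. f (e i)) \<le> (\<Sum>\<^sub>\<infinity>i\<in>UNIV. f i)"
        unfolding inf by (auto intro!: SUP_upper)
    qed
    show "(\<Sum>\<^sub>\<infinity>i\<in>UNIV. f i) \<le> (SUP n. \<Sum>i<n. f (e i))"
      unfolding inf
    proof (rule SUP_least)
      fix F :: "int set" assume "F \<in> {F. finite F \<and> F \<subseteq> UNIV}"
      then have F: "finite F" by simp
      define g where "g = inv_into UNIV e"
      have eg: "e (g i) = i" for i using e by (simp add: g_def f_inv_into_f bij_betw_def)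
      obtain n where n: "g ` F \<subseteq> {..<n}" using F finite_nat_iff_bounded[of "g ` F"] by blast
      have "sum f F = (\<Sum>i\<in>g ` F. f (e i))"
        by (subst sum.reindex) (auto simp: eg inj_on_def, metis eg)
      also have "\<dots> \<le> (\<Sum>i<n. f (e i))" using n by (intro sum_mono2) auto
      finally show "sum f F \<le> (SUP n. \<Sum>i<n. f (e i))" by (meson SUP_upper2 UNIV_I)
    qed
  qed
  finally show ?thesis .
qed

lemma nn_integral_floor:
  assumes h: "0 < h"
  shows "(\<integral>\<^sup>+x. b \<lfloor>x / h\<rfloor> \<partial>lborel) = ennreal h * (\<integral>\<^sup>+l. b l \<partial>count_space UNIV)"
proof -
  have iff: "l = \<lfloor>x / h\<rfloor> \<longleftrightarrow> x \<in> {of_int l * h..<(of_int l + 1) * h}" for l x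
    using h by (auto simp: pos_le_divide_eq pos_divide_less_eq floor_eq_iff eq_commute[of l])
  have "(\<integral>\<^sup>+x. b \<lfloor>x / h\<rfloor> \<partial>lborel)
    = (\<integral>\<^sup>+x. (\<integral>\<^sup>+l. b l * indicator {of_int l * h..<(of_int l + 1) * h} x \<partial>count_space UNIV) \<partial>lborel)"
  proof (rule nn_integral_cong)
    fix x
    have "indicator {of_int l * h..<(of_int l + 1) * h} x = (indicator {\<lfloor>x / h\<rfloor>} l :: ennreal)" for l
      by (simp only: indicator_def singleton_iff iff)
    then have "(\<integral>\<^sup>+l. b l * indicator {of_int l * h..<(of_int l + 1) * h} x \<partial>count_space UNIV)
      = (\<integral>\<^sup>+l. b l * indicator {\<lfloor>x / h\<rfloor>} l \<partial>count_space UNIV)"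
      by (simp only:)
    then show "b \<lfloor>x / h\<rfloor> = (\<integral>\<^sup>+l. b l * indicator {of_int l * h..<(of_int l + 1) * h} x \<partial>count_space UNIV)"
      by simp
  qed
  also have "\<dots> = (\<integral>\<^sup>+l. (\<integral>\<^sup>+x. b l * indicator {of_int l * h..<(of_int l + 1) * h} x \<partial>lborel) \<partial>count_space UNIV)"
    by (rule nn_integral_count_space_nn_integral) auto
  also have "\<dots> = (\<integral>\<^sup>+l. ennreal h * b l \<partial>count_space UNIV)"
  proof (rule nn_integral_cong)
    fix l :: int
    have "of_int l * h \<le> (of_int l + 1) * h" using h by simp
    then show "(\<integral>\<^sup>+x. b l * indicator {of_int l * h..<(of_int l + 1) * h} x \<partial>lborel) = ennreal h * b l"
      by (subst nn_integral_cmult_indicator) (auto simp: algebra_simps)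
  qed
  also have "\<dots> = ennreal h * (\<integral>\<^sup>+l. b l \<partial>count_space UNIV)" by (rule nn_integral_cmult) simp
  finally show ?thesis .
qed

text \<open>\<open>d\<close> is the horizontal spacing of a row relative to its height. The lattice
  of the theorem has \<open>d = \<delta>\<^sup>2 / 8\<close>, since
  \<open>\<delta>\<^sup>2 / 4 * 2 powr (\<gamma> * j - 1)\<close> is
  \<open>\<delta>\<^sup>2 / 8 * 2 powr (\<gamma> * j)\<close>.\<close>

locale lattice_space = mixed_space +
  fixes \<gamma> d :: real
  assumes gamma: "0 < \<gamma>" and d: "0 < d"
begin

definition sc :: "int \<Rightarrow> real" where "sc j = 2 powr (\<gamma> * of_int j)"

definition row :: "real \<Rightarrow> int" where "row y = \<lfloor>log 2 y / \<gamma>\<rfloor>"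

text \<open>The cells are half-open rectangles with the lattice point as lower left corner; they
  tile the half-plane, and the index map encodes this tiling.\<close>

definition idx :: "complex \<Rightarrow> int \<times> int" where
  "idx w = (\<lfloor>Re w / (d * sc (row (Im w)))\<rfloor>, row (Im w))"

definition pt :: "int \<times> int \<Rightarrow> complex" where
  "pt i = Complex (d * of_int (fst i) * sc (snd i)) (sc (snd i))"

text \<open>Width plus height of a cell, relative to the height of its lattice point. It bounds the
  distance from the lattice point to any point of the cell.\<close>

definition \<eta> :: real where "\<eta> = d + (2 powr \<gamma> - 1)"

lemma sc_pos [simp]: "0 < sc j" by (simp add: sc_def)

lemma sc_nonneg [simp]: "0 \<le> sc j" by (simp add: sc_def)

lemma sc_nonzero [simp]: "sc j \<noteq> 0" using sc_pos[of j] by linarith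

lemma sc_Suc: "sc (j + 1) = 2 powr \<gamma> * sc j"
  by (simp add: sc_def algebra_simps powr_add)

lemma two_powr_gamma: "1 < 2 powr \<gamma>" using gamma by simp

lemma eta_pos: "0 < \<eta>" using d two_powr_gamma by (simp add: \<eta>_def)

lemma row_eq_iff:
  assumes "0 < y"
  shows "row y = j \<longleftrightarrow> sc j \<le> y \<and> y < sc (j + 1)"
proof -
  have "row y = j \<longleftrightarrow> of_int j \<le> log 2 y / \<gamma> \<and> log 2 y / \<gamma> < of_int j + 1"
    by (simp add: row_def floor_eq_iff)
  also have "\<dots> \<longleftrightarrow> \<gamma> * of_int j \<le> log 2 y \<and> log 2 y < \<gamma> * of_int (j + 1)"
    using gamma by (simp add: pos_le_divide_eq pos_divide_less_eq mult.commute)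
  also have "\<dots> \<longleftrightarrow> sc j \<le> y \<and> y < sc (j + 1)"
    unfolding sc_def using assms by (simp add: le_log_iff log_less_iff)
  finally show ?thesis .
qed

lemma pt_upper [simp]: "pt i \<in> upper_half_plane" by (simp add: pt_def upper_half_plane_def)

lemma Im_pt [simp]: "Im (pt i) = sc (snd i)" by (simp add: pt_def)

lemma row_bounds:
  assumes "w \<in> upper_half_plane"
  shows "sc (snd (idx w)) \<le> Im w" "Im w < 2 powr \<gamma> * sc (snd (idx w))"
  using row_eq_iff[of "Im w" "row (Im w)"] assms by (auto simp: idx_def sc_Suc upper_half_plane_def)

lemma idx_dist:
  assumes w: "w \<in> upper_half_plane"
  shows "norm (w - pt (idx w)) \<le> \<eta> * sc (snd (idx w))"
proof -
  define j where "j = row (Im w)"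
  define l where "l = \<lfloor>Re w / (d * sc j)\<rfloor>"
  have i: "idx w = (l, j)" by (simp add: idx_def j_def l_def)
  have dp: "0 < d * sc j" using d by simp
  have "of_int l \<le> Re w / (d * sc j)" "Re w / (d * sc j) < of_int l + 1" by (auto simp: l_def)
  then have "of_int l * (d * sc j) \<le> Re w" "Re w < (of_int l + 1) * (d * sc j)"
    using dp by (auto simp: pos_le_divide_eq pos_divide_less_eq)
  then have "\<bar>Re (w - pt (idx w))\<bar> \<le> d * sc j" by (simp add: i pt_def algebra_simps)
  moreover have "\<bar>Im (w - pt (idx w))\<bar> \<le> (2 powr \<gamma> - 1) * sc j"
    using row_bounds[OF w] by (simp add: i algebra_simps)
  ultimately show ?thesis
    using cmod_le[of "w - pt (idx w)"] by (simp add: i \<eta>_def algebra_simps)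
qed

lemma row_measurable [measurable]: "row \<in> borel \<rightarrow>\<^sub>M count_space UNIV"
  unfolding row_def[abs_def] by measurable

lemma idx_measurable [measurable]: "idx \<in> borel \<rightarrow>\<^sub>M count_space UNIV"
proof (subst measurable_count_space_eq_countable, simp, intro conjI ballI)
  fix a :: "int \<times> int"
  have "idx -` {a} \<inter> space borel
    = {w. \<lfloor>Re w / (d * sc (snd a))\<rfloor> = fst a \<and> row (Im w) = snd a}"
    by (cases a) (auto simp: idx_def)
  also have "\<dots> \<in> sets borel" by measurable
  finally show "idx -` {a} \<inter> space borel \<in> sets borel" .
qed simp

section \<open>Step functions on the cells and the coefficient norm\<close>

definition step :: "(int \<times> int \<Rightarrow> ennreal) \<Rightarrow> complex \<Rightarrow> ennreal" where
  "step a w = a (idx w)"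

lemma step_measurable [measurable]: "step a \<in> borel_measurable borel"
  unfolding step_def[abs_def] by measurable

definition cell :: "int \<times> int \<Rightarrow> complex set" where "cell i = idx -` {i}"

lemma cell_measurable [measurable]: "cell i \<in> sets borel"
  using measurable_sets[OF idx_measurable, of "{i}"] by (simp add: cell_def)

lemma step_eq_integral: "step a w = (\<integral>\<^sup>+i. a i * indicator (cell i) w \<partial>count_space UNIV)"
proof -
  have "(\<integral>\<^sup>+i. a i * indicator (cell i) w \<partial>count_space UNIV) = (\<integral>\<^sup>+i. a i * indicator {idx w} i \<partial>count_space UNIV)"
    by (intro nn_integral_cong) (auto simp: cell_def split: split_indicator)
  then show ?thesis by (simp add: step_def)
qed

text \<open>In the exponent, \<open>\<alpha> + 1\<close> comes from the mass of a row and
  \<open>q / p\<close> from the width \<open>d * sc j\<close> of its cells.\<close>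

definition coeff_norm :: "(int \<times> int \<Rightarrow> ennreal) \<Rightarrow> ennreal" where
  "coeff_norm a = (\<integral>\<^sup>+j. ennreal_powr (\<integral>\<^sup>+l. ennreal_powr (a (l, j)) p \<partial>count_space UNIV) (q / p)
      * ennreal (W (sc j) * sc j powr (\<alpha> + 1 + q / p)) \<partial>count_space UNIV)"

definition row_mass :: "int \<Rightarrow> ennreal" where
  "row_mass j = (\<integral>\<^sup>+y. ennreal (W y * y powr \<alpha>) * indicator {sc j..<sc (j + 1)} y \<partial>lborel)"

lemma weight_measurable [measurable]:
  "(\<lambda>y. ennreal (W y * y powr \<alpha>) * indicator {0<..} y) \<in> borel_measurable borel"
proof -
  have "(\<lambda>y. ennreal (W y * y powr \<alpha>) * indicator {0<..} y)
    = (\<lambda>y. ennreal (indicator {0<..} y * W y) * ennreal (y powr \<alpha>))"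
    by (auto simp: fun_eq_iff ennreal_mult'' split: split_indicator)
  then show ?thesis using density_measurable by simp
qed

lemma nn_integral_rows:
  "(\<integral>\<^sup>+y\<in>{0<..}. b (row y) * ennreal (W y * y powr \<alpha>) \<partial>lborel) = (\<integral>\<^sup>+j. b j * row_mass j \<partial>count_space UNIV)"
proof -
  have eq: "ennreal (W y * y powr \<alpha>) * indicator {sc j..<sc (j + 1)} y
      = (ennreal (W y * y powr \<alpha>) * indicator {0<..} y) * indicator {sc j..<sc (j + 1)} y" for y j
    using sc_pos[of j] by (auto split: split_indicator simp del: sc_pos)
  have meas [measurable]: "(\<lambda>y. ennreal (W y * y powr \<alpha>) * indicator {sc j..<sc (j + 1)} y) \<in> borel_measurable borel" for j
    unfolding eq by measurable
  have "(\<integral>\<^sup>+y\<in>{0<..}. b (row y) * ennreal (W y * y powr \<alpha>) \<partial>lborel)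
    = (\<integral>\<^sup>+y. (\<integral>\<^sup>+j. b j * (ennreal (W y * y powr \<alpha>) * indicator {sc j..<sc (j + 1)} y) \<partial>count_space UNIV) \<partial>lborel)"
  proof (rule nn_integral_cong)
    fix y :: real
    show "b (row y) * ennreal (W y * y powr \<alpha>) * indicator {0<..} y
      = (\<integral>\<^sup>+j. b j * (ennreal (W y * y powr \<alpha>) * indicator {sc j..<sc (j + 1)} y) \<partial>count_space UNIV)"
    proof (cases "0 < y")
      case True
      have row: "(j = row y) = (y \<in> {sc j..<sc (j + 1)})" for j
        using row_eq_iff[OF True, of j] by auto
      have "indicator {sc j..<sc (j + 1)} y = (indicator {row y} j :: ennreal)" for j
        by (simp only: indicator_def singleton_iff row)
      then have "(\<integral>\<^sup>+j. b j * (ennreal (W y * y powr \<alpha>) * indicator {sc j..<sc (j + 1)} y) \<partial>count_space UNIV)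
        = (\<integral>\<^sup>+j. b j * ennreal (W y * y powr \<alpha>) * indicator {row y} j \<partial>count_space UNIV)"
        by (simp only: mult.assoc)
      then show ?thesis using True by simp
    next
      case False
      then have "indicator {sc j..<sc (j + 1)} y = (0 :: ennreal)" for j
        using sc_pos[of j] by (auto split: split_indicator simp del: sc_pos)
      then show ?thesis using False by simp
    qed
  qed
  also have "\<dots> = (\<integral>\<^sup>+j. (\<integral>\<^sup>+y. b j * (ennreal (W y * y powr \<alpha>) * indicator {sc j..<sc (j + 1)} y) \<partial>lborel) \<partial>count_space UNIV)"
    by (rule nn_integral_count_space_nn_integral) auto
  also have "\<dots> = (\<integral>\<^sup>+j. b j * row_mass j \<partial>count_space UNIV)"
    by (intro nn_integral_cong) (simp add: row_mass_def nn_integral_cmult)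
  finally show ?thesis .
qed

lemma row_mass_bounds:
  "\<exists>c C::real. 0 < c \<and> 0 < C \<and> (\<forall>j. ennreal (c * (W (sc j) * sc j powr (\<alpha> + 1))) \<le> row_mass j \<and>
      row_mass j \<le> ennreal (C * (W (sc j) * sc j powr (\<alpha> + 1))))"
proof -
  \<comment> \<open>Inside a row the ratio \<open>y / sc j\<close> stays between \<open>1\<close>
    and \<open>2 powr \<gamma>\<close>, so the exponent \<open>1\<close> in \<open>W_slow\<close> is
    as good as any.\<close>
  obtain C where C: "0 \<le> C" "\<And>s t. 0 < s \<Longrightarrow> 0 < t \<Longrightarrow> W (s * t) \<le> C * max t (1 / t) powr 1 * W s"
    using W_slow[of 1] by force
  define G where "G = 2 powr \<gamma>"
  have G: "1 < G" using two_powr_gamma by (simp add: G_def)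
  define B where "B = (C + 1) * G"
  have B: "0 < B" using C G by (simp add: B_def add_nonneg_pos)
  define A where "A = G powr \<bar>\<alpha>\<bar>"
  have A: "0 < A" using G by (simp add: A_def)
  have main: "W (sc j) * sc j powr \<alpha> / (A * B) \<le> W y * y powr \<alpha> \<and> W y * y powr \<alpha> \<le> A * B * (W (sc j) * sc j powr \<alpha>)"
    if y: "sc j \<le> y" "y < sc (j + 1)" for y j
  proof -
    have y0: "0 < y" using sc_pos[of j] y by linarith
    define t where "t = y / sc j"
    have t: "1 \<le> t" "t \<le> G" using y by (simp_all add: t_def sc_Suc G_def pos_divide_le_eq)
    have yt: "y = sc j * t" by (simp add: t_def)
    have m: "max t (1 / t) powr 1 \<le> G" "max (1 / t) (1 / (1 / t)) powr 1 \<le> G"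
    proof -
      have "1 / t \<le> 1" using t by simp
      then have "1 / t \<le> t" using t by linarith
      then have "max t (1 / t) = t" "max (1 / t) (1 / (1 / t)) = t" using t by auto
      then show "max t (1 / t) powr 1 \<le> G" "max (1 / t) (1 / (1 / t)) powr 1 \<le> G" using t by auto
    qed
    have Wb: "W (s * r) \<le> B * W s" if "0 < s" "0 < r" "max r (1 / r) powr 1 \<le> G" for s r
    proof -
      have "W (s * r) \<le> C * max r (1 / r) powr 1 * W s" using that C by simp
      also have "\<dots> \<le> (C + 1) * G * W s"
        using that C W_pos[of s] G by (intro mult_right_mono mult_mono) auto
      finally show ?thesis by (simp add: B_def)
    qed
    have W1: "W y \<le> B * W (sc j)" unfolding yt using t m by (intro Wb) auto
    have "W (y * (1 / t)) \<le> B * W y" using t m y0 by (intro Wb) auto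
    moreover have "y * (1 / t) = sc j" using t y0 by (simp add: t_def)
    ultimately have W2: "W (sc j) \<le> B * W y" by simp
    have yp: "y powr \<alpha> = sc j powr \<alpha> * t powr \<alpha>" using t by (simp add: yt powr_mult)
    have "t powr \<alpha> \<le> t powr \<bar>\<alpha>\<bar>" using t by (intro powr_mono) auto
    also have "\<dots> \<le> A" unfolding A_def using t by (intro powr_mono2) auto
    finally have tA: "t powr \<alpha> \<le> A" .
    have "t powr (- \<alpha>) \<le> t powr \<bar>\<alpha>\<bar>" using t by (intro powr_mono) auto
    also have "\<dots> \<le> A" unfolding A_def using t by (intro powr_mono2) auto
    finally have "t powr (- \<alpha>) * t powr \<alpha> \<le> A * t powr \<alpha>" by (intro mult_right_mono) auto
    then have tA': "1 \<le> A * t powr \<alpha>" using t by (simp add: powr_add[symmetric])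
    have "y powr \<alpha> \<le> A * sc j powr \<alpha>" using tA by (simp add: yp mult.commute mult_left_mono)
    then have u: "W y * y powr \<alpha> \<le> (B * W (sc j)) * (A * sc j powr \<alpha>)"
      using W1 W_pos[of "sc j"] B by (intro mult_mono) auto
    have "sc j powr \<alpha> \<le> A * y powr \<alpha>"
      using mult_left_mono[OF tA', of "sc j powr \<alpha>"] by (simp add: yp mult_ac)
    then have l: "W (sc j) * sc j powr \<alpha> \<le> (B * W y) * (A * y powr \<alpha>)"
      using W2 W_pos[OF y0] B by (intro mult_mono) auto
    show ?thesis using u l A B by (auto simp: pos_divide_le_eq mult_ac)
  qed
  have len: "emeasure lborel {sc j..<sc (j + 1)} = ennreal ((G - 1) * sc j)" for j
  proof -
    have e: "sc (j + 1) - sc j = (G - 1) * sc j" unfolding sc_Suc G_def by (simp add: algebra_simps)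
    moreover have "0 \<le> (G - 1) * sc j" using G by (intro mult_nonneg_nonneg) (auto intro: less_imp_le)
    ultimately have "0 \<le> sc (j + 1) - sc j" by simp
    then have "sc j \<le> sc (j + 1)" by linarith
    then show ?thesis unfolding e[symmetric] by (rule emeasure_lborel_Ico)
  qed
  have g0: "0 \<le> (G - 1) * sc j" for j using G by (intro mult_nonneg_nonneg) (auto intro: less_imp_le)
  have sp: "sc j powr (\<alpha> + 1) = sc j powr \<alpha> * sc j" for j by (simp add: powr_add abs_of_pos)
  have "ennreal ((G - 1) / (A * B) * (W (sc j) * sc j powr (\<alpha> + 1))) \<le> row_mass j \<and>
      row_mass j \<le> ennreal (A * B * (G - 1) * (W (sc j) * sc j powr (\<alpha> + 1)))" for j
  proof
    have W0: "0 < W (sc j)" by (simp add: W_pos)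
    have "ennreal ((G - 1) / (A * B) * (W (sc j) * sc j powr (\<alpha> + 1)))
      = ennreal (W (sc j) * sc j powr \<alpha> / (A * B)) * emeasure lborel {sc j..<sc (j + 1)}"
      unfolding len using W0 A B g0[of j] by (subst ennreal_mult[symmetric]) (auto simp: sp mult_ac)
    also have "\<dots> = (\<integral>\<^sup>+y. ennreal (W (sc j) * sc j powr \<alpha> / (A * B)) * indicator {sc j..<sc (j + 1)} y \<partial>lborel)"
      by (rule nn_integral_cmult_indicator[symmetric]) simp
    also have "\<dots> \<le> row_mass j" unfolding row_mass_def
      using main by (intro nn_integral_mono) (auto split: split_indicator intro!: ennreal_leI)
    finally show "ennreal ((G - 1) / (A * B) * (W (sc j) * sc j powr (\<alpha> + 1))) \<le> row_mass j" .
    have "row_mass j \<le> (\<integral>\<^sup>+y. ennreal (A * B * (W (sc j) * sc j powr \<alpha>)) * indicator {sc j..<sc (j + 1)} y \<partial>lborel)"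
      unfolding row_mass_def
      using main by (intro nn_integral_mono) (auto split: split_indicator intro!: ennreal_leI)
    also have "\<dots> = ennreal (A * B * (W (sc j) * sc j powr \<alpha>)) * emeasure lborel {sc j..<sc (j + 1)}"
      by (rule nn_integral_cmult_indicator) simp
    also have "\<dots> = ennreal (A * B * (G - 1) * (W (sc j) * sc j powr (\<alpha> + 1)))"
      unfolding len using W0 A B g0[of j] by (subst ennreal_mult[symmetric]) (auto simp: sp mult_ac)
    finally show "row_mass j \<le> ennreal (A * B * (G - 1) * (W (sc j) * sc j powr (\<alpha> + 1)))" .
  qed
  moreover have "0 < (G - 1) / (A * B)" "0 < A * B * (G - 1)" using A B G by auto
  ultimately show ?thesis by blast
qed

lemma step_norm_rows:
  "ennreal_powr (N (step a)) q = (\<integral>\<^sup>+j. ennreal_powr (ennreal (d * sc j)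
      * (\<integral>\<^sup>+l. ennreal_powr (a (l, j)) p \<partial>count_space UNIV)) (q / p) * row_mass j \<partial>count_space UNIV)"
proof -
  have inner: "(\<integral>\<^sup>+x. ennreal_powr (step a (Complex x y)) p \<partial>lborel)
    = ennreal (d * sc (row y)) * (\<integral>\<^sup>+l. ennreal_powr (a (l, row y)) p \<partial>count_space UNIV)" for y
    unfolding step_def idx_def using d nn_integral_floor[of "d * sc (row y)" "\<lambda>l. ennreal_powr (a (l, row y)) p"]
    by simp
  show ?thesis
    unfolding nn_integral_rows[symmetric]
    by (subst mixed_norm_powr) (auto simp: inner)
qed

text \<open>The function is constant on each cell, so its norm is computed row by row; only the
  variation of the weight within a row is lost, and \<open>row_mass_bounds\<close> controls it from
  both sides.\<close>

lemma step_norm: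
  "\<exists>c C::real. 0 < c \<and> 0 < C \<and> (\<forall>a. ennreal c * coeff_norm a \<le> ennreal_powr (N (step a)) q \<and>
      ennreal_powr (N (step a)) q \<le> ennreal C * coeff_norm a)"
proof -
  obtain c C :: real where c: "0 < c" and C: "0 < C"
    and b: "\<And>j. ennreal (c * (W (sc j) * sc j powr (\<alpha> + 1))) \<le> row_mass j"
      "\<And>j. row_mass j \<le> ennreal (C * (W (sc j) * sc j powr (\<alpha> + 1)))"
    using row_mass_bounds by metis
  define D where "D = d powr (q / p)"
  have D: "0 < D" using d by (simp add: D_def)
  have eq: "ennreal_powr (ennreal (d * sc j) * x) (q / p) * ennreal (k * (W (sc j) * sc j powr (\<alpha> + 1)))
    = ennreal (k * D) * (ennreal_powr x (q / p) * ennreal (W (sc j) * sc j powr (\<alpha> + 1 + q / p)))"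
    if "0 < k" for j x k
  proof -
    have "ennreal_powr (ennreal (d * sc j) * x) (q / p) = ennreal (D * sc j powr (q / p)) * ennreal_powr x (q / p)"
      using d by (simp add: ennreal_powr_mult D_def powr_mult less_imp_le)
    moreover have "ennreal (D * sc j powr (q / p)) * ennreal (k * (W (sc j) * sc j powr (\<alpha> + 1)))
      = ennreal (k * D) * ennreal (W (sc j) * sc j powr (\<alpha> + 1 + q / p))"
    proof -
      have "sc j powr (\<alpha> + 1 + q / p) = sc j powr (\<alpha> + 1) * sc j powr (q / p)" by (rule powr_add)
      then show ?thesis
        using D that W_pos[of "sc j"] by (simp add: ennreal_mult[symmetric] mult_ac)
    qed
    ultimately show ?thesis by (simp add: mult_ac)
  qed
  have "ennreal (c * D) * coeff_norm a \<le> ennreal_powr (N (step a)) q \<and>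
      ennreal_powr (N (step a)) q \<le> ennreal (C * D) * coeff_norm a" for a
  proof
    have "ennreal (c * D) * coeff_norm a = (\<integral>\<^sup>+j. ennreal_powr (ennreal (d * sc j)
      * (\<integral>\<^sup>+l. ennreal_powr (a (l, j)) p \<partial>count_space UNIV)) (q / p) * ennreal (c * (W (sc j) * sc j powr (\<alpha> + 1))) \<partial>count_space UNIV)"
      unfolding coeff_norm_def eq[OF c] by (rule nn_integral_cmult[symmetric]) simp
    also have "\<dots> \<le> ennreal_powr (N (step a)) q"
      unfolding step_norm_rows by (intro nn_integral_mono mult_left_mono b) simp
    finally show "ennreal (c * D) * coeff_norm a \<le> ennreal_powr (N (step a)) q" .
    have "ennreal_powr (N (step a)) q \<le> (\<integral>\<^sup>+j. ennreal_powr (ennreal (d * sc j)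
      * (\<integral>\<^sup>+l. ennreal_powr (a (l, j)) p \<partial>count_space UNIV)) (q / p) * ennreal (C * (W (sc j) * sc j powr (\<alpha> + 1))) \<partial>count_space UNIV)"
      unfolding step_norm_rows by (intro nn_integral_mono mult_left_mono b) simp
    also have "\<dots> = ennreal (C * D) * coeff_norm a"
      unfolding coeff_norm_def eq[OF C] by (rule nn_integral_cmult) simp
    finally show "ennreal_powr (N (step a)) q \<le> ennreal (C * D) * coeff_norm a" .
  qed
  moreover have "0 < c * D" "0 < C * D" using c C D by auto
  ultimately show ?thesis by blast
qed

end

subsection \<open>Atomic series\<close>

lemma sum_le_nn_integral_count_space:
  fixes f :: "'i \<Rightarrow> ennreal"
  assumes "finite S" "S \<subseteq> A"
  shows "sum f S \<le> (\<integral>\<^sup>+i. f i \<partial>count_space A)"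
proof -
  have "sum f S = (\<integral>\<^sup>+i. f i \<partial>count_space S)" using assms by (simp add: nn_integral_count_space_finite)
  also have "\<dots> \<le> (\<integral>\<^sup>+i. f i \<partial>count_space A)"
    unfolding nn_integral_count_space_indicator[unfolded NO_MATCH_def, OF TrueI, of S]
      nn_integral_count_space_indicator[unfolded NO_MATCH_def, OF TrueI, of A]
    using assms by (intro nn_integral_mono) (auto split: split_indicator)
  finally show ?thesis .
qed

lemma norm_has_sum_le:
  fixes u :: "'i \<Rightarrow> complex"
  assumes "(u has_sum s) A"
  shows "ennreal (norm s) \<le> (\<integral>\<^sup>+i. ennreal (norm (u i)) \<partial>count_space A)"
proof (cases "(\<integral>\<^sup>+i. ennreal (norm (u i)) \<partial>count_space A)")
  case (real b)
  have "norm s \<le> b"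
  proof (rule tendsto_upperbound)
    show "((\<lambda>S. norm (sum u S)) \<longlongrightarrow> norm s) (finite_subsets_at_top A)"
      using assms unfolding has_sum_def by (rule tendsto_norm)
    show "\<forall>\<^sub>F S in finite_subsets_at_top A. norm (sum u S) \<le> b"
    proof (rule eventually_finite_subsets_at_top_weakI)
      fix S assume S: "finite S" "S \<subseteq> A"
      have "ennreal (\<Sum>i\<in>S. norm (u i)) \<le> ennreal b"
        using sum_le_nn_integral_count_space[OF S, of "\<lambda>i. ennreal (norm (u i))"] real by simp
      then have "(\<Sum>i\<in>S. norm (u i)) \<le> b" using real by (simp add: ennreal_le_iff)
      then show "norm (sum u S) \<le> b" using norm_sum[of u S] by linarith
    qed
  qed simp
  then show ?thesis using real by (simp add: ennreal_leI)
qed simp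

lemma abs_summable_if_nn_integral_finite:
  fixes u :: "'i \<Rightarrow> complex"
  assumes "(\<integral>\<^sup>+i. ennreal (norm (u i)) \<partial>count_space A) < top"
  shows "(\<lambda>i. norm (u i)) summable_on A"
proof -
  obtain b where b: "0 \<le> b" "(\<integral>\<^sup>+i. ennreal (norm (u i)) \<partial>count_space A) = ennreal b"
    using assms by (cases "(\<integral>\<^sup>+i. ennreal (norm (u i)) \<partial>count_space A)") auto
  show ?thesis
  proof (rule nonneg_bdd_above_summable_on)
    show "bdd_above (sum (\<lambda>i. norm (u i)) ` {F. F \<subseteq> A \<and> finite F})"
    proof (rule bdd_aboveI2)
      fix F assume "F \<in> {F. F \<subseteq> A \<and> finite F}"
      then have "ennreal (\<Sum>i\<in>F. norm (u i)) \<le> ennreal b"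
        using sum_le_nn_integral_count_space[of F A "\<lambda>i. ennreal (norm (u i))"] b by simp
      then show "(\<Sum>i\<in>F. norm (u i)) \<le> b" using b by (simp add: ennreal_le_iff)
    qed
  qed simp
qed

lemma PP_cmult:
  assumes [measurable]: "f \<in> borel_measurable borel"
  shows "PP \<alpha> (\<lambda>w. c * f w) z = c * PP \<alpha> f z"
proof -
  have "(\<lambda>w. f w * ennreal (1 / norm (z - cnj w) powr (2 + \<alpha>))) \<in> borel_measurable (bergman_measure \<alpha>)"
    by (rule borel_measurable_bergman_measure) measurable
  then show ?thesis unfolding PP_def by (simp add: mult.assoc nn_integral_cmult)
qed

lemma PP_nn_integral_count_space:
  fixes f :: "'i::countable \<Rightarrow> complex \<Rightarrow> ennreal"
  assumes [measurable]: "\<And>i. f i \<in> borel_measurable borel"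
  shows "PP \<alpha> (\<lambda>w. \<integral>\<^sup>+i. f i w \<partial>count_space UNIV) z = (\<integral>\<^sup>+i. PP \<alpha> (f i) z \<partial>count_space UNIV)"
proof -
  have "PP \<alpha> (\<lambda>w. \<integral>\<^sup>+i. f i w \<partial>count_space UNIV) z
    = (\<integral>\<^sup>+w. (\<integral>\<^sup>+i. f i w * ennreal (1 / norm (z - cnj w) powr (2 + \<alpha>)) \<partial>count_space UNIV) \<partial>bergman_measure \<alpha>)"
    unfolding PP_def by (simp add: nn_integral_multc)
  also have "\<dots> = (\<integral>\<^sup>+i. PP \<alpha> (f i) z \<partial>count_space UNIV)"
    unfolding PP_def
    by (rule nn_integral_count_space_nn_integral) (auto intro!: borel_measurable_bergman_measure)
  finally show ?thesis .
qed

text \<open>The case of \<open>step_norm\<close> with exponents two and weight one, applied to the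
  indicator of a single index. It stands outside the locale because it interprets it with other
  parameters; the lattice objects depend on \<open>\<gamma>\<close> and \<open>d\<close>
  only.\<close>

lemma cell_mass:
  fixes \<alpha> \<gamma> d :: real
  assumes alpha: "-1 < \<alpha>" and gamma: "0 < \<gamma>" and d: "0 < d"
  shows "\<exists>c::real. 0 < c \<and> (\<forall>i. ennreal (c * lattice_space.sc \<gamma> (snd i) powr (\<alpha> + 2)) \<le> (\<integral>\<^sup>+w. indicator (lattice_space.cell \<gamma> d i) w \<partial>bergman_measure \<alpha>))"
proof -
  interpret U: lattice_space 2 2 \<alpha> "\<lambda>_. 1" \<gamma> d
    using mixed_space_unit[OF alpha] gamma d by (intro lattice_space.intro lattice_space_axioms.intro)
  obtain c :: real where c: "0 < c"
    and le: "\<And>a. ennreal c * U.coeff_norm a \<le> ennreal_powr (mixed_norm 2 2 \<alpha> (\<lambda>_. 1) (U.step a)) 2"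
    using U.step_norm by blast
  have "ennreal (c * U.sc (snd i) powr (\<alpha> + 2)) \<le> (\<integral>\<^sup>+w. indicator (U.cell i) w \<partial>bergman_measure \<alpha>)" for i
  proof -
    obtain l j where i: "i = (l, j)" by force
    have ind: "ennreal_powr (indicator X x) 2 = indicator X x" for X :: "'z set" and x
      by (simp add: indicator_def)
    have "(\<integral>\<^sup>+l'. indicator {i} (l', j') \<partial>count_space UNIV) = (indicator {j} j' :: ennreal)" for j'
    proof -
      have "(\<integral>\<^sup>+l'. indicator {i} (l', j') \<partial>count_space UNIV) = (\<integral>\<^sup>+l'. indicator {j} j' * indicator {l} l' \<partial>count_space UNIV)"
        by (intro nn_integral_cong) (auto simp: i indicator_def)
      then show ?thesis by simp
    qed
    then have "U.coeff_norm (indicator {i}) = (\<integral>\<^sup>+j'. ennreal (U.sc j' powr (\<alpha> + 2)) * indicator {j} j' \<partial>count_space UNIV)"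
      unfolding U.coeff_norm_def by (intro nn_integral_cong) (simp add: ind mult.commute add.commute[of 2 \<alpha>])
    also have "\<dots> = ennreal (U.sc j powr (\<alpha> + 2))" by simp
    finally have cn: "U.coeff_norm (indicator {i}) = ennreal (U.sc j powr (\<alpha> + 2))" .
    have "ennreal (c * U.sc (snd i) powr (\<alpha> + 2)) = ennreal c * U.coeff_norm (indicator {i})"
      using c using cn by (simp add: i ennreal_mult)
    also have "\<dots> \<le> ennreal_powr (mixed_norm 2 2 \<alpha> (\<lambda>_. 1) (U.step (indicator {i}))) 2" by (rule le)
    also have "\<dots> = (\<integral>\<^sup>+w. ennreal_powr (U.step (indicator {i}) w) 2 \<partial>bergman_measure \<alpha>)"
      by (rule mixed_norm_unit[OF alpha U.step_measurable])
    also have "\<dots> = (\<integral>\<^sup>+w. indicator (U.cell i) w \<partial>bergman_measure \<alpha>)"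
      by (intro nn_integral_cong) (auto simp: U.step_def ind U.cell_def indicator_def)
    finally show ?thesis .
  qed
  then show ?thesis using c by blast
qed

context lattice_space
begin

definition atom_size :: "int \<times> int \<Rightarrow> complex \<Rightarrow> real" where
  "atom_size i z = sc (snd i) powr (\<alpha> + 2) / norm (z - cnj (pt i)) powr (2 + \<alpha>)"

text \<open>The constant \<open>c\<close> stays free because the synthesis uses
  \<open>bergman_const \<alpha>\<close> and the analysis
  \<open>reproducing_const \<alpha>\<close>.\<close>

definition atom :: "complex \<Rightarrow> (int \<times> int \<Rightarrow> complex) \<Rightarrow> int \<times> int \<Rightarrow> complex \<Rightarrow> complex" where
  "atom c \<mu> i z = \<mu> i * of_real (sc (snd i) powr (\<alpha> + 2)) * (c / (z - cnj (pt i)) powr of_real (2 + \<alpha>))"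

lemma norm_atom: "norm (atom c \<mu> i z) = norm c * (norm (\<mu> i) * atom_size i z)"
  by (simp add: atom_def atom_size_def norm_mult norm_divide norm_powr_real del: of_real_add)

lemma atom_size_nonneg [simp]: "0 \<le> atom_size i z"
  by (simp add: atom_size_def)

text \<open>By the symmetry of \<open>norm (z - cnj w)\<close> the kernel comparison also applies to
  the second variable, so throughout the cell the kernel is comparable with its value at
  \<open>pt i\<close>. Integrating over the cell brings in its mass, at least
  \<open>c * sc (snd i) powr (\<alpha> + 2)\<close>, which matches the factor in the atom.\<close>

lemma atom_size_le_PP:
  "\<exists>K::real. 0 < K \<and> (\<forall>i. \<forall>z\<in>upper_half_plane. ennreal (atom_size i z) \<le> ennreal K * PP \<alpha> (indicator (cell i)) z)"
proof -
  obtain c :: real where c: "0 < c"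
    and mass: "\<And>i. ennreal (c * sc (snd i) powr (\<alpha> + 2)) \<le> (\<integral>\<^sup>+w. indicator (cell i) w \<partial>bergman_measure \<alpha>)"
    using cell_mass[OF alpha gamma d] by blast
  define K where "K = (1 + \<eta>) powr (2 + \<alpha>) / c"
  have K: "0 < K" using c eta_pos by (simp add: K_def)
  have "ennreal (atom_size i z) \<le> ennreal K * PP \<alpha> (indicator (cell i)) z" if z: "z \<in> upper_half_plane" for i z
  proof -
    define r where "r = 1 / norm (z - cnj (pt i)) powr (2 + \<alpha>)"
    have r: "0 \<le> r" by (simp add: r_def)
    have pw: "r \<le> (1 + \<eta>) powr (2 + \<alpha>) * (1 / norm (z - cnj w) powr (2 + \<alpha>))"
      if w: "w \<in> upper_half_plane" "w \<in> cell i" for w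
    proof -
      have n: "norm (a - cnj b) = norm (b - cnj a)" for a b
        using complex_mod_cnj[of "a - cnj b"] by (simp add: norm_minus_commute)
      have "norm (pt i - w) \<le> \<eta> * Im (pt i)"
        using idx_dist[OF w(1)] w(2) by (simp add: cell_def norm_minus_commute)
      then have "1 / norm (pt i - cnj z) powr (2 + \<alpha>) \<le> (1 + \<eta>) powr (2 + \<alpha>) * (1 / norm (w - cnj z) powr (2 + \<alpha>))"
        using w z alpha eta_pos by (intro kernel_harnack) auto
      then show ?thesis by (simp add: r_def n[of z])
    qed
    have "ennreal (atom_size i z) = ennreal (r / c) * ennreal (c * sc (snd i) powr (\<alpha> + 2))"
      using c r by (simp add: atom_size_def r_def ennreal_mult[symmetric])
    also have "\<dots> \<le> ennreal (r / c) * (\<integral>\<^sup>+w. indicator (cell i) w \<partial>bergman_measure \<alpha>)"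
      by (intro mult_left_mono mass) simp
    also have "\<dots> = (\<integral>\<^sup>+w. ennreal (r / c) * indicator (cell i) w \<partial>bergman_measure \<alpha>)"
      by (rule nn_integral_cmult[symmetric]) (rule borel_measurable_bergman_measure, measurable)
    also have "\<dots> \<le> (\<integral>\<^sup>+w. ennreal K * (indicator (cell i) w * ennreal (1 / norm (z - cnj w) powr (2 + \<alpha>))) \<partial>bergman_measure \<alpha>)"
    proof (rule nn_integral_mono)
      fix w assume "w \<in> space (bergman_measure \<alpha>)"
      then have w: "w \<in> upper_half_plane" by (simp add: space_bergman_measure)
      show "ennreal (r / c) * indicator (cell i) w \<le> ennreal K * (indicator (cell i) w * ennreal (1 / norm (z - cnj w) powr (2 + \<alpha>)))"
      proof (cases "w \<in> cell i")
        case True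
        have "r / c \<le> K * (1 / norm (z - cnj w) powr (2 + \<alpha>))"
        proof -
          have "r / c \<le> (1 + \<eta>) powr (2 + \<alpha>) * (1 / norm (z - cnj w) powr (2 + \<alpha>)) / c"
            using pw[OF w True] c by (intro divide_right_mono) auto
          then show ?thesis by (simp add: K_def mult.commute)
        qed
        then show ?thesis using True K by (simp add: ennreal_mult[symmetric] ennreal_leI del: times_divide_eq_right)
      qed simp
    qed
    also have "\<dots> = ennreal K * PP \<alpha> (indicator (cell i)) z"
      unfolding PP_def by (rule nn_integral_cmult) (rule borel_measurable_bergman_measure, measurable)
    finally show ?thesis .
  qed
  then show ?thesis using K by blast
qed

lemma atom_sum_le_PP:
  "\<exists>K::real. 0 < K \<and> (\<forall>a. \<forall>z\<in>upper_half_plane.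
      (\<integral>\<^sup>+i. a i * ennreal (atom_size i z) \<partial>count_space UNIV) \<le> ennreal K * PP \<alpha> (step a) z)"
proof -
  obtain K :: real where K: "0 < K"
    and le: "\<And>i z. z \<in> upper_half_plane \<Longrightarrow> ennreal (atom_size i z) \<le> ennreal K * PP \<alpha> (indicator (cell i)) z"
    using atom_size_le_PP by blast
  have "(\<integral>\<^sup>+i. a i * ennreal (atom_size i z) \<partial>count_space UNIV) \<le> ennreal K * PP \<alpha> (step a) z"
    if z: "z \<in> upper_half_plane" for a z
  proof -
    have "(\<integral>\<^sup>+i. a i * ennreal (atom_size i z) \<partial>count_space UNIV)
      \<le> (\<integral>\<^sup>+i. ennreal K * PP \<alpha> (\<lambda>w. a i * indicator (cell i) w) z \<partial>count_space UNIV)"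
    proof (rule nn_integral_mono)
      fix i
      have "a i * ennreal (atom_size i z) \<le> a i * (ennreal K * PP \<alpha> (indicator (cell i)) z)"
        by (intro mult_left_mono le z) simp
      then show "a i * ennreal (atom_size i z) \<le> ennreal K * PP \<alpha> (\<lambda>w. a i * indicator (cell i) w) z"
        by (simp add: PP_cmult mult_ac)
    qed
    also have "\<dots> = ennreal K * PP \<alpha> (\<lambda>w. \<integral>\<^sup>+i. a i * indicator (cell i) w \<partial>count_space UNIV) z"
      by (simp add: nn_integral_cmult PP_nn_integral_count_space)
    finally show ?thesis by (simp add: step_eq_integral[symmetric, abs_def])
  qed
  then show ?thesis using K by blast
qed

definition outside :: "(int \<times> int) set \<Rightarrow> complex set" where
  "outside S = {w. idx w \<notin> S}"

lemma outside_measurable [measurable]: "outside S \<in> sets borel"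
proof -
  have "outside S = idx -` (- S) \<inter> space borel" by (auto simp: outside_def)
  then show ?thesis using measurable_sets[OF idx_measurable, of "- S"] by simp
qed

text \<open>Exhausts the index set by finite boxes, so that dominated convergence for sequences
  applies to sums over finite index sets.\<close>

definition box_of :: "nat \<Rightarrow> (int \<times> int) set" where
  "box_of n = {- int n..int n} \<times> {- int n..int n}"

lemma outside_box_of: "decseq (\<lambda>n. outside (box_of n))" "(\<Inter>n. outside (box_of n)) = {}"
proof -
  show "decseq (\<lambda>n. outside (box_of n))" by (auto simp: decseq_def outside_def box_of_def)
  have "\<exists>n. idx w \<in> box_of n" for w
    by (intro exI[of _ "nat (max \<bar>fst (idx w)\<bar> \<bar>snd (idx w)\<bar>)"]) (auto simp: box_of_def mem_Times_iff)
  then show "(\<Inter>n. outside (box_of n)) = {}" by (auto simp: outside_def)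
qed

text \<open>The norm decreases as \<open>S\<close> grows, so convergence along the boxes controls
  the whole filter of finite sets.\<close>

lemma N_outside_tendsto_0:
  assumes f: "f \<in> borel_measurable borel" "N f < top"
  shows "((\<lambda>S. N (\<lambda>z. f z * indicator (outside S) z)) \<longlongrightarrow> 0) (finite_subsets_at_top UNIV)"
proof (rule order_tendstoI)
  fix e :: ennreal assume "0 < e"
  have "(\<lambda>n. N (\<lambda>z. f z * indicator (outside (box_of n)) z)) \<longlonglongrightarrow> 0"
    using f outside_box_of by (intro N_tail_tendsto_0) auto
  then have "\<forall>\<^sub>F n in sequentially. N (\<lambda>z. f z * indicator (outside (box_of n)) z) < e"
    using \<open>0 < e\<close> by (rule order_tendstoD(2))
  then obtain n where n: "N (\<lambda>z. f z * indicator (outside (box_of n)) z) < e"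
    using eventually_happens'[OF sequentially_bot] by blast
  show "\<forall>\<^sub>F S in finite_subsets_at_top UNIV. N (\<lambda>z. f z * indicator (outside S) z) < e"
    unfolding eventually_finite_subsets_at_top
  proof (intro exI[of _ "box_of n"] conjI allI impI)
    show "finite (box_of n)" by (simp add: box_of_def)
    fix S assume S: "finite S \<and> box_of n \<subseteq> S \<and> S \<subseteq> UNIV"
    then have "N (\<lambda>z. f z * indicator (outside S) z) \<le> N (\<lambda>z. f z * indicator (outside (box_of n)) z)"
      by (intro N_mono) (auto simp: outside_def split: split_indicator)
    then show "N (\<lambda>z. f z * indicator (outside S) z) < e" using n by simp
  qed simp
qed simp

section \<open>Convergence and holomorphy of atomic series\<close>

lemma N_step_finite:
  assumes "coeff_norm a < top"
  shows "N (step a) < top"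
proof -
  obtain C :: real where "ennreal_powr (N (step a)) q \<le> ennreal C * coeff_norm a"
    using step_norm by blast
  also have "\<dots> < top" using assms by (simp add: ennreal_mult_less_top)
  finally show ?thesis by simp
qed

lemma atom_holomorphic: "atom c \<mu> i holomorphic_on upper_half_plane"
  unfolding atom_def[abs_def] using kernel_arg[OF _ pt_upper[of i]] by (intro holomorphic_intros) auto

lemma atom_harnack:
  assumes z: "z \<in> upper_half_plane" and z': "z' \<in> upper_half_plane" and n: "norm (z - z') \<le> Im z"
  shows "norm (atom c \<mu> i z) \<le> 2 powr (2 + \<alpha>) * norm (atom c \<mu> i z')"
proof -
  have "1 / norm (z - cnj (pt i)) powr (2 + \<alpha>) \<le> (1 + 1) powr (2 + \<alpha>) * (1 / norm (z' - cnj (pt i)) powr (2 + \<alpha>))"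
    using z z' n alpha by (intro kernel_harnack) auto
  then have "sc (snd i) powr (\<alpha> + 2) * (1 / norm (z - cnj (pt i)) powr (2 + \<alpha>))
    \<le> sc (snd i) powr (\<alpha> + 2) * ((1 + 1) powr (2 + \<alpha>) * (1 / norm (z' - cnj (pt i)) powr (2 + \<alpha>)))"
    by (rule mult_left_mono) simp
  then have "atom_size i z \<le> 2 powr (2 + \<alpha>) * atom_size i z'"
    by (simp add: atom_size_def mult_ac)
  then have "norm c * norm (\<mu> i) * atom_size i z \<le> norm c * norm (\<mu> i) * (2 powr (2 + \<alpha>) * atom_size i z')"
    by (rule mult_left_mono) simp
  then show ?thesis by (simp add: norm_atom mult_ac)
qed

text \<open>Absolute convergence follows from the finiteness of \<open>PP\<close> on the step
  function of the coefficients. Near \<open>z0\<close> the atoms are dominated by their values at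
  \<open>z0\<close>, so the Weierstrass test upgrades pointwise to locally uniform
  convergence.\<close>

lemma atom_series:
  assumes fin: "N (step (\<lambda>i. ennreal (norm (\<mu> i)))) < top"
  shows "z \<in> upper_half_plane \<Longrightarrow> (\<lambda>i. norm (atom c \<mu> i z)) summable_on UNIV"
    and "(\<And>z. z \<in> upper_half_plane \<Longrightarrow> ((\<lambda>i. atom c \<mu> i z) has_sum F z) UNIV) \<Longrightarrow> F holomorphic_on upper_half_plane"
proof -
  define a where "a i = ennreal (norm (\<mu> i))" for i
  show summ: "(\<lambda>i. norm (atom c \<mu> i z)) summable_on UNIV" if z: "z \<in> upper_half_plane" for z
  proof (rule abs_summable_if_nn_integral_finite)
    obtain K :: real where K: "(\<integral>\<^sup>+i. a i * ennreal (atom_size i z) \<partial>count_space UNIV) \<le> ennreal K * PP \<alpha> (step a) z"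
      using atom_sum_le_PP z by blast
    have "(\<integral>\<^sup>+i. ennreal (norm (atom c \<mu> i z)) \<partial>count_space UNIV)
      = (\<integral>\<^sup>+i. ennreal (norm c) * (a i * ennreal (atom_size i z)) \<partial>count_space UNIV)"
      by (simp add: norm_atom a_def ennreal_mult)
    also have "\<dots> = ennreal (norm c) * (\<integral>\<^sup>+i. a i * ennreal (atom_size i z) \<partial>count_space UNIV)"
      by (rule nn_integral_cmult) simp
    also have "\<dots> \<le> ennreal (norm c) * (ennreal K * PP \<alpha> (step a) z)" using K by (rule mult_left_mono) simp
    also have "\<dots> < top"
      using PP_finite[OF step_measurable _ z, of a] fin by (simp add: a_def[abs_def] ennreal_mult_less_top)
    finally show "(\<integral>\<^sup>+i. ennreal (norm (atom c \<mu> i z)) \<partial>count_space UNIV) < top" .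
  qed
  assume F: "\<And>z. z \<in> upper_half_plane \<Longrightarrow> ((\<lambda>i. atom c \<mu> i z) has_sum F z) UNIV"
  have "\<exists>r>0. F holomorphic_on ball z0 r" if z0: "z0 \<in> upper_half_plane" for z0
  proof -
    define r where "r = Im z0 / 2"
    have r: "0 < r" using z0 by (simp add: r_def upper_half_plane_def)
    have near: "z \<in> upper_half_plane \<and> norm (z - z0) \<le> Im z" if "z \<in> cball z0 r" for z
    proof -
      have "norm (z - z0) \<le> r" using that by (simp add: dist_norm norm_minus_commute)
      moreover have "\<bar>Im (z - z0)\<bar> \<le> norm (z - z0)" by (rule abs_Im_le_cmod)
      ultimately show ?thesis using r by (auto simp: r_def upper_half_plane_def)
    qed
    have "uniform_limit (cball z0 r) (\<lambda>S z. \<Sum>i\<in>S. atom c \<mu> i z) F (finite_subsets_at_top UNIV)"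
    proof (rule Weierstrass_m_test_general')
      show "norm (atom c \<mu> i z) \<le> 2 powr (2 + \<alpha>) * norm (atom c \<mu> i z0)" if "z \<in> cball z0 r" for i z
        using near[OF that] z0 by (intro atom_harnack) auto
      show "(\<lambda>i. 2 powr (2 + \<alpha>) * norm (atom c \<mu> i z0)) summable_on UNIV"
        by (intro summable_on_cmult_right summ z0)
    qed (use F near in auto)
    moreover have "\<forall>\<^sub>F S in finite_subsets_at_top UNIV. continuous_on (cball z0 r) (\<lambda>z. \<Sum>i\<in>S. atom c \<mu> i z)
        \<and> (\<lambda>z. \<Sum>i\<in>S. atom c \<mu> i z) holomorphic_on ball z0 r"
    proof (rule always_eventually, intro allI conjI)
      fix S
      have h: "(\<lambda>z. \<Sum>i\<in>S. atom c \<mu> i z) holomorphic_on cball z0 r"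
        using near by (intro holomorphic_on_sum holomorphic_on_subset[OF atom_holomorphic]) auto
      then show "continuous_on (cball z0 r) (\<lambda>z. \<Sum>i\<in>S. atom c \<mu> i z)" by (rule holomorphic_on_imp_continuous_on)
      show "(\<lambda>z. \<Sum>i\<in>S. atom c \<mu> i z) holomorphic_on ball z0 r"
        using h by (rule holomorphic_on_subset) auto
    qed
    ultimately obtain "F holomorphic_on ball z0 r"
      using holomorphic_uniform_limit[of z0 r "\<lambda>S z. \<Sum>i\<in>S. atom c \<mu> i z" "finite_subsets_at_top UNIV" F] by auto
    then show ?thesis using r by blast
  qed
  then have "\<exists>f'. (F has_field_derivative f') (at z)" if "z \<in> upper_half_plane" for z
    using that by (metis centre_in_ball holomorphic_on_open open_ball)
  then show "F holomorphic_on upper_half_plane"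
    using open_upper_half_plane by (simp add: holomorphic_on_open)
qed

text \<open>The remainder after \<open>S\<close> is again an atomic series, with the coefficients in
  \<open>S\<close> removed. \<open>S = {}\<close> gives the norm estimate, and growing
  \<open>S\<close> gives convergence in norm.\<close>

lemma synthesis_bound:
  obtains K :: real where "0 < K"
    "\<And>\<mu> F S. finite S \<Longrightarrow> (\<And>z. z \<in> upper_half_plane \<Longrightarrow> ((\<lambda>i. atom c \<mu> i z) has_sum F z) UNIV) \<Longrightarrow>
      N (hnorm (\<lambda>z. F z - (\<Sum>i\<in>S. atom c \<mu> i z)))
        \<le> ennreal K * N (\<lambda>z. step (\<lambda>i. ennreal (norm (\<mu> i))) z * indicator (outside S) z)"
proof -
  obtain K1 :: real where K1: "0 < K1" and le1: "\<And>a z. z \<in> upper_half_plane \<Longrightarrow>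
      (\<integral>\<^sup>+i. a i * ennreal (atom_size i z) \<partial>count_space UNIV) \<le> ennreal K1 * PP \<alpha> (step a) z"
    using atom_sum_le_PP by blast
  obtain K2 :: real where K2: "0 < K2" and le2: "\<And>f. f \<in> borel_measurable borel \<Longrightarrow> N (PP \<alpha> f) \<le> ennreal K2 * N f"
    using PP_bounded by blast
  define K where "K = norm c * K1 * K2 + 1"
  have K: "0 < K" using K1 K2 by (simp add: K_def add_nonneg_pos)
  have "N (hnorm (\<lambda>z. F z - (\<Sum>i\<in>S. atom c \<mu> i z))) \<le> ennreal K * N (\<lambda>z. step (\<lambda>i. ennreal (norm (\<mu> i))) z * indicator (outside S) z)"
    if S: "finite S" and F: "\<And>z. z \<in> upper_half_plane \<Longrightarrow> ((\<lambda>i. atom c \<mu> i z) has_sum F z) UNIV" for \<mu> F S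
  proof -
    define a where "a i = ennreal (norm (\<mu> i)) * indicator (- S) i" for i
    have st: "step a = (\<lambda>z. step (\<lambda>i. ennreal (norm (\<mu> i))) z * indicator (outside S) z)"
      by (auto simp: step_def a_def outside_def fun_eq_iff split: split_indicator)
    have "N (hnorm (\<lambda>z. F z - (\<Sum>i\<in>S. atom c \<mu> i z))) \<le> N (\<lambda>z. ennreal (norm c * K1) * PP \<alpha> (step a) z)"
    proof (rule N_mono)
      fix z assume z: "z \<in> upper_half_plane"
      have "((\<lambda>i. atom c \<mu> i z) has_sum (F z - (\<Sum>i\<in>S. atom c \<mu> i z))) (UNIV - S)"
        using S by (intro has_sum_Diff F z has_sum_finite) auto
      then have "ennreal (norm (F z - (\<Sum>i\<in>S. atom c \<mu> i z)))
        \<le> (\<integral>\<^sup>+i. ennreal (norm (atom c \<mu> i z)) \<partial>count_space (UNIV - S))"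
        by (rule norm_has_sum_le)
      also have "\<dots> = (\<integral>\<^sup>+i. ennreal (norm (atom c \<mu> i z)) * indicator (UNIV - S) i \<partial>count_space UNIV)"
        by (subst nn_integral_count_space_indicator) auto
      also have "\<dots> = (\<integral>\<^sup>+i. ennreal (norm c) * (a i * ennreal (atom_size i z)) \<partial>count_space UNIV)"
        by (intro nn_integral_cong) (auto simp: norm_atom a_def ennreal_mult split: split_indicator)
      also have "\<dots> = ennreal (norm c) * (\<integral>\<^sup>+i. a i * ennreal (atom_size i z) \<partial>count_space UNIV)"
        by (rule nn_integral_cmult) simp
      also have "\<dots> \<le> ennreal (norm c) * (ennreal K1 * PP \<alpha> (step a) z)"
        by (intro mult_left_mono le1 z) simp
      also have "\<dots> = ennreal (norm c * K1) * PP \<alpha> (step a) z"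
        using K1 by (simp add: ennreal_mult mult.assoc)
      finally show "hnorm (\<lambda>z. F z - (\<Sum>i\<in>S. atom c \<mu> i z)) z \<le> ennreal (norm c * K1) * PP \<alpha> (step a) z"
        using z by (simp add: hnorm_def)
    qed
    also have "\<dots> = ennreal (norm c * K1) * N (PP \<alpha> (step a))" by (rule N_cmult) measurable
    also have "\<dots> \<le> ennreal (norm c * K1) * (ennreal K2 * N (step a))"
      by (intro mult_left_mono le2 step_measurable) simp
    also have "\<dots> = ennreal (norm c * K1 * K2) * N (step a)"
      using K1 K2 by (simp add: ennreal_mult mult.assoc)
    also have "\<dots> \<le> ennreal K * N (step a)"
      by (intro mult_right_mono ennreal_leI) (auto simp: K_def)
    finally show ?thesis by (simp add: st)
  qed
  then show ?thesis using that[OF K] by simp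
qed

lemma synthesis_converges:
  assumes fin: "N (step (\<lambda>i. ennreal (norm (\<mu> i)))) < top"
    and F: "\<And>z. z \<in> upper_half_plane \<Longrightarrow> ((\<lambda>i. atom c \<mu> i z) has_sum F z) UNIV"
  shows "((\<lambda>S. N (hnorm (\<lambda>z. F z - (\<Sum>i\<in>S. atom c \<mu> i z)))) \<longlongrightarrow> 0) (finite_subsets_at_top UNIV)"
proof -
  define a where "a i = ennreal (norm (\<mu> i))" for i
  obtain K :: real where K: "0 < K" and le: "\<And>S. finite S \<Longrightarrow>
      N (hnorm (\<lambda>z. F z - (\<Sum>i\<in>S. atom c \<mu> i z))) \<le> ennreal K * N (\<lambda>z. step a z * indicator (outside S) z)"
  proof -
    obtain K where "0 < K" "\<And>\<mu> F S. finite S \<Longrightarrow> (\<And>z. z \<in> upper_half_plane \<Longrightarrow> ((\<lambda>i. atom c \<mu> i z) has_sum F z) UNIV) \<Longrightarrow>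
      N (hnorm (\<lambda>z. F z - (\<Sum>i\<in>S. atom c \<mu> i z)))
        \<le> ennreal K * N (\<lambda>z. step (\<lambda>i. ennreal (norm (\<mu> i))) z * indicator (outside S) z)"
      by (rule synthesis_bound[of c]) (rule that, assumption, simp)
    then show ?thesis using F that unfolding a_def by simp
  qed
  have "((\<lambda>S. ennreal K * N (\<lambda>z. step a z * indicator (outside S) z)) \<longlongrightarrow> ennreal K * 0) (finite_subsets_at_top UNIV)"
    using fin by (intro ennreal_tendsto_cmult N_outside_tendsto_0) (auto simp: a_def[abs_def])
  then have "((\<lambda>S. ennreal K * N (\<lambda>z. step a z * indicator (outside S) z)) \<longlongrightarrow> 0) (finite_subsets_at_top UNIV)"
    by simp
  then show ?thesis
    by (rule tendsto_sandwich[OF _ _ tendsto_const, rotated 2])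
      (auto intro!: always_eventually eventually_finite_subsets_at_top_weakI le)
qed

end

subsection \<open>Discretisation of the reproducing formula\<close>

text \<open>By homogeneity the quotient \<open>u = \<xi>' / \<xi>\<close> reduces the estimate to
  the continuity of \<open>1 / u powr s\<close> at \<open>1\<close>.\<close>

lemma kernel_perturbation:
  fixes \<alpha> \<epsilon> :: real
  assumes "0 < \<epsilon>"
  shows "\<exists>\<theta>>0. \<forall>\<xi>\<in>upper_half_plane. \<forall>\<xi>'\<in>upper_half_plane. norm (\<xi> - \<xi>') \<le> \<theta> * norm \<xi> \<longrightarrow>
    norm (1 / \<xi> powr of_real (2 + \<alpha>) - 1 / \<xi>' powr of_real (2 + \<alpha>)) \<le> \<epsilon> / norm \<xi> powr (2 + \<alpha>)"
proof -
  define s where "s = complex_of_real (2 + \<alpha>)"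
  have "isCont (\<lambda>u::complex. 1 / u powr s) 1"
    by (intro continuous_intros) auto
  then obtain \<delta> where \<delta>: "0 < \<delta>" "\<And>u. dist u 1 < \<delta> \<Longrightarrow> dist (1 / u powr s) (1 / 1 powr s) < \<epsilon>"
    unfolding continuous_at_eps_delta using assms by metis
  have "norm (1 / \<xi> powr s - 1 / \<xi>' powr s) \<le> \<epsilon> / norm \<xi> powr (2 + \<alpha>)"
    if x: "\<xi> \<in> upper_half_plane" "\<xi>' \<in> upper_half_plane" "norm (\<xi> - \<xi>') \<le> \<delta> / 2 * norm \<xi>" for \<xi> \<xi>'
  proof -
    have n: "\<xi> \<noteq> 0" "\<xi>' \<noteq> 0" using x by (auto simp: upper_half_plane_def)
    define u where "u = \<xi>' / \<xi>"
    have un: "u \<noteq> 0" using n by (simp add: u_def)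
    have "norm (u - 1) = norm (\<xi> - \<xi>') / norm \<xi>"
      using n by (simp add: u_def diff_divide_distrib[symmetric] norm_divide[symmetric] norm_minus_commute divide_diff_eq_iff)
    also have "\<dots> \<le> \<delta> / 2" using x(3) n by (simp add: pos_divide_le_eq)
    finally have "dist u 1 < \<delta>" using \<delta>(1) by (simp add: dist_norm)
    then have d: "norm (1 - 1 / u powr s) < \<epsilon>" using \<delta>(2)[of u] by (simp add: dist_norm norm_minus_commute)
    \<comment> \<open>Both arguments lie strictly between \<open>0\<close> and \<open>pi\<close>, so
      their difference is a principal argument and \<open>\<xi>' powr s\<close> factors as
      \<open>\<xi> powr s * u powr s\<close>.\<close>
    have "0 < Im (Ln \<xi>) \<and> Im (Ln \<xi>) < pi" "0 < Im (Ln \<xi>') \<and> Im (Ln \<xi>') < pi"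
      using x by (auto simp: upper_half_plane_def intro!: Im_Ln_pos_lt_imp[THEN conjunct1] Im_Ln_pos_lt_imp[THEN conjunct2])
    then have "Ln (exp (Ln \<xi>' - Ln \<xi>)) = Ln \<xi>' - Ln \<xi>" by (intro Ln_exp) auto
    moreover have "exp (Ln \<xi>' - Ln \<xi>) = u" using n by (simp add: exp_diff u_def)
    ultimately have "Ln \<xi>' = Ln \<xi> + Ln u" by simp
    then have "\<xi>' powr s = \<xi> powr s * u powr s"
      using n un by (simp add: powr_def exp_add[symmetric] algebra_simps)
    then have "1 / \<xi> powr s - 1 / \<xi>' powr s = (1 / \<xi> powr s) * (1 - 1 / u powr s)"
      using n un by (simp add: field_simps powr_def)
    then have "norm (1 / \<xi> powr s - 1 / \<xi>' powr s) = norm (1 - 1 / u powr s) / norm \<xi> powr (2 + \<alpha>)"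
      by (simp only: norm_mult norm_divide norm_one s_def norm_powr_real) simp
    also have "\<dots> \<le> \<epsilon> / norm \<xi> powr (2 + \<alpha>)" using d by (intro divide_right_mono) auto
    finally show ?thesis .
  qed
  then show ?thesis unfolding s_def using \<delta>(1) by (intro exI[of _ "\<delta> / 2"]) auto
qed

text \<open>A function that is not integrable has integral \<open>0\<close> by convention, so the
  usual bound holds for all functions.\<close>

lemma norm_integral_le_nn_integral:
  fixes f :: "'a \<Rightarrow> complex"
  shows "ennreal (norm (LINT x|M. f x)) \<le> (\<integral>\<^sup>+x. ennreal (norm (f x)) \<partial>M)"
  by (cases "integrable M f") (auto simp: integral_norm_bound_ennreal not_integrable_integral_eq)

context lattice_space
begin

definition cell_integral :: "(complex \<Rightarrow> complex) \<Rightarrow> int \<times> int \<Rightarrow> complex" where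
  "cell_integral F i = (LINT w|bergman_measure \<alpha>. indicator (cell i) w *\<^sub>R F w)"

text \<open>The division cancels the factor \<open>sc (snd i) powr (\<alpha> + 2)\<close> built into
  the atom, so that the term of the series is the cell integral times the kernel at
  \<open>pt i\<close>.\<close>

definition cell_coeff :: "(complex \<Rightarrow> complex) \<Rightarrow> int \<times> int \<Rightarrow> complex" where
  "cell_coeff F i = cell_integral F i / of_real (sc (snd i) powr (\<alpha> + 2))"

lemma cell_dist:
  assumes "w \<in> upper_half_plane" "w \<in> cell i"
  shows "norm (w - pt i) \<le> \<eta> * sc (snd i)" "Im w \<le> 2 powr \<gamma> * sc (snd i)" "sc (snd i) \<le> Im w"
  using idx_dist[OF assms(1)] row_bounds[OF assms(1)] assms(2) by (auto simp: cell_def)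

text \<open>For two points \<open>w\<close>, \<open>w'\<close> of one cell,
  \<open>norm (w - cnj w')\<close> is at most \<open>2 * \<eta> + 2 * 2 powr \<gamma>\<close> times
  the height of the lattice point: two distances to that point plus
  \<open>2 * Im w'\<close>.\<close>

definition cell_const :: real where "cell_const = (2 * \<eta> + 2 * 2 powr \<gamma>) powr (2 + \<alpha>)"

text \<open>On the cell the modulus of the kernel is at least
  \<open>1 / b powr (2 + \<alpha>)\<close>.\<close>

lemma cell_norm_bound:
  assumes F: "F \<in> borel_measurable (bergman_measure \<alpha>)" and z: "z \<in> upper_half_plane"
    and b: "0 \<le> b" "\<And>w. w \<in> upper_half_plane \<Longrightarrow> w \<in> cell i \<Longrightarrow> norm (z - cnj w) \<le> b"
  shows "(\<integral>\<^sup>+w. ennreal (norm (indicator (cell i) w *\<^sub>R F w)) \<partial>bergman_measure \<alpha>)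
    \<le> ennreal (b powr (2 + \<alpha>)) * PP \<alpha> (hnorm F) z"
proof -
  have "(\<integral>\<^sup>+w. ennreal (norm (indicator (cell i) w *\<^sub>R F w)) \<partial>bergman_measure \<alpha>)
    \<le> (\<integral>\<^sup>+w. ennreal (b powr (2 + \<alpha>)) * (hnorm F w * ennreal (1 / norm (z - cnj w) powr (2 + \<alpha>))) \<partial>bergman_measure \<alpha>)"
  proof (rule nn_integral_mono)
    fix w assume "w \<in> space (bergman_measure \<alpha>)"
    then have w: "w \<in> upper_half_plane" by (simp add: space_bergman_measure)
    show "ennreal (norm (indicator (cell i) w *\<^sub>R F w)) \<le> ennreal (b powr (2 + \<alpha>)) * (hnorm F w * ennreal (1 / norm (z - cnj w) powr (2 + \<alpha>)))"
    proof (cases "w \<in> cell i")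
      case True
      have "norm (z - cnj w) powr (2 + \<alpha>) \<le> b powr (2 + \<alpha>)"
        using b(2)[OF w True] alpha by (intro powr_mono2) auto
      moreover have "0 < norm (z - cnj w)" by (rule upper_half_plane_norm_ge(3)[OF z w])
      ultimately have "1 \<le> b powr (2 + \<alpha>) * (1 / norm (z - cnj w) powr (2 + \<alpha>))"
        by (simp add: pos_le_divide_eq)
      then have "norm (F w) * 1 \<le> norm (F w) * (b powr (2 + \<alpha>) * (1 / norm (z - cnj w) powr (2 + \<alpha>)))"
        by (rule mult_left_mono) simp
      then have "ennreal (norm (F w)) \<le> ennreal (b powr (2 + \<alpha>) * (norm (F w) * (1 / norm (z - cnj w) powr (2 + \<alpha>))))"
        by (intro ennreal_leI) (simp add: mult_ac)
      then show ?thesis using True w by (simp add: hnorm_def ennreal_mult[symmetric])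
    qed simp
  qed
  also have "\<dots> = ennreal (b powr (2 + \<alpha>)) * PP \<alpha> (hnorm F) z"
  proof -
    note [measurable] = hnorm_measurable[OF F]
    have "(\<lambda>w. hnorm F w * ennreal (1 / norm (z - cnj w) powr (2 + \<alpha>))) \<in> borel_measurable (bergman_measure \<alpha>)"
      by (rule borel_measurable_bergman_measure) measurable
    then show ?thesis unfolding PP_def by (rule nn_integral_cmult)
  qed
  finally show ?thesis .
qed

text \<open>Any point \<open>w\<close> of the cell may serve as the point \<open>z\<close> in
  \<open>cell_norm_bound\<close>. The step function of the coefficients is thus dominated pointwise
  by the positive operator, whose boundedness then controls the coefficient norm.\<close>

lemma cell_coeff_le:
  assumes F: "F \<in> borel_measurable (bergman_measure \<alpha>)" and w: "w \<in> upper_half_plane"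
  shows "step (\<lambda>i. ennreal (norm (cell_coeff F i))) w \<le> ennreal cell_const * PP \<alpha> (hnorm F) w"
proof -
  define i where "i = idx w"
  define b where "b = (2 * \<eta> + 2 * 2 powr \<gamma>) * sc (snd i)"
  have b: "0 \<le> b" unfolding b_def using eta_pos by (intro mult_nonneg_nonneg) auto
  have wi: "w \<in> cell i" by (simp add: cell_def i_def)
  have le: "norm (w - cnj w') \<le> b" if w': "w' \<in> upper_half_plane" "w' \<in> cell i" for w'
  proof -
    have "norm (w - cnj w') \<le> norm (w - pt i) + norm (w' - pt i) + norm (w' - cnj w')"
      using norm_triangle_ineq[of "w - pt i" "pt i - w'"] norm_triangle_ineq[of "w - w'" "w' - cnj w'"]
      by (simp add: norm_minus_commute)
    also have "norm (w' - cnj w') = 2 * Im w'"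
    proof -
      have "w' - cnj w' = of_real (2 * Im w') * \<i>" by (simp add: complex_eq_iff)
      then have "norm (w' - cnj w') = norm (of_real (2 * Im w') * \<i>)" by (rule arg_cong)
      also have "\<dots> = 2 * Im w'" using w'(1) by (simp add: norm_mult upper_half_plane_def)
      finally show ?thesis .
    qed
    also have "norm (w - pt i) + norm (w' - pt i) + 2 * Im w' \<le> b"
      using cell_dist[OF w wi] cell_dist[OF w'] unfolding b_def by (simp add: algebra_simps)
    finally show ?thesis .
  qed
  have "ennreal (norm (cell_coeff F i)) = ennreal (1 / sc (snd i) powr (\<alpha> + 2)) * ennreal (norm (cell_integral F i))"
    by (simp add: cell_coeff_def norm_divide ennreal_mult[symmetric])
  also have "\<dots> \<le> ennreal (1 / sc (snd i) powr (\<alpha> + 2)) * (ennreal (b powr (2 + \<alpha>)) * PP \<alpha> (hnorm F) w)"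
    unfolding cell_integral_def
    by (intro mult_left_mono order_trans[OF norm_integral_le_nn_integral cell_norm_bound[OF F w b le]]) auto
  also have "\<dots> = ennreal (1 / sc (snd i) powr (\<alpha> + 2) * b powr (2 + \<alpha>)) * PP \<alpha> (hnorm F) w"
    by (simp add: ennreal_mult[symmetric] mult.assoc[symmetric])
  also have "1 / sc (snd i) powr (\<alpha> + 2) * b powr (2 + \<alpha>) = cell_const"
    using eta_pos by (simp add: b_def cell_const_def powr_mult add.commute[of \<alpha> 2])
  finally show ?thesis by (simp add: step_def i_def)
qed

lemma cell_coeff_norm_le:
  assumes F: "F \<in> borel_measurable (bergman_measure \<alpha>)"
  shows "N (step (\<lambda>i. ennreal (norm (cell_coeff F i)))) \<le> ennreal cell_const * N (PP \<alpha> (hnorm F))"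
proof -
  note [measurable] = hnorm_measurable[OF F]
  have "N (step (\<lambda>i. ennreal (norm (cell_coeff F i)))) \<le> N (\<lambda>z. ennreal cell_const * PP \<alpha> (hnorm F) z)"
    by (intro N_mono cell_coeff_le F)
  also have "\<dots> = ennreal cell_const * N (PP \<alpha> (hnorm F))" by (rule N_cmult) measurable
  finally show ?thesis .
qed

lemma PP_outside_tendsto_0:
  assumes f [measurable]: "f \<in> borel_measurable borel" and fin: "PP \<alpha> f z < top"
  shows "(\<lambda>n. PP \<alpha> (\<lambda>w. f w * indicator (outside (box_of n)) w) z) \<longlonglongrightarrow> 0"
proof -
  define k where "k w = ennreal (1 / norm (z - cnj w) powr (2 + \<alpha>))" for w
  have [measurable]: "k \<in> borel_measurable borel" unfolding k_def by measurable
  have "(\<lambda>n. \<integral>\<^sup>+w. f w * indicator (outside (box_of n)) w * k w \<partial>bergman_measure \<alpha>) \<longlonglongrightarrow> (\<integral>\<^sup>+w. 0 \<partial>bergman_measure \<alpha>)"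
  proof (rule nn_integral_dominated_convergence[where w = "\<lambda>w. f w * k w"])
    show "(\<lambda>w. f w * indicator (outside (box_of n)) w * k w) \<in> borel_measurable (bergman_measure \<alpha>)" for n
      by (rule borel_measurable_bergman_measure) measurable
    show "(\<lambda>w. f w * k w) \<in> borel_measurable (bergman_measure \<alpha>)"
      by (rule borel_measurable_bergman_measure) measurable
    show "(\<integral>\<^sup>+w. f w * k w \<partial>bergman_measure \<alpha>) < \<infinity>" using fin by (simp add: PP_def k_def)
    show "AE w in bergman_measure \<alpha>. (\<lambda>n. f w * indicator (outside (box_of n)) w * k w) \<longlonglongrightarrow> 0"
    proof (intro AE_I2 tendsto_eventually)
      fix w
      obtain m where m: "w \<notin> outside (box_of m)" using outside_box_of(2) by blast
      have "w \<notin> outside (box_of n)" if "m \<le> n" for n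
        using m outside_box_of(1) that by (auto simp: decseq_def)
      then show "\<forall>\<^sub>F n in sequentially. f w * indicator (outside (box_of n)) w * k w = 0"
        unfolding eventually_sequentially by (intro exI[of _ m]) auto
    qed
  qed (auto split: split_indicator)
  then show ?thesis by (simp add: PP_def k_def)
qed

section \<open>Error of the discretised reproducing integral\<close>

lemma box_of_filterlim: "filterlim box_of (finite_subsets_at_top UNIV) sequentially"
  unfolding filterlim_finite_subsets_at_top
proof (intro allI impI)
  fix X :: "(int \<times> int) set" assume X: "finite X \<and> X \<subseteq> UNIV"
  define Mx where "Mx = Max (insert 0 ((\<lambda>i. max \<bar>fst i\<bar> \<bar>snd i\<bar>) ` X))"
  define m where "m = nat Mx"
  have "i \<in> box_of n" if "i \<in> X" "m \<le> n" for i n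
  proof -
    have "max \<bar>fst i\<bar> \<bar>snd i\<bar> \<le> Mx"
      unfolding Mx_def using X that by (intro Max_ge) auto
    moreover have "Mx \<le> int n" using that(2) by (simp add: m_def nat_le_iff)
    ultimately have "max \<bar>fst i\<bar> \<bar>snd i\<bar> \<le> int n" by linarith
    then show ?thesis by (auto simp: box_of_def mem_Times_iff)
  qed
  then show "\<forall>\<^sub>F n in sequentially. finite (box_of n) \<and> X \<subseteq> box_of n \<and> box_of n \<subseteq> UNIV"
    unfolding eventually_sequentially by (intro exI[of _ m]) (auto simp: box_of_def)
qed

abbreviation "rc \<equiv> reproducing_const \<alpha>"

text \<open>For a finite index set the sum of cell integrals can be moved under the reproducing
  integral. Cells in \<open>S\<close> contribute the variation of the kernel, with factor
  \<open>\<epsilon>\<close>; the rest of the half-plane contributes the full kernel and disappears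
  in the limit.\<close>

lemma discretization_partial:
  assumes F: "F holomorphic_on upper_half_plane" and z: "z \<in> upper_half_plane"
    and fin: "PP \<alpha> (hnorm F) z < top" and \<epsilon>: "0 < \<epsilon>"
    and pert: "\<forall>\<xi>\<in>upper_half_plane. \<forall>\<xi>'\<in>upper_half_plane. norm (\<xi> - \<xi>') \<le> \<theta> * norm \<xi> \<longrightarrow>
      norm (1 / \<xi> powr of_real (2 + \<alpha>) - 1 / \<xi>' powr of_real (2 + \<alpha>)) \<le> \<epsilon> / norm \<xi> powr (2 + \<alpha>)"
    and \<theta>: "\<eta> \<le> \<theta>" and S: "finite S"
  shows "ennreal (norm (F z - (\<Sum>i\<in>S. atom rc (cell_coeff F) i z)))
    \<le> ennreal (norm rc) * (ennreal \<epsilon> * PP \<alpha> (hnorm F) z + PP \<alpha> (\<lambda>w. hnorm F w * indicator (outside S) w) z)"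
proof -
  define B where "B = bergman_measure \<alpha>"
  define s where "s = complex_of_real (2 + \<alpha>)"
  define k where "k w = 1 / (z - cnj w) powr s" for w
  have Fm: "F \<in> borel_measurable B" unfolding B_def by (rule holomorphic_bergman_measurable[OF F])
  note Hm [measurable] = hnorm_measurable[OF Fm[unfolded B_def]]
  have int: "integrable B (\<lambda>w. F w * k w)"
    using bergman_op_integrable[OF Fm[unfolded B_def] z fin] by (simp add: B_def k_def s_def)
  have Fz: "F z = rc * (LINT w|B. F w * k w)"
    using reproducing_formula(2)[OF alpha F z] fin by (simp add: PP_hnorm B_def k_def s_def)
  have celli: "integrable B (\<lambda>w. indicator (cell i) w *\<^sub>R F w)" for i
  proof (rule integrableI_bounded)
    have "(\<lambda>w. indicat_real (cell i) w) \<in> borel_measurable B"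
      unfolding B_def by (rule borel_measurable_bergman_measure) measurable
    then show "(\<lambda>w. indicator (cell i) w *\<^sub>R F w) \<in> borel_measurable B"
      using Fm by measurable
    define b where "b = norm (z - cnj (pt i)) + \<eta> * sc (snd i)"
    have b: "0 \<le> b" unfolding b_def using eta_pos
      by (intro add_nonneg_nonneg mult_nonneg_nonneg) auto
    have "norm (z - cnj w) \<le> b" if "w \<in> upper_half_plane" "w \<in> cell i" for w
    proof -
      have "norm (z - cnj w) \<le> norm (z - cnj (pt i)) + norm (cnj (pt i) - cnj w)"
        using norm_triangle_ineq[of "z - cnj (pt i)" "cnj (pt i) - cnj w"] by simp
      also have "norm (cnj (pt i) - cnj w) = norm (w - pt i)"
        using complex_mod_cnj[of "pt i - w"] by (simp add: norm_minus_commute)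
      finally show ?thesis using cell_dist(1)[OF that] by (simp add: b_def)
    qed
    then have "(\<integral>\<^sup>+w. ennreal (norm (indicator (cell i) w *\<^sub>R F w)) \<partial>B) \<le> ennreal (b powr (2 + \<alpha>)) * PP \<alpha> (hnorm F) z"
      unfolding B_def by (intro cell_norm_bound Fm[unfolded B_def] z b)
    also have "\<dots> < \<infinity>" using fin by (simp add: ennreal_mult_less_top)
    finally show "(\<integral>\<^sup>+w. ennreal (norm (indicator (cell i) w *\<^sub>R F w)) \<partial>B) < \<infinity>" .
  qed
  have "(\<Sum>i\<in>S. atom rc (cell_coeff F) i z) = rc * (\<Sum>i\<in>S. k (pt i) * cell_integral F i)"
    unfolding sum_distrib_left
  proof (rule sum.cong[OF refl])
    fix i :: "int \<times> int"
    have "sc (snd i) powr (\<alpha> + 2) \<noteq> 0" by simp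
    then show "atom rc (cell_coeff F) i z = rc * (k (pt i) * cell_integral F i)"
      by (simp add: atom_def cell_coeff_def k_def s_def del: of_real_add)
  qed
  also have "(\<Sum>i\<in>S. k (pt i) * cell_integral F i) = (LINT w|B. (\<Sum>i\<in>S. k (pt i) * (indicator (cell i) w *\<^sub>R F w)))"
  proof -
    have "(LINT w|B. (\<Sum>i\<in>S. k (pt i) * (indicator (cell i) w *\<^sub>R F w)))
      = (\<Sum>i\<in>S. LINT w|B. k (pt i) * (indicator (cell i) w *\<^sub>R F w))"
      by (rule Bochner_Integration.integral_sum) (intro integrable_mult_right celli)
    then show ?thesis by (simp only: integral_mult_right_zero cell_integral_def B_def)
  qed
  finally have sumeq: "(\<Sum>i\<in>S. atom rc (cell_coeff F) i z)
      = rc * (LINT w|B. (\<Sum>i\<in>S. k (pt i) * (indicator (cell i) w *\<^sub>R F w)))" .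
  have "integrable B (\<lambda>w. \<Sum>i\<in>S. k (pt i) * (indicator (cell i) w *\<^sub>R F w))"
    by (intro Bochner_Integration.integrable_sum integrable_mult_right celli)
  from Bochner_Integration.integral_diff[OF int this]
  have "F z - (\<Sum>i\<in>S. atom rc (cell_coeff F) i z)
    = rc * (LINT w|B. F w * k w - (\<Sum>i\<in>S. k (pt i) * (indicator (cell i) w *\<^sub>R F w)))"
    unfolding sumeq Fz by (simp only: right_diff_distrib)
  then have "ennreal (norm (F z - (\<Sum>i\<in>S. atom rc (cell_coeff F) i z)))
    = ennreal (norm rc) * ennreal (norm (LINT w|B. F w * k w - (\<Sum>i\<in>S. k (pt i) * (indicator (cell i) w *\<^sub>R F w))))"
    by (simp only: norm_mult ennreal_mult norm_ge_zero)
  also have "\<dots> \<le> ennreal (norm rc) *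
     (\<integral>\<^sup>+w. ennreal (norm (F w * k w - (\<Sum>i\<in>S. k (pt i) * (indicator (cell i) w *\<^sub>R F w)))) \<partial>B)"
    by (intro mult_left_mono norm_integral_le_nn_integral) simp
  also have "\<dots> \<le> ennreal (norm rc) *
     (\<integral>\<^sup>+w. ennreal \<epsilon> * (hnorm F w * ennreal (1 / norm (z - cnj w) powr (2 + \<alpha>)))
        + hnorm F w * indicator (outside S) w * ennreal (1 / norm (z - cnj w) powr (2 + \<alpha>)) \<partial>B)"
  proof (intro mult_left_mono nn_integral_mono)
    fix w assume "w \<in> space B"
    then have w: "w \<in> upper_half_plane" by (simp add: B_def space_bergman_measure)
    have sum: "(\<Sum>i\<in>S. k (pt i) * (indicator (cell i) w *\<^sub>R F w)) = (if idx w \<in> S then k (pt (idx w)) * F w else 0)"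
    proof -
      have "(\<Sum>i\<in>S. k (pt i) * (indicator (cell i) w *\<^sub>R F w)) = (\<Sum>i\<in>S. if idx w = i then k (pt i) * F w else 0)"
        by (intro sum.cong) (auto simp: cell_def)
      then show ?thesis using S by simp
    qed
    show "ennreal (norm (F w * k w - (\<Sum>i\<in>S. k (pt i) * (indicator (cell i) w *\<^sub>R F w))))
      \<le> ennreal \<epsilon> * (hnorm F w * ennreal (1 / norm (z - cnj w) powr (2 + \<alpha>)))
        + hnorm F w * indicator (outside S) w * ennreal (1 / norm (z - cnj w) powr (2 + \<alpha>))"
    proof (cases "idx w \<in> S")
      case True
      define i where "i = idx w"
      have wi: "w \<in> cell i" by (simp add: cell_def i_def)
      \<comment> \<open>The displacement is at most \<open>\<eta> * sc (snd i)\<close>, and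
        \<open>sc (snd i) \<le> Im w \<le> norm (z - cnj w)\<close> makes it small relative to the
        kernel argument.\<close>
      have "norm ((z - cnj w) - (z - cnj (pt i))) = norm (w - pt i)"
        using complex_mod_cnj[of "pt i - w"] by (simp add: norm_minus_commute)
      also have "\<dots> \<le> \<eta> * norm (z - cnj w)"
      proof -
        have "sc (snd i) \<le> norm (z - cnj w)"
          using cell_dist(3)[OF w wi] upper_half_plane_norm_ge(2)[OF z w] by linarith
        then have "\<eta> * sc (snd i) \<le> \<eta> * norm (z - cnj w)" using eta_pos by (intro mult_left_mono) auto
        then show ?thesis using cell_dist(1)[OF w wi] by linarith
      qed
      also have "\<dots> \<le> \<theta> * norm (z - cnj w)" using \<theta> by (rule mult_right_mono) simp
      finally have "norm (k w - k (pt i)) \<le> \<epsilon> / norm (z - cnj w) powr (2 + \<alpha>)"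
        using pert kernel_arg(1)[OF z w] kernel_arg(1)[OF z pt_upper[of i]] unfolding k_def s_def by blast
      then have "norm (F w) * norm (k w - k (pt i)) \<le> norm (F w) * (\<epsilon> / norm (z - cnj w) powr (2 + \<alpha>))"
        by (rule mult_left_mono) simp
      moreover have "F w * k w - k (pt i) * F w = F w * (k w - k (pt i))" by (simp add: algebra_simps)
      ultimately have "norm (F w * k w - k (pt i) * F w) \<le> \<epsilon> * (norm (F w) * (1 / norm (z - cnj w) powr (2 + \<alpha>)))"
        by (simp add: norm_mult mult_ac)
      then have "ennreal (norm (F w * k w - k (pt i) * F w)) \<le> ennreal \<epsilon> * (hnorm F w * ennreal (1 / norm (z - cnj w) powr (2 + \<alpha>)))"
        using \<epsilon> w by (simp add: hnorm_def ennreal_mult[symmetric] ennreal_leI)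
      then show ?thesis unfolding sum using True by (simp add: i_def add_increasing2)
    next
      case False
      have "norm (F w * k w) = norm (F w) * (1 / norm (z - cnj w) powr (2 + \<alpha>))"
        unfolding norm_mult k_def s_def norm_divide norm_powr_real by simp
      then have "ennreal (norm (F w * k w)) = hnorm F w * indicator (outside S) w * ennreal (1 / norm (z - cnj w) powr (2 + \<alpha>))"
        using w False by (simp add: hnorm_def outside_def ennreal_mult[symmetric])
      then show ?thesis unfolding sum using False by (simp add: add_increasing)
    qed
  qed simp
  also have "(\<integral>\<^sup>+w. ennreal \<epsilon> * (hnorm F w * ennreal (1 / norm (z - cnj w) powr (2 + \<alpha>)))
        + hnorm F w * indicator (outside S) w * ennreal (1 / norm (z - cnj w) powr (2 + \<alpha>)) \<partial>B)
    = ennreal \<epsilon> * PP \<alpha> (hnorm F) z + PP \<alpha> (\<lambda>w. hnorm F w * indicator (outside S) w) z"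
  proof -
    have m1: "(\<lambda>w. hnorm F w * ennreal (1 / norm (z - cnj w) powr (2 + \<alpha>))) \<in> borel_measurable B"
      unfolding B_def by (rule borel_measurable_bergman_measure) measurable
    have m2: "(\<lambda>w. hnorm F w * indicator (outside S) w * ennreal (1 / norm (z - cnj w) powr (2 + \<alpha>))) \<in> borel_measurable B"
      unfolding B_def by (rule borel_measurable_bergman_measure) measurable
    show ?thesis using m1 m2 by (subst nn_integral_add) (auto simp: nn_integral_cmult PP_def B_def)
  qed
  finally show ?thesis .
qed

lemma discretization_error:
  assumes F: "F holomorphic_on upper_half_plane" and z: "z \<in> upper_half_plane"
    and fin: "PP \<alpha> (hnorm F) z < top" and \<epsilon>: "0 < \<epsilon>"
    and pert: "\<forall>\<xi>\<in>upper_half_plane. \<forall>\<xi>'\<in>upper_half_plane. norm (\<xi> - \<xi>') \<le> \<theta> * norm \<xi> \<longrightarrow>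
      norm (1 / \<xi> powr of_real (2 + \<alpha>) - 1 / \<xi>' powr of_real (2 + \<alpha>)) \<le> \<epsilon> / norm \<xi> powr (2 + \<alpha>)"
    and \<theta>: "\<eta> \<le> \<theta>"
    and R: "((\<lambda>i. atom rc (cell_coeff F) i z) has_sum R) UNIV"
  shows "ennreal (norm (F z - R)) \<le> ennreal (norm rc * \<epsilon>) * PP \<alpha> (hnorm F) z"
proof -
  note Hm [measurable] = hnorm_measurable[OF holomorphic_bergman_measurable[OF F]]
  have "(\<lambda>n. \<Sum>i\<in>box_of n. atom rc (cell_coeff F) i z) \<longlonglongrightarrow> R"
    using R box_of_filterlim unfolding has_sum_def by (rule filterlim_compose)
  then have "(\<lambda>n. ennreal (norm (F z - (\<Sum>i\<in>box_of n. atom rc (cell_coeff F) i z)))) \<longlonglongrightarrow> ennreal (norm (F z - R))"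
    by (intro tendsto_ennrealI tendsto_norm tendsto_diff tendsto_const)
  moreover have "(\<lambda>n. ennreal (norm rc) * (ennreal \<epsilon> * PP \<alpha> (hnorm F) z + PP \<alpha> (\<lambda>w. hnorm F w * indicator (outside (box_of n)) w) z))
    \<longlonglongrightarrow> ennreal (norm rc) * (ennreal \<epsilon> * PP \<alpha> (hnorm F) z + 0)"
    by (intro ennreal_tendsto_cmult tendsto_add tendsto_const PP_outside_tendsto_0 Hm fin) simp
  ultimately have "ennreal (norm (F z - R)) \<le> ennreal (norm rc) * (ennreal \<epsilon> * PP \<alpha> (hnorm F) z + 0)"
  proof (rule LIMSEQ_le)
    show "\<exists>N. \<forall>n\<ge>N. ennreal (norm (F z - (\<Sum>i\<in>box_of n. atom rc (cell_coeff F) i z)))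
      \<le> ennreal (norm rc) * (ennreal \<epsilon> * PP \<alpha> (hnorm F) z + PP \<alpha> (\<lambda>w. hnorm F w * indicator (outside (box_of n)) w) z)"
      using discretization_partial[OF F z fin \<epsilon> pert \<theta>] by (auto simp: box_of_def)
  qed
  then show ?thesis using \<epsilon> by (simp add: ennreal_mult mult.assoc)
qed

text \<open>The remainder operator is \<open>T G = G - R G\<close>, where \<open>R G\<close> is the
  atomic series with the cell coefficients of \<open>G\<close>. The bound on
  \<open>norm rc * \<epsilon> * K2\<close> makes \<open>T\<close> halve the norm, so the
  coefficients of \<open>F\<close> are the sums over \<open>n\<close> of the cell coefficients of
  \<open>(T ^^ n) F\<close>. The numbers \<open>K2\<close>, \<open>\<epsilon>\<close> and
  \<open>\<theta>\<close> do not refer to the lattice, which is constrained only by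
  \<open>\<eta> \<le> \<theta>\<close>.\<close>

lemma analysis:
  assumes K2: "\<And>f. f \<in> borel_measurable borel \<Longrightarrow> N (PP \<alpha> f) \<le> ennreal K2 * N f" "0 \<le> K2"
    and \<epsilon>: "0 < \<epsilon>" "norm rc * \<epsilon> * K2 \<le> 1 / 2"
    and pert: "\<forall>\<xi>\<in>upper_half_plane. \<forall>\<xi>'\<in>upper_half_plane. norm (\<xi> - \<xi>') \<le> \<theta> * norm \<xi> \<longrightarrow>
      norm (1 / \<xi> powr of_real (2 + \<alpha>) - 1 / \<xi>' powr of_real (2 + \<alpha>)) \<le> \<epsilon> / norm \<xi> powr (2 + \<alpha>)"
    and \<theta>: "\<eta> \<le> \<theta>"
    and F: "F holomorphic_on upper_half_plane" and NF: "N (hnorm F) < top"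
  shows "\<exists>\<mu>. N (step (\<lambda>i. ennreal (norm (\<mu> i)))) \<le> ennreal (2 * cell_const * K2) * N (hnorm F) \<and>
    (\<forall>z\<in>upper_half_plane. ((\<lambda>i. atom rc \<mu> i z) has_sum F z) UNIV)"
proof -
  define X where "X G \<longleftrightarrow> G holomorphic_on upper_half_plane \<and> N (hnorm G) < top" for G
  define R where "R G z = (\<Sum>\<^sub>\<infinity>i\<in>UNIV. atom rc (cell_coeff G) i z)" for G z
  define T where "T G = (\<lambda>z. G z - R G z)" for G
  have meas: "G \<in> borel_measurable (bergman_measure \<alpha>)" "hnorm G \<in> borel_measurable borel"
    if "X G" for G
    using that holomorphic_bergman_measurable[of G \<alpha>] hnorm_measurable[of G \<alpha>] by (auto simp: X_def)
  have PPfin: "PP \<alpha> (hnorm G) z < top" if "X G" "z \<in> upper_half_plane" for G z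
    using that meas(2)[OF that(1)] by (intro PP_finite) (auto simp: X_def)
  have coeffN: "N (step (\<lambda>i. ennreal (norm (cell_coeff G i)))) \<le> ennreal (cell_const * K2) * N (hnorm G)" if G: "X G" for G
  proof -
    have "N (step (\<lambda>i. ennreal (norm (cell_coeff G i)))) \<le> ennreal cell_const * N (PP \<alpha> (hnorm G))"
      by (rule cell_coeff_norm_le[OF meas(1)[OF G]])
    also have "\<dots> \<le> ennreal cell_const * (ennreal K2 * N (hnorm G))"
      by (intro mult_left_mono K2 meas(2) G) simp
    also have "\<dots> = ennreal (cell_const * K2) * N (hnorm G)"
      using K2(2) by (simp add: ennreal_mult cell_const_def mult.assoc)
    finally show ?thesis .
  qed
  have coefffin: "N (step (\<lambda>i. ennreal (norm (cell_coeff G i)))) < top" if G: "X G" for G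
    using coeffN[OF G] G by (auto simp: X_def ennreal_mult_less_top intro: le_less_trans)
  have Rsum: "((\<lambda>i. atom rc (cell_coeff G) i z) has_sum R G z) UNIV" if "X G" "z \<in> upper_half_plane" for G z
    unfolding R_def
    by (rule has_sum_infsum[OF abs_summable_summable[OF atom_series(1)[OF coefffin[OF that(1)] that(2)]]])
  have Tle: "ennreal (norm (T G z)) \<le> ennreal (norm rc * \<epsilon>) * PP \<alpha> (hnorm G) z" if G: "X G" and z: "z \<in> upper_half_plane" for G z
    unfolding T_def using G z
    by (intro discretization_error[OF _ z PPfin[OF G z] \<epsilon>(1) pert \<theta> Rsum]) (auto simp: X_def)
  have TN: "N (hnorm (T G)) \<le> ennreal (1 / 2) * N (hnorm G)" if G: "X G" for G
  proof -
    note [measurable] = meas(2)[OF G]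
    have "N (hnorm (T G)) \<le> N (\<lambda>z. ennreal (norm rc * \<epsilon>) * PP \<alpha> (hnorm G) z)"
      by (intro N_mono) (simp add: hnorm_def Tle G)
    also have "\<dots> = ennreal (norm rc * \<epsilon>) * N (PP \<alpha> (hnorm G))" by (rule N_cmult) measurable
    also have "\<dots> \<le> ennreal (norm rc * \<epsilon>) * (ennreal K2 * N (hnorm G))"
      by (intro mult_left_mono K2) simp_all
    also have "\<dots> = ennreal (norm rc * \<epsilon> * K2) * N (hnorm G)"
      using \<epsilon> K2(2) by (simp add: ennreal_mult mult.assoc)
    also have "\<dots> \<le> ennreal (1 / 2) * N (hnorm G)" using \<epsilon>(2) by (intro mult_right_mono ennreal_leI) auto
    finally show ?thesis .
  qed
  have XT: "X (T G)" if G: "X G" for G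
  proof -
    have "R G holomorphic_on upper_half_plane"
      by (rule atom_series(2)[OF coefffin[OF G] Rsum[OF G]])
    then have "T G holomorphic_on upper_half_plane"
      using G unfolding T_def X_def by (intro holomorphic_intros) auto
    moreover have "ennreal (1 / 2) * N (hnorm G) < top"
      using G unfolding X_def ennreal_mult_less_top by (metis ennreal_less_top)
    then have "N (hnorm (T G)) < top" using TN[OF G] by (rule le_less_trans[rotated])
    ultimately show ?thesis by (simp add: X_def)
  qed
  define Fn where "Fn n = (T ^^ n) F" for n
  have Fn_Suc: "Fn (Suc n) = T (Fn n)" for n by (simp add: Fn_def)
  have XF: "X (Fn n)" for n
    by (induction n) (use F NF XT in \<open>auto simp: Fn_def X_def\<close>)
  have NFn: "N (hnorm (Fn n)) \<le> ennreal ((1 / 2) ^ n) * N (hnorm F)" for n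
  proof (induction n)
    case (Suc n)
    have "N (hnorm (Fn (Suc n))) \<le> ennreal (1 / 2) * N (hnorm (Fn n))"
      unfolding Fn_Suc by (rule TN[OF XF])
    also have "\<dots> \<le> ennreal (1 / 2) * (ennreal ((1 / 2) ^ n) * N (hnorm F))"
      by (intro mult_left_mono Suc.IH) simp
    also have "\<dots> = ennreal ((1 / 2) ^ Suc n) * N (hnorm F)"
    proof -
      have "ennreal ((1 / 2) ^ Suc n) = ennreal (1 / 2) * ennreal ((1 / 2) ^ n)"
        by (subst ennreal_mult[symmetric]) (simp_all only: power_Suc, auto)
      then show ?thesis by (simp only: mult.assoc)
    qed
    finally show ?case .
  qed (simp add: Fn_def)
  have geo: "(\<Sum>n. ennreal ((1 / 2) ^ n)) = 2"
  proof -
    have "(\<Sum>n. ennreal ((1 / 2) ^ n)) = ennreal (\<Sum>n. (1 / 2) ^ n)"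
      by (intro suminf_ennreal2 summable_geometric) auto
    also have "(\<Sum>n. (1 / 2 :: real) ^ n) = 2" by (subst suminf_geometric) auto
    finally show ?thesis by simp
  qed
  have sumFn: "(\<Sum>n. N (hnorm (Fn n))) \<le> 2 * N (hnorm F)"
  proof -
    have "(\<Sum>n. N (hnorm (Fn n))) \<le> (\<Sum>n. ennreal ((1 / 2) ^ n) * N (hnorm F))"
      by (intro suminf_le NFn) auto
    also have "\<dots> = 2 * N (hnorm F)" by (simp add: ennreal_suminf_multc geo)
    finally show ?thesis .
  qed
  define a where "a n i = ennreal (norm (cell_coeff (Fn n) i))" for n i
  \<comment> \<open>Summed in \<open>[0,\<infinity>]\<close>, so that the norm bound comes before
    any convergence of the coefficient series; finiteness of each \<open>A i\<close> is deduced from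
    that bound.\<close>
  define A where "A i = (\<Sum>n. a n i)" for i
  have NA: "N (step A) \<le> ennreal (2 * cell_const * K2) * N (hnorm F)"
  proof -
    have "N (step A) = N (\<lambda>z. \<Sum>n. step (a n) z)"
      by (simp add: step_def[abs_def] A_def)
    also have "\<dots> \<le> (\<Sum>n. N (step (a n)))" by (rule N_suminf_le) measurable
    also have "\<dots> \<le> (\<Sum>n. ennreal (cell_const * K2) * N (hnorm (Fn n)))"
      unfolding a_def by (intro suminf_le coeffN XF) auto
    also have "\<dots> = ennreal (cell_const * K2) * (\<Sum>n. N (hnorm (Fn n)))" by (rule ennreal_suminf_cmult)
    also have "\<dots> \<le> ennreal (cell_const * K2) * (2 * N (hnorm F))" by (intro mult_left_mono sumFn) simp
    also have "\<dots> = ennreal (2 * cell_const * K2) * N (hnorm F)"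
    proof -
      have "ennreal (2 * cell_const * K2) = ennreal (cell_const * K2) * ennreal 2"
        using K2(2) by (subst ennreal_mult[symmetric]) (auto simp: cell_const_def mult_ac)
      then show ?thesis by (simp add: mult.assoc)
    qed
    finally show ?thesis .
  qed
  have NAfin: "N (step A) < top" using NA NF by (auto simp: ennreal_mult_less_top intro: le_less_trans)
  have Afin': "(\<integral>\<^sup>+i. A i * ennreal (atom_size i z) \<partial>count_space UNIV) < top" if z: "z \<in> upper_half_plane" for z
  proof -
    obtain K :: real where "(\<integral>\<^sup>+i. A i * ennreal (atom_size i z) \<partial>count_space UNIV) \<le> ennreal K * PP \<alpha> (step A) z"
      using atom_sum_le_PP z by blast
    also have "\<dots> < top" using PP_finite[OF step_measurable NAfin z] by (simp add: ennreal_mult_less_top)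
    finally show ?thesis .
  qed
  have i0: "\<i> \<in> upper_half_plane" by (simp add: upper_half_plane_def)
  \<comment> \<open>Every \<open>atom_size i\<close> is positive at \<open>\<i>\<close>, so a finite
    weighted sum there forces each \<open>A i\<close> to be finite.\<close>
  have Afin: "A i < top" for i
  proof -
    have "A i * ennreal (atom_size i \<i>) = (\<Sum>i\<in>{i}. A i * ennreal (atom_size i \<i>))" by simp
    also have "\<dots> \<le> (\<integral>\<^sup>+i. A i * ennreal (atom_size i \<i>) \<partial>count_space UNIV)"
      by (rule sum_le_nn_integral_count_space) auto
    also have "\<dots> < top" by (rule Afin'[OF i0])
    finally have "A i * ennreal (atom_size i \<i>) < top" .
    moreover have "0 < atom_size i \<i>"
      using upper_half_plane_norm_ge(3)[OF i0 pt_upper[of i]] by (simp add: atom_size_def)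
    ultimately show ?thesis by (auto simp: ennreal_mult_less_top)
  qed
  have csum: "summable (\<lambda>n. norm (cell_coeff (Fn n) i))" for i
    using Afin[of i] by (intro summable_suminf_not_top) (auto simp: A_def a_def)
  define \<mu> where "\<mu> i = (\<Sum>n. cell_coeff (Fn n) i)" for i
  have muA: "ennreal (norm (\<mu> i)) \<le> A i" for i
  proof -
    have "norm (\<mu> i) \<le> (\<Sum>n. norm (cell_coeff (Fn n) i))" unfolding \<mu>_def by (rule summable_norm[OF csum])
    then have "ennreal (norm (\<mu> i)) \<le> ennreal (\<Sum>n. norm (cell_coeff (Fn n) i))" by (rule ennreal_leI)
    also have "\<dots> = A i" unfolding A_def a_def using csum by (intro suminf_ennreal2[symmetric]) auto
    finally show ?thesis .
  qed
  have N\<mu>: "N (step (\<lambda>i. ennreal (norm (\<mu> i)))) \<le> N (step A)"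
    by (intro N_mono) (simp add: step_def muA)
  have N\<mu>fin: "N (step (\<lambda>i. ennreal (norm (\<mu> i)))) < top" using N\<mu> NAfin by (rule le_less_trans)
  have main: "((\<lambda>i. atom rc \<mu> i z) has_sum F z) UNIV" if z: "z \<in> upper_half_plane" for z
  proof -
    define u where "u n i = atom rc (cell_coeff (Fn n)) i z" for n i
    \<comment> \<open>Absolute summability over \<open>n\<close> and \<open>i\<close> together
      licenses both orders of summation: summing over \<open>i\<close> first gives a telescoping
      series, summing over \<open>n\<close> first gives the atoms of \<open>\<mu>\<close>.\<close>
    have dbl: "(\<lambda>(n, i). u n i) summable_on UNIV \<times> UNIV"
    proof -
      have "(\<integral>\<^sup>+x. ennreal (norm (case x of (n, i) \<Rightarrow> u n i)) \<partial>count_space UNIV)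
        = (\<integral>\<^sup>+i. (\<integral>\<^sup>+n. ennreal (norm (u n i)) \<partial>count_space UNIV) \<partial>count_space UNIV)"
        by (subst nn_integral_snd_count_space[symmetric]) simp
      also have "\<dots> = (\<integral>\<^sup>+i. ennreal (norm rc) * (A i * ennreal (atom_size i z)) \<partial>count_space UNIV)"
      proof (rule nn_integral_cong)
        fix i
        have "(\<integral>\<^sup>+n. ennreal (norm (u n i)) \<partial>count_space UNIV) = (\<Sum>n. ennreal (norm rc) * (a n i * ennreal (atom_size i z)))"
          unfolding nn_integral_count_space_nat u_def norm_atom a_def by (simp add: ennreal_mult)
        then show "(\<integral>\<^sup>+n. ennreal (norm (u n i)) \<partial>count_space UNIV) = ennreal (norm rc) * (A i * ennreal (atom_size i z))"
          by (simp add: ennreal_suminf_cmult ennreal_suminf_multc A_def)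
      qed
      also have "\<dots> = ennreal (norm rc) * (\<integral>\<^sup>+i. A i * ennreal (atom_size i z) \<partial>count_space UNIV)"
        by (rule nn_integral_cmult) simp
      also have "\<dots> < top" using Afin'[OF z] by (simp add: ennreal_mult_less_top)
      finally have "(\<lambda>x. norm (case x of (n, i) \<Rightarrow> u n i)) summable_on UNIV"
        by (rule abs_summable_if_nn_integral_finite)
      then show ?thesis by (simp add: abs_summable_summable)
    qed
    have inner: "(\<Sum>\<^sub>\<infinity>i\<in>UNIV. u n i) = Fn n z - Fn (Suc n) z" for n
      by (simp add: u_def Fn_Suc T_def R_def)
    have inner': "(\<Sum>\<^sub>\<infinity>n\<in>UNIV. u n i) = atom rc \<mu> i z" for i
    proof -
      have s: "(\<lambda>n. cell_coeff (Fn n) i) sums \<mu> i"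
        unfolding \<mu>_def by (rule summable_sums[OF summable_norm_cancel[OF csum]])
      define b where "b = of_real (sc (snd i) powr (\<alpha> + 2)) * (rc / (z - cnj (pt i)) powr of_real (2 + \<alpha>))"
      have ub: "u n i = cell_coeff (Fn n) i * b" for n
        by (simp add: u_def atom_def b_def mult.assoc)
      have "(\<lambda>n. u n i) sums (\<mu> i * b)" unfolding ub by (rule sums_mult2[OF s])
      moreover have "summable (\<lambda>n. norm (u n i))" unfolding ub norm_mult by (rule summable_mult2[OF csum])
      ultimately have "((\<lambda>n. u n i) has_sum (\<mu> i * b)) UNIV" by (intro norm_summable_imp_has_sum)
      then have "(\<Sum>\<^sub>\<infinity>n\<in>UNIV. u n i) = \<mu> i * b" by (rule infsumI)
      then show ?thesis by (simp add: atom_def b_def mult.assoc)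
    qed
    \<comment> \<open>Norms tending to zero do not by themselves make the values tend to zero. The
      reproducing formula bounds \<open>norm (Fn n z)\<close> by a multiple of \<open>PP\<close> of
      \<open>hnorm (Fn n)\<close>, and the sum of these is \<open>PP\<close> of a function of finite
      norm.\<close>
    have Fn0: "(\<lambda>n. Fn n z) \<longlonglongrightarrow> 0"
    proof -
      note mF [measurable] = meas(2)[OF XF]
      have "N (\<lambda>z. \<Sum>n. hnorm (Fn n) z) \<le> (\<Sum>n. N (hnorm (Fn n)))" by (rule N_suminf_le) measurable
      also have "\<dots> < top" using sumFn NF by (auto simp: ennreal_mult_less_top intro: le_less_trans)
      finally have "PP \<alpha> (\<lambda>z. \<Sum>n. hnorm (Fn n) z) z < top" by (intro PP_finite z) measurable
      then have "(\<Sum>n. PP \<alpha> (hnorm (Fn n)) z) < top"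
        using PP_nn_integral_count_space[of "\<lambda>n. hnorm (Fn n)" \<alpha> z] mF by (simp add: nn_integral_count_space_nat)
      then have "ennreal (norm rc) * (\<Sum>n. PP \<alpha> (hnorm (Fn n)) z) < top" by (simp add: ennreal_mult_less_top)
      moreover have "(\<Sum>n. ennreal (norm (Fn n z))) \<le> (\<Sum>n. ennreal (norm rc) * PP \<alpha> (hnorm (Fn n)) z)"
      proof (intro suminf_le)
        fix n
        have h: "Fn n holomorphic_on upper_half_plane" using XF[of n] by (simp add: X_def)
        have "Fn n z = rc * bergman_op \<alpha> (Fn n) z"
          unfolding bergman_op_def
          using PPfin[OF XF[of n] z] by (intro reproducing_formula(2)[OF alpha h z]) (simp add: PP_hnorm)
        then have "ennreal (norm (Fn n z)) = ennreal (norm rc) * ennreal (norm (bergman_op \<alpha> (Fn n) z))"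
          by (simp add: norm_mult ennreal_mult)
        also have "\<dots> \<le> ennreal (norm rc) * PP \<alpha> (hnorm (Fn n)) z"
          by (intro mult_left_mono bergman_op_norm_le meas XF z PPfin) simp
        finally show "ennreal (norm (Fn n z)) \<le> ennreal (norm rc) * PP \<alpha> (hnorm (Fn n)) z" .
      qed auto
      ultimately have "(\<Sum>n. ennreal (norm (Fn n z))) < top"
        by (simp add: ennreal_suminf_cmult le_less_trans)
      then have "summable (\<lambda>n. norm (Fn n z))" by (intro summable_suminf_not_top) auto
      from summable_LIMSEQ_zero[OF summable_norm_cancel[OF this]] show ?thesis .
    qed
    have "(\<lambda>n. (\<Sum>\<^sub>\<infinity>i\<in>UNIV. u n i)) summable_on UNIV"
      using summable_on_Sigma_banach[OF dbl] by simp
    then have "((\<lambda>n. Fn n z - Fn (Suc n) z) has_sum (\<Sum>\<^sub>\<infinity>n\<in>UNIV. Fn n z - Fn (Suc n) z)) UNIV"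
      unfolding inner by (rule has_sum_infsum)
    then have "(\<lambda>n. Fn n z - Fn (Suc n) z) sums (\<Sum>\<^sub>\<infinity>n\<in>UNIV. Fn n z - Fn (Suc n) z)" by (rule has_sum_imp_sums)
    moreover have "(\<lambda>n. Fn n z - Fn (Suc n) z) sums (Fn 0 z - 0)" by (rule telescope_sums'[OF Fn0])
    ultimately have "(\<Sum>\<^sub>\<infinity>n\<in>UNIV. Fn n z - Fn (Suc n) z) = F z"
      using sums_unique2 by (fastforce simp: Fn_def)
    moreover have "(\<Sum>\<^sub>\<infinity>n\<in>UNIV. (\<Sum>\<^sub>\<infinity>i\<in>UNIV. u n i)) = (\<Sum>\<^sub>\<infinity>i\<in>UNIV. (\<Sum>\<^sub>\<infinity>n\<in>UNIV. u n i))"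
      by (rule infsum_swap_banach[OF dbl])
    ultimately have "(\<Sum>\<^sub>\<infinity>i\<in>UNIV. atom rc \<mu> i z) = F z" by (simp only: inner inner')
    moreover have "(\<lambda>i. atom rc \<mu> i z) summable_on UNIV"
      by (rule abs_summable_summable[OF atom_series(1)[OF N\<mu>fin z]])
    ultimately show ?thesis using has_sum_infsum by metis
  qed
  show ?thesis using order_trans[OF N\<mu> NA] main by blast
qed

text \<open>Formulated for every \<open>F\<close> that is pointwise the sum: the series determines
  \<open>F\<close> on the half-plane only, and in the representation of a given function
  \<open>F\<close> comes before the coefficients.\<close>

lemma synthesis:
  "\<exists>C::real. \<forall>\<mu>. coeff_norm (\<lambda>i. ennreal (norm (\<mu> i))) < top \<longrightarrow>
    (\<forall>F. (\<forall>z\<in>upper_half_plane. ((\<lambda>i. atom c \<mu> i z) has_sum F z) UNIV) \<longrightarrow>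
      F holomorphic_on upper_half_plane \<and> N (hnorm F) < top \<and>
      ennreal_powr (N (hnorm F)) q \<le> ennreal C * coeff_norm (\<lambda>i. ennreal (norm (\<mu> i))) \<and>
      (\<forall>i. N (hnorm (atom c \<mu> i)) < top) \<and>
      ((\<lambda>S. N (hnorm (\<lambda>z. F z - (\<Sum>i\<in>S. atom c \<mu> i z)))) \<longlongrightarrow> 0) (finite_subsets_at_top UNIV))"
proof -
  obtain K :: real where K: "0 < K" and le: "\<And>\<mu> F S. finite S \<Longrightarrow> (\<And>z. z \<in> upper_half_plane \<Longrightarrow> ((\<lambda>i. atom c \<mu> i z) has_sum F z) UNIV) \<Longrightarrow>
      N (hnorm (\<lambda>z. F z - (\<Sum>i\<in>S. atom c \<mu> i z)))
        \<le> ennreal K * N (\<lambda>z. step (\<lambda>i. ennreal (norm (\<mu> i))) z * indicator (outside S) z)"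
    by (rule synthesis_bound[of c]) (rule that, assumption, simp)
  obtain C :: real where C: "0 < C" "\<And>a. ennreal_powr (N (step a)) q \<le> ennreal C * coeff_norm a"
    using step_norm by blast
  have le0: "N (hnorm F) \<le> ennreal K * N (step (\<lambda>i. ennreal (norm (\<mu> i))))"
    if "\<And>z. z \<in> upper_half_plane \<Longrightarrow> ((\<lambda>i. atom c \<mu> i z) has_sum F z) UNIV" for \<mu> F
    using le[of "{}", OF _ that] by (simp add: outside_def)
  show ?thesis
  proof (intro exI[of _ "K powr q * C"] allI impI)
    fix \<mu> F
    assume fin: "coeff_norm (\<lambda>i. ennreal (norm (\<mu> i))) < top"
      and "\<forall>z\<in>upper_half_plane. ((\<lambda>i. atom c \<mu> i z) has_sum F z) UNIV"
    then have F: "\<And>z. z \<in> upper_half_plane \<Longrightarrow> ((\<lambda>i. atom c \<mu> i z) has_sum F z) UNIV" by blast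
    define a where "a i = ennreal (norm (\<mu> i))" for i
    have Na: "N (step a) < top" using fin by (intro N_step_finite) (simp add: a_def[abs_def])
    have NF: "N (hnorm F) \<le> ennreal K * N (step a)" using le0[OF F] by (simp add: a_def[abs_def])
    have "ennreal_powr (N (hnorm F)) q \<le> ennreal_powr (ennreal K * N (step a)) q"
      using NF q by (intro ennreal_powr_mono) auto
    also have "\<dots> = ennreal (K powr q) * ennreal_powr (N (step a)) q" using K by (simp add: ennreal_powr_mult)
    also have "\<dots> \<le> ennreal (K powr q) * (ennreal C * coeff_norm a)" by (intro mult_left_mono C) simp
    also have "\<dots> = ennreal (K powr q * C) * coeff_norm a" using C by (simp add: ennreal_mult mult.assoc)
    finally have 1: "ennreal_powr (N (hnorm F)) q \<le> ennreal (K powr q * C) * coeff_norm a" .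
    have 2: "N (hnorm (atom c \<mu> i)) < top" for i
    proof -
      \<comment> \<open>A single atom is the series of a family with one nonzero coefficient, so
        \<open>le0\<close> bounds its norm as well.\<close>
      define \<mu>' where "\<mu>' i' = (if i' = i then \<mu> i else 0)" for i'
      have "((\<lambda>i'. atom c \<mu>' i' z) has_sum atom c \<mu> i z) UNIV" for z
        by (rule has_sum_finite_neutralI[of "{i}"]) (auto simp: atom_def \<mu>'_def)
      then have "N (hnorm (atom c \<mu> i)) \<le> ennreal K * N (step (\<lambda>i. ennreal (norm (\<mu>' i))))" by (intro le0)
      also have "\<dots> \<le> ennreal K * N (step a)"
        by (intro mult_left_mono N_mono) (auto simp: step_def \<mu>'_def a_def)
      also have "\<dots> < top" using Na by (simp add: ennreal_mult_less_top)
      finally show ?thesis .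
    qed
    show "F holomorphic_on upper_half_plane \<and> N (hnorm F) < top \<and>
      ennreal_powr (N (hnorm F)) q \<le> ennreal (K powr q * C) * coeff_norm (\<lambda>i. ennreal (norm (\<mu> i))) \<and>
      (\<forall>i. N (hnorm (atom c \<mu> i)) < top) \<and>
      ((\<lambda>S. N (hnorm (\<lambda>z. F z - (\<Sum>i\<in>S. atom c \<mu> i z)))) \<longlongrightarrow> 0) (finite_subsets_at_top UNIV)"
    proof (intro conjI)
      show "F holomorphic_on upper_half_plane" using Na F by (intro atom_series(2)) (auto simp: a_def[abs_def])
      show "N (hnorm F) < top" using NF Na by (auto simp: ennreal_mult_less_top intro: le_less_trans)
      show "((\<lambda>S. N (hnorm (\<lambda>z. F z - (\<Sum>i\<in>S. atom c \<mu> i z)))) \<longlongrightarrow> 0) (finite_subsets_at_top UNIV)"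
        using Na F by (intro synthesis_converges) (auto simp: a_def[abs_def])
    qed (use 1 2 in \<open>auto simp: a_def[abs_def]\<close>)
  qed
qed

end

subsection \<open>Logarithmic weights\<close>

lemma growth_function_nonneg:
  assumes "growth_function \<Phi>" "0 \<le> t"
  shows "0 \<le> \<Phi> t"
  using assms by (auto simp: growth_function_def)

text \<open>In the lower class \<open>\<Phi> t / t\<close> is nonincreasing, which gives the bound
  with \<open>r = 1\<close>; in the upper class it is the upper type. The constant is taken at least
  \<open>1\<close> so that \<open>ln C\<close> is nonnegative.\<close>

lemma growth_doubling:
  assumes "\<Phi> \<in> lower_growth \<union> upper_growth"
  shows "growth_function \<Phi>"
    and "\<exists>C r. 1 \<le> C \<and> 0 \<le> r \<and> (\<forall>t\<ge>1. \<forall>s>0. \<Phi> (s * t) \<le> C * t powr r * \<Phi> s)"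
proof -
  show g: "growth_function \<Phi>"
    using assms by (auto simp: lower_growth_def upper_growth_def lower_growth_type_def upper_growth_type_def)
  show "\<exists>C r. 1 \<le> C \<and> 0 \<le> r \<and> (\<forall>t\<ge>1. \<forall>s>0. \<Phi> (s * t) \<le> C * t powr r * \<Phi> s)"
    using assms
  proof
    assume "\<Phi> \<in> lower_growth"
    then have anti: "antimono_on {0<..} (\<lambda>t. \<Phi> t / t)" by (auto simp: lower_growth_def lower_growth_type_def)
    have "\<Phi> (s * t) \<le> 1 * t powr 1 * \<Phi> s" if "1 \<le> t" "0 < s" for s t
    proof -
      have "\<Phi> (s * t) / (s * t) \<le> \<Phi> s / s"
        using that by (intro monotone_onD[OF anti]) auto
      then show ?thesis using that by (simp add: pos_divide_le_eq field_simps)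
    qed
    then show ?thesis by (intro exI[of _ 1]) auto
  next
    assume "\<Phi> \<in> upper_growth"
    then obtain r where "1 \<le> r" "upper_type r \<Phi>" by (auto simp: upper_growth_def upper_growth_type_def)
    then obtain C where C: "0 < C" "\<And>s t. 1 \<le> t \<Longrightarrow> 0 < s \<Longrightarrow> \<Phi> (s * t) \<le> C * t powr r * \<Phi> s"
      by (auto simp: upper_type_def)
    have "\<Phi> (s * t) \<le> max C 1 * t powr r * \<Phi> s" if "1 \<le> t" "0 < s" for s t
    proof -
      have "C * t powr r * \<Phi> s \<le> max C 1 * t powr r * \<Phi> s"
        using growth_function_nonneg[OF g, of s] that by (intro mult_right_mono) auto
      then show ?thesis using C(2)[OF that] by linarith
    qed
    then show ?thesis using \<open>1 \<le> r\<close> by (intro exI[of _ "max C 1"] exI[of _ r]) auto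
  qed
qed

lemma ln_plus_nonneg [simp]: "0 \<le> ln_plus x"
  by (simp add: ln_plus_def)

lemma ln_plus_mono:
  assumes "0 \<le> x" "x \<le> y"
  shows "ln_plus x \<le> ln_plus y"
proof (cases "x \<le> 1")
  case True
  \<comment> \<open>The case \<open>x = 0\<close> rests on the default value of \<open>ln\<close>
    there.\<close>
  then have "ln x \<le> 0" using assms by (cases "x = 0") auto
  then show ?thesis by (simp add: ln_plus_def)
next
  case False
  then have "ln x \<le> ln y" using assms by simp
  then show ?thesis by (auto simp: ln_plus_def)
qed

lemma log_weight_ge_1: "1 \<le> log_weight \<Phi> \<epsilon>1 \<epsilon>2 t"
  by (simp add: log_weight_def)

text \<open>For \<open>t \<ge> 1\<close> take logarithms in the growth bound; for
  \<open>t < 1\<close> monotonicity of \<open>\<Phi>\<close> suffices.\<close>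

lemma ln_plus_dilation:
  assumes g: "growth_function \<Phi>" and C: "1 \<le> C" "0 \<le> r"
    and db: "\<And>t s. 1 \<le> t \<Longrightarrow> 0 < s \<Longrightarrow> \<Phi> (s * t) \<le> C * t powr r * \<Phi> s"
    and st: "0 < s" "0 < t"
  shows "ln_plus (\<Phi> (s * t)) \<le> ln_plus (\<Phi> s) + (ln C + r * \<bar>ln t\<bar>)"
proof (cases "1 \<le> t")
  case True
  have n: "0 \<le> ln C + r * \<bar>ln t\<bar>" using C by (intro add_nonneg_nonneg) auto
  show ?thesis
  proof (cases "\<Phi> (s * t) \<le> 1")
    case True
    have "ln (\<Phi> (s * t)) \<le> 0"
      using True growth_function_nonneg[OF g, of "s * t"] st by (cases "\<Phi> (s * t) = 0") auto
    then have "ln_plus (\<Phi> (s * t)) = 0" by (simp add: ln_plus_def)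
    then show ?thesis using n by (simp add: add_nonneg_nonneg)
  next
    case False
    have le: "\<Phi> (s * t) \<le> C * t powr r * \<Phi> s" using db True st by simp
    have "0 \<le> \<Phi> s" using growth_function_nonneg[OF g] st by simp
    moreover have "\<Phi> s \<noteq> 0" using le False by auto
    ultimately have ps: "0 < \<Phi> s" by simp
    have "ln (\<Phi> (s * t)) \<le> ln (C * t powr r * \<Phi> s)" using le False ps by simp
    also have "\<dots> = ln C + r * ln t + ln (\<Phi> s)" using C st ps by (simp add: ln_mult)
    also have "ln t = \<bar>ln t\<bar>" using True by simp
    finally show ?thesis using False n by (simp add: ln_plus_def)
  qed
next
  case False
  have "mono_on {0..} \<Phi>" using g by (simp add: growth_function_def)
  moreover have "s * t \<le> s" using False st by simp
  ultimately have "\<Phi> (s * t) \<le> \<Phi> s" using st by (intro mono_onD[of "{0..}" \<Phi>]) auto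
  then have "ln_plus (\<Phi> (s * t)) \<le> ln_plus (\<Phi> s)"
    using growth_function_nonneg[OF g, of "s * t"] st by (intro ln_plus_mono) auto
  moreover have "0 \<le> ln C + r * \<bar>ln t\<bar>" using C by (intro add_nonneg_nonneg) auto
  ultimately show ?thesis by linarith
qed

text \<open>A dilation adds at most a multiple of \<open>1 + \<bar>ln t\<bar>\<close> to the weight.
  Since the weight is at least one, an additive change is also a multiplicative one.\<close>

lemma log_weight_slow:
  assumes \<Phi>: "\<Phi> \<in> lower_growth \<union> upper_growth" and e: "\<epsilon>1 \<in> {0, 1}" "\<epsilon>2 \<in> {0, 1}"
  shows "\<exists>A\<ge>1. \<forall>s>0. \<forall>t>0. log_weight \<Phi> \<epsilon>1 \<epsilon>2 (s * t) \<le> A * (1 + \<bar>ln t\<bar>) * log_weight \<Phi> \<epsilon>1 \<epsilon>2 s"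
proof -
  obtain C r where C: "1 \<le> C" "0 \<le> r"
    and db: "\<And>t s. 1 \<le> t \<Longrightarrow> 0 < s \<Longrightarrow> \<Phi> (s * t) \<le> C * t powr r * \<Phi> s"
    using growth_doubling(2)[OF \<Phi>] by blast
  note g = growth_doubling(1)[OF \<Phi>]
  \<comment> \<open>Chosen so that \<open>1 + 2 * (ln C + r * \<bar>ln t\<bar>) \<le> A * (1 +
    \<bar>ln t\<bar>)\<close>; the factor two accounts for the two logarithms in the weight.\<close>
  define A where "A = 1 + 2 * ln C + 2 * r"
  have lC: "0 \<le> ln C" using C by simp
  have A: "1 \<le> A" using lC C by (simp add: A_def)
  have "log_weight \<Phi> \<epsilon>1 \<epsilon>2 (s * t) \<le> A * (1 + \<bar>ln t\<bar>) * log_weight \<Phi> \<epsilon>1 \<epsilon>2 s" if st: "0 < s" "0 < t" for s t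
  proof -
    define L where "L = ln C + r * \<bar>ln t\<bar>"
    have L: "0 \<le> L" unfolding L_def using lC C by (intro add_nonneg_nonneg) auto
    define w where "w = log_weight \<Phi> \<epsilon>1 \<epsilon>2 s"
    have w: "1 \<le> w" unfolding w_def by (rule log_weight_ge_1)
    have "ln_plus (\<Phi> (s * t)) \<le> ln_plus (\<Phi> s) + L"
      unfolding L_def by (rule ln_plus_dilation[OF g C db st])
    moreover have "ln_plus (\<Phi> ((1 / s) * (1 / t))) \<le> ln_plus (\<Phi> (1 / s)) + (ln C + r * \<bar>ln (1 / t)\<bar>)"
      using st by (intro ln_plus_dilation[OF g C db]) auto
    then have "ln_plus (\<Phi> (1 / (s * t))) \<le> ln_plus (\<Phi> (1 / s)) + L"
      using st by (simp add: L_def ln_div)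
    ultimately have "log_weight \<Phi> \<epsilon>1 \<epsilon>2 (s * t) \<le> w + 2 * L"
      using e L by (auto simp: log_weight_def w_def)
    also have "\<dots> \<le> w + 2 * L * w"
      using L w mult_left_mono[of 1 w "2 * L"] by simp
    also have "\<dots> = (1 + 2 * L) * w" by (simp add: algebra_simps)
    also have "\<dots> \<le> (A * (1 + \<bar>ln t\<bar>)) * w"
    proof (rule mult_right_mono)
      have "0 \<le> ln C * \<bar>ln t\<bar>" using lC by simp
      then show "1 + 2 * L \<le> A * (1 + \<bar>ln t\<bar>)"
        using C by (simp add: A_def L_def algebra_simps)
    qed (use w in simp)
    finally show ?thesis by (simp add: w_def)
  qed
  then show ?thesis using A by blast
qed

lemma log_bound_powr:
  fixes \<epsilon> k A :: real
  assumes \<epsilon>: "0 < \<epsilon>" and A: "0 \<le> A"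
  shows "\<exists>C\<ge>0. \<forall>t>0. (A * (1 + \<bar>ln t\<bar>)) powr \<bar>k\<bar> \<le> C * max t (1 / t) powr \<epsilon>"
proof -
  \<comment> \<open>With this exponent \<open>\<delta> * \<bar>k\<bar> \<le> \<epsilon>\<close>, and
    the \<open>+ 1\<close> covers \<open>k = 0\<close>. The logarithm will be bounded by
    \<open>m powr \<delta> / \<delta>\<close>.\<close>
  define \<delta> where "\<delta> = \<epsilon> / (\<bar>k\<bar> + 1)"
  have \<delta>: "0 < \<delta>" "\<delta> * \<bar>k\<bar> \<le> \<epsilon>" using \<epsilon> by (auto simp: \<delta>_def field_simps)
  define B where "B = A * (1 + 1 / \<delta>)"
  have B: "0 \<le> B" using A \<delta> by (simp add: B_def)
  have "(A * (1 + \<bar>ln t\<bar>)) powr \<bar>k\<bar> \<le> B powr \<bar>k\<bar> * max t (1 / t) powr \<epsilon>" if t: "0 < t" for t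
  proof -
    define m where "m = max t (1 / t)"
    have m: "1 \<le> m" and lm: "ln m = \<bar>ln t\<bar>"
    proof -
      show "1 \<le> m" using t by (cases "1 \<le> t") (auto simp: m_def le_max_iff_disj)
      show "ln m = \<bar>ln t\<bar>"
      proof (cases "1 \<le> t")
        case True
        then have "1 / t \<le> 1" using t by simp
        then have "1 / t \<le> t" using True by linarith
        then show ?thesis using True by (simp add: m_def)
      next
        case False
        then have "1 < 1 / t" using t by simp
        then have "m = 1 / t" using False by (auto simp: m_def max_def)
        then show ?thesis using t False by (simp add: ln_div abs_if not_less)
      qed
    qed
    have "\<delta> * ln m = ln (m powr \<delta>)" using m by (simp add: ln_powr)
    also have "\<dots> \<le> m powr \<delta> - 1" using m by (intro ln_le_minus_one) simp
    finally have "ln m \<le> m powr \<delta> / \<delta>" using \<delta> by (simp add: pos_le_divide_eq mult.commute)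
    moreover have "1 \<le> m powr \<delta>" using m \<delta> by (simp add: ge_one_powr_ge_zero)
    ultimately have "1 + \<bar>ln t\<bar> \<le> (1 + 1 / \<delta>) * m powr \<delta>" by (simp add: lm algebra_simps)
    then have "A * (1 + \<bar>ln t\<bar>) \<le> A * ((1 + 1 / \<delta>) * m powr \<delta>)" using A by (rule mult_left_mono)
    then have "(A * (1 + \<bar>ln t\<bar>)) powr \<bar>k\<bar> \<le> (B * m powr \<delta>) powr \<bar>k\<bar>"
      using A by (intro powr_mono2) (auto simp: B_def mult.assoc)
    also have "\<dots> = B powr \<bar>k\<bar> * m powr (\<delta> * \<bar>k\<bar>)" using B m by (simp add: powr_mult powr_powr)
    also have "\<dots> \<le> B powr \<bar>k\<bar> * m powr \<epsilon>" using m \<delta> by (intro mult_left_mono powr_mono) auto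
    finally show ?thesis by (simp add: m_def)
  qed
  then show ?thesis by (intro exI[of _ "B powr \<bar>k\<bar>"]) auto
qed

lemma log_weight_powr_measurable:
  assumes g: "growth_function \<Phi>"
  shows "(\<lambda>y. indicator {0<..} y * log_weight \<Phi> \<epsilon>1 \<epsilon>2 y powr k) \<in> borel_measurable borel"
proof -
  have c: "continuous_on {0<..} \<Phi>"
    using g by (auto simp: growth_function_def intro: continuous_on_subset)
  have "continuous_on {0<..} (\<lambda>y. \<Phi> (1 / y))"
    by (rule continuous_on_compose2[OF c]) (auto intro!: continuous_intros)
  then have m1: "(\<lambda>y. indicator {0<..} y *\<^sub>R \<Phi> (1 / y)) \<in> borel_measurable borel"
    by (intro borel_measurable_continuous_on_indicator) auto
  have m2: "(\<lambda>y. indicator {0<..} y *\<^sub>R \<Phi> y) \<in> borel_measurable borel"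
    using c by (intro borel_measurable_continuous_on_indicator) auto
  have "(\<lambda>y. indicator {0<..} y * (1 + of_nat \<epsilon>1 * max (ln (indicator {0<..} y *\<^sub>R \<Phi> (1 / y))) 0
      + of_nat \<epsilon>2 * max (ln (indicator {0<..} y *\<^sub>R \<Phi> y)) 0) powr k) \<in> borel_measurable borel"
    using m1 m2 by measurable
  also have "(\<lambda>y. indicator {0<..} y * (1 + of_nat \<epsilon>1 * max (ln (indicator {0<..} y *\<^sub>R \<Phi> (1 / y))) 0
      + of_nat \<epsilon>2 * max (ln (indicator {0<..} y *\<^sub>R \<Phi> y)) 0) powr k)
    = (\<lambda>y. indicator {0<..} y * log_weight \<Phi> \<epsilon>1 \<epsilon>2 y powr k)"
    by (auto simp: fun_eq_iff log_weight_def ln_plus_def split: split_indicator)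
  finally show ?thesis .
qed

lemma mixed_space_log_weight:
  assumes "-1 < \<alpha>" "1 < p" "1 < q" and \<Phi>: "\<Phi> \<in> lower_growth \<union> upper_growth"
    and e: "\<epsilon>1 \<in> {0, 1}" "\<epsilon>2 \<in> {0, 1}"
  shows "mixed_space p q \<alpha> (\<lambda>y. log_weight \<Phi> \<epsilon>1 \<epsilon>2 y powr k)"
proof
  define \<omega> where "\<omega> = log_weight \<Phi> \<epsilon>1 \<epsilon>2"
  have w1: "1 \<le> \<omega> y" for y unfolding \<omega>_def by (rule log_weight_ge_1)
  obtain A where A: "1 \<le> A" and slow: "\<And>s t. 0 < s \<Longrightarrow> 0 < t \<Longrightarrow> \<omega> (s * t) \<le> A * (1 + \<bar>ln t\<bar>) * \<omega> s"
    using log_weight_slow[OF \<Phi> e] unfolding \<omega>_def by blast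
  have key: "\<omega> (s * t) powr k \<le> (A * (1 + \<bar>ln t\<bar>)) powr \<bar>k\<bar> * \<omega> s powr k" if st: "0 < s" "0 < t" for s t
  proof (cases "0 \<le> k")
    case True
    have "\<omega> (s * t) powr k \<le> (A * (1 + \<bar>ln t\<bar>) * \<omega> s) powr k"
      using slow[OF st] True w1[of "s * t"] by (intro powr_mono2) auto
    also have "\<dots> = (A * (1 + \<bar>ln t\<bar>)) powr \<bar>k\<bar> * \<omega> s powr k"
      using True A w1[of s] by (simp add: powr_mult)
    finally show ?thesis .
  next
    case False
    have ap: "0 < A * (1 + \<bar>ln t\<bar>)" using A by (intro mult_pos_pos) auto
    \<comment> \<open>For negative \<open>k\<close> a lower bound for
      \<open>\<omega> (s * t)\<close> is needed; it comes from dilating \<open>s * t\<close> back by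
      \<open>1 / t\<close>.\<close>
    have "\<omega> (s * t * (1 / t)) \<le> A * (1 + \<bar>ln (1 / t)\<bar>) * \<omega> (s * t)"
      using st by (intro slow) auto
    then have "\<omega> s \<le> A * (1 + \<bar>ln t\<bar>) * \<omega> (s * t)" using st by (simp add: ln_div)
    then have "(A * (1 + \<bar>ln t\<bar>) * \<omega> (s * t)) powr k \<le> \<omega> s powr k"
      using False w1[of s] by (intro powr_mono2') auto
    then have "(A * (1 + \<bar>ln t\<bar>)) powr k * \<omega> (s * t) powr k \<le> \<omega> s powr k"
      using ap w1[of "s * t"] by (simp add: powr_mult)
    then have "(A * (1 + \<bar>ln t\<bar>)) powr \<bar>k\<bar> * ((A * (1 + \<bar>ln t\<bar>)) powr k * \<omega> (s * t) powr k)
      \<le> (A * (1 + \<bar>ln t\<bar>)) powr \<bar>k\<bar> * \<omega> s powr k"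
      by (rule mult_left_mono) simp
    moreover have "(A * (1 + \<bar>ln t\<bar>)) powr \<bar>k\<bar> * (A * (1 + \<bar>ln t\<bar>)) powr k = 1"
      using less_imp_neq[OF ap] False by (simp only: powr_add[symmetric]) simp
    ultimately show ?thesis by (simp add: mult.assoc[symmetric])
  qed
  fix \<epsilon> :: real assume "0 < \<epsilon>"
  then obtain C where C: "0 \<le> C" "\<And>t. 0 < t \<Longrightarrow> (A * (1 + \<bar>ln t\<bar>)) powr \<bar>k\<bar> \<le> C * max t (1 / t) powr \<epsilon>"
    using log_bound_powr[of \<epsilon> A k] A by auto
  have "\<omega> (s * t) powr k \<le> C * max t (1 / t) powr \<epsilon> * \<omega> s powr k" if "0 < s" "0 < t" for s t
    using key[OF that] mult_right_mono[OF C(2)[OF that(2)], of "\<omega> s powr k"] by simp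
  then show "\<exists>C\<ge>0. \<forall>s>0. \<forall>t>0. log_weight \<Phi> \<epsilon>1 \<epsilon>2 (s * t) powr k
      \<le> C * max t (1 / t) powr \<epsilon> * log_weight \<Phi> \<epsilon>1 \<epsilon>2 s powr k"
    using C(1) unfolding \<omega>_def by blast
next
  fix y :: real
  show "0 < log_weight \<Phi> \<epsilon>1 \<epsilon>2 y powr k" using log_weight_ge_1[of \<Phi> \<epsilon>1 \<epsilon>2 y] by simp
qed (use assms log_weight_powr_measurable[OF growth_doubling(1)[OF \<Phi>]] in auto)

lemma mixed_norm_pow_eq:
  assumes "mixed_space p q \<alpha> (\<lambda>y. \<omega> y powr k)" and f: "f \<in> borel_measurable (bergman_measure \<alpha>)"
  shows "mixed_norm_pow p q \<omega> k \<alpha> f = ennreal_powr (mixed_norm p q \<alpha> (\<lambda>y. \<omega> y powr k) (hnorm f)) q"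
proof -
  interpret mixed_space p q \<alpha> "\<lambda>y. \<omega> y powr k" by fact
  have "ennreal_powr (N (hnorm f)) q = (\<integral>\<^sup>+y\<in>{0<..}. ennreal_powr (\<integral>\<^sup>+x. ennreal_powr (hnorm f (Complex x y)) p \<partial>lborel) (q / p)
        * ennreal (\<omega> y powr k * y powr \<alpha>) \<partial>lborel)"
    by (rule mixed_norm_powr[OF hnorm_measurable[OF f]])
  also have "\<dots> = mixed_norm_pow p q \<omega> k \<alpha> f"
    unfolding mixed_norm_pow_def
    by (intro nn_integral_cong) (auto simp: hnorm_def upper_half_plane_def split: split_indicator)
  finally show ?thesis by simp
qed

subsection \<open>The lattice of the theorem\<close>

text \<open>The lower bound on \<open>\<gamma>\<close> makes it positive. The upper bound says
  \<open>2 powr (4 * \<gamma>) < X\<close>; the cruder \<open>2 powr \<gamma> \<le> X\<close> with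
  \<open>X - 1 \<le> \<delta>\<^sup>2\<close> already shows that the relative cell size is at most
  of order \<open>\<delta>\<^sup>2\<close>.\<close>

lemma admissible_gamma_bounds:
  assumes "0 < \<delta>" "\<delta> < 1" "admissible_gamma \<delta> \<gamma>"
  shows "0 < \<gamma>" "\<delta>\<^sup>2 / 8 + (2 powr \<gamma> - 1) \<le> 2 * \<delta>\<^sup>2"
proof -
  have d2: "0 < \<delta>\<^sup>2" "\<delta>\<^sup>2 < 1" using assms by (auto simp: power_less_one_iff abs_square_less_1)
  have "0 < ln ((1 + \<delta>\<^sup>2 / 20) / (1 - \<delta>\<^sup>2 / 20))" using d2 by (intro ln_gt_zero) (simp add: field_simps)
  then have "0 < ln ((1 + \<delta>\<^sup>2 / 20) / (1 - \<delta>\<^sup>2 / 20)) / (4 * ln 2)" by (intro divide_pos_pos) auto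
  then show g: "0 < \<gamma>" using assms(3) unfolding admissible_gamma_def by linarith
  define X where "X = (1 + \<delta>\<^sup>2 / 4) / (1 - \<delta>\<^sup>2 / 4)"
  have X: "1 \<le> X" using d2 by (simp add: X_def field_simps)
  have "\<gamma> < ln X / (4 * ln 2)" using assms(3) by (simp add: admissible_gamma_def X_def)
  then have "\<gamma> * (4 * ln 2) < ln X" by (simp add: pos_less_divide_eq)
  moreover have "\<gamma> * ln 2 \<le> \<gamma> * (4 * ln 2)" using g by simp
  ultimately have "\<gamma> * ln 2 \<le> ln X" by linarith
  then have "exp (\<gamma> * ln 2) \<le> exp (ln X)" by simp
  then have "2 powr \<gamma> \<le> X" using X by (simp add: powr_def)
  moreover have "X - 1 \<le> \<delta>\<^sup>2"
  proof -
    have "X - 1 = (\<delta>\<^sup>2 / 2) / (1 - \<delta>\<^sup>2 / 4)" using d2 by (simp add: X_def field_simps)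
    also have "\<dots> \<le> (\<delta>\<^sup>2 / 2) / (1 / 2)" using d2 by (intro divide_left_mono) auto
    also have "\<dots> = \<delta>\<^sup>2" by simp
    finally show ?thesis .
  qed
  ultimately show "\<delta>\<^sup>2 / 8 + (2 powr \<gamma> - 1) \<le> 2 * \<delta>\<^sup>2" using d2 by linarith
qed

lemma lattice_translation:
  assumes ms: "lattice_space p q \<alpha> (\<lambda>y. \<omega> y powr k) \<gamma> (\<delta>\<^sup>2 / 8)"
  shows "atom_term \<alpha> \<delta> \<gamma> \<mu> = lattice_space.atom \<alpha> \<gamma> (\<delta>\<^sup>2 / 8) (bergman_const \<alpha>) (\<lambda>(l, j). \<mu> l j)"
    and "coeff_norm_pow p q \<omega> k \<alpha> \<gamma> \<mu>
      = lattice_space.coeff_norm p q \<alpha> (\<lambda>y. \<omega> y powr k) \<gamma> (\<lambda>i. ennreal (norm ((\<lambda>(l, j). \<mu> l j) i)))"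
proof -
  interpret lattice_space p q \<alpha> "\<lambda>y. \<omega> y powr k" \<gamma> "\<delta>\<^sup>2 / 8" by fact
  have sc2: "2 powr (\<gamma> * of_int j * x) = sc j powr x" for j x by (simp add: sc_def powr_powr)
  have pt: "lattice_point \<delta> \<gamma> l j = pt (l, j)" for l j
    by (simp add: lattice_point_def pt_def sc_def powr_diff)
  show "atom_term \<alpha> \<delta> \<gamma> \<mu> = atom (bergman_const \<alpha>) (\<lambda>(l, j). \<mu> l j)"
    by (auto simp: fun_eq_iff atom_term_def atom_def bergman_kernel_def kernel_with_const_def pt sc2)
  show "coeff_norm_pow p q \<omega> k \<alpha> \<gamma> \<mu> = coeff_norm (\<lambda>i. ennreal (norm ((\<lambda>(l, j). \<mu> l j) i)))"
    unfolding coeff_norm_pow_def coeff_norm_def sc2 nn_integral_count_space_infsum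
    by (simp add: sc_def)
qed

lemma sums_in_mixed_bergman_iff:
  assumes ms: "mixed_space p q \<alpha> (\<lambda>y. \<omega> y powr k)"
    and u: "\<And>i. u i holomorphic_on upper_half_plane" "\<And>i. mixed_norm p q \<alpha> (\<lambda>y. \<omega> y powr k) (hnorm (u i)) < top"
    and F: "F holomorphic_on upper_half_plane" "mixed_norm p q \<alpha> (\<lambda>y. \<omega> y powr k) (hnorm F) < top"
    and lim: "((\<lambda>S. mixed_norm p q \<alpha> (\<lambda>y. \<omega> y powr k) (hnorm (\<lambda>z. F z - (\<Sum>i\<in>S. u i z)))) \<longlongrightarrow> 0) (finite_subsets_at_top UNIV)"
  shows "sums_in_mixed_bergman p q \<omega> k \<alpha> u UNIV F"
proof -
  interpret mixed_space p q \<alpha> "\<lambda>y. \<omega> y powr k" by fact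
  note eq = mixed_norm_pow_eq[OF ms holomorphic_bergman_measurable]
  have "mixed_norm_pow p q \<omega> k \<alpha> (\<lambda>z. F z - (\<Sum>i\<in>S. u i z)) = ennreal_powr (N (hnorm (\<lambda>z. F z - (\<Sum>i\<in>S. u i z)))) q" for S
    by (intro eq holomorphic_intros F u)
  moreover have "((\<lambda>S. ennreal_powr (N (hnorm (\<lambda>z. F z - (\<Sum>i\<in>S. u i z)))) q) \<longlongrightarrow> 0) (finite_subsets_at_top UNIV)"
    using q by (intro tendsto_ennreal_powr_0 lim) auto
  ultimately show ?thesis
    using u F by (auto simp: sums_in_mixed_bergman_def mixed_bergman_def eq)
qed

theorem theorem7:
  fixes \<alpha> p q k :: real and \<Phi> \<omega> :: "real \<Rightarrow> real" and \<epsilon>1 \<epsilon>2 :: nat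
  assumes "\<alpha> > -1" and "1 < p" and "1 < q"
    and "\<Phi> \<in> lower_growth \<union> upper_growth"
    and "\<epsilon>1 \<in> {0, 1}" and "\<epsilon>2 \<in> {0, 1}"
    and "\<omega> = log_weight \<Phi> \<epsilon>1 \<epsilon>2"
  shows
    "(\<forall>\<delta> \<gamma>. 0 < \<delta> \<and> \<delta> < 1 \<and> admissible_gamma \<delta> \<gamma> \<longrightarrow>
        (\<exists>C::real. \<forall>\<mu> :: int \<Rightarrow> int \<Rightarrow> complex.
           coeff_norm_pow p q \<omega> k \<alpha> \<gamma> \<mu> < \<infinity> \<longrightarrow>
           (\<exists>F. sums_in_mixed_bergman p q \<omega> k \<alpha> (atom_term \<alpha> \<delta> \<gamma> \<mu>) UNIV F \<and>
                mixed_norm_pow p q \<omega> k \<alpha> F \<le> ennreal C * coeff_norm_pow p q \<omega> k \<alpha> \<gamma> \<mu>)))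
   \<and> (\<exists>\<delta>0. 0 < \<delta>0 \<and> \<delta>0 < 1 \<and>
        (\<forall>\<delta> \<gamma>. 0 < \<delta> \<and> \<delta> < \<delta>0 \<and> admissible_gamma \<delta> \<gamma> \<longrightarrow>
          (\<exists>C::real. \<forall>F \<in> mixed_bergman p q \<omega> k \<alpha>.
             \<exists>\<mu> :: int \<Rightarrow> int \<Rightarrow> complex.
               sums_in_mixed_bergman p q \<omega> k \<alpha> (atom_term \<alpha> \<delta> \<gamma> \<mu>) UNIV F \<and>
               (\<forall>z \<in> upper_half_plane. ((\<lambda>i. atom_term \<alpha> \<delta> \<gamma> \<mu> i z) has_sum F z) UNIV) \<and>
               coeff_norm_pow p q \<omega> k \<alpha> \<gamma> \<mu> \<le> ennreal C * mixed_norm_pow p q \<omega> k \<alpha> F)))"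
proof -
  have ms: "mixed_space p q \<alpha> (\<lambda>y. \<omega> y powr k)"
    unfolding assms(7) using assms(1-6) by (intro mixed_space_log_weight)
  interpret MS: mixed_space p q \<alpha> "\<lambda>y. \<omega> y powr k" by fact
  note eq = mixed_norm_pow_eq[OF ms holomorphic_bergman_measurable]
  have ls: "lattice_space p q \<alpha> (\<lambda>y. \<omega> y powr k) \<gamma> (\<delta>\<^sup>2 / 8)"
    if "0 < \<delta>" "\<delta> < 1" "admissible_gamma \<delta> \<gamma>" for \<delta> \<gamma>
    using ms admissible_gamma_bounds(1)[OF that] that(1)
    by (intro lattice_space.intro lattice_space_axioms.intro) auto
  \<comment> \<open>Serves both parts: the first assertion takes the pointwise sum for
    \<open>F\<close>, the second applies the estimate to the given function.\<close>
  have synth: "\<exists>C::real. \<forall>\<mu>. coeff_norm_pow p q \<omega> k \<alpha> \<gamma> \<mu> < top \<longrightarrow>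
      (\<exists>F. \<forall>z\<in>upper_half_plane. ((\<lambda>i. atom_term \<alpha> \<delta> \<gamma> \<mu> i z) has_sum F z) UNIV) \<and>
      (\<forall>F. (\<forall>z\<in>upper_half_plane. ((\<lambda>i. atom_term \<alpha> \<delta> \<gamma> \<mu> i z) has_sum F z) UNIV) \<longrightarrow>
        sums_in_mixed_bergman p q \<omega> k \<alpha> (atom_term \<alpha> \<delta> \<gamma> \<mu>) UNIV F \<and>
        mixed_norm_pow p q \<omega> k \<alpha> F \<le> ennreal C * coeff_norm_pow p q \<omega> k \<alpha> \<gamma> \<mu>)"
    if "0 < \<delta>" "\<delta> < 1" "admissible_gamma \<delta> \<gamma>" for \<delta> \<gamma>
  proof -
    interpret L: lattice_space p q \<alpha> "\<lambda>y. \<omega> y powr k" \<gamma> "\<delta>\<^sup>2 / 8" by (rule ls[OF that])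
    define c where "c = bergman_const \<alpha>"
    obtain C :: real where C: "\<forall>\<mu>. L.coeff_norm (\<lambda>i. ennreal (norm (\<mu> i))) < top \<longrightarrow>
      (\<forall>F. (\<forall>z\<in>upper_half_plane. ((\<lambda>i. L.atom c \<mu> i z) has_sum F z) UNIV) \<longrightarrow>
        F holomorphic_on upper_half_plane \<and> MS.N (hnorm F) < top \<and>
        ennreal_powr (MS.N (hnorm F)) q \<le> ennreal C * L.coeff_norm (\<lambda>i. ennreal (norm (\<mu> i))) \<and>
        (\<forall>i. MS.N (hnorm (L.atom c \<mu> i)) < top) \<and>
        ((\<lambda>S. MS.N (hnorm (\<lambda>z. F z - (\<Sum>i\<in>S. L.atom c \<mu> i z)))) \<longlongrightarrow> 0) (finite_subsets_at_top UNIV))"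
      by (rule exE[OF L.synthesis[of c]])
    show ?thesis
    proof (intro exI[of _ C] allI impI conjI)
      fix \<mu> :: "int \<Rightarrow> int \<Rightarrow> complex"
      define \<nu> where "\<nu> = (\<lambda>(l, j). \<mu> l j)"
      note tr = lattice_translation[OF ls[OF that], of \<mu>, folded \<nu>_def c_def]
      assume "coeff_norm_pow p q \<omega> k \<alpha> \<gamma> \<mu> < top"
      then have fin: "L.coeff_norm (\<lambda>i. ennreal (norm (\<nu> i))) < top" by (simp only: tr)
      show "\<exists>F. \<forall>z\<in>upper_half_plane. ((\<lambda>i. atom_term \<alpha> \<delta> \<gamma> \<mu> i z) has_sum F z) UNIV"
      proof (intro exI ballI)
        fix z assume z: "z \<in> upper_half_plane"
        show "((\<lambda>i. atom_term \<alpha> \<delta> \<gamma> \<mu> i z) has_sum (\<Sum>\<^sub>\<infinity>i\<in>UNIV. atom_term \<alpha> \<delta> \<gamma> \<mu> i z)) UNIV"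
          unfolding tr
          by (rule has_sum_infsum[OF abs_summable_summable[OF L.atom_series(1)[OF L.N_step_finite[OF fin] z]]])
      qed
      fix F assume F: "\<forall>z\<in>upper_half_plane. ((\<lambda>i. atom_term \<alpha> \<delta> \<gamma> \<mu> i z) has_sum F z) UNIV"
      note CF = mp[OF spec[OF mp[OF spec[OF C] fin]] F[unfolded tr]]
      show "sums_in_mixed_bergman p q \<omega> k \<alpha> (atom_term \<alpha> \<delta> \<gamma> \<mu>) UNIV F"
        unfolding tr using CF by (intro sums_in_mixed_bergman_iff[OF ms] L.atom_holomorphic) auto
      show "mixed_norm_pow p q \<omega> k \<alpha> F \<le> ennreal C * coeff_norm_pow p q \<omega> k \<alpha> \<gamma> \<mu>"
        unfolding tr using CF by (simp add: eq)
    qed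
  qed
  show ?thesis
  proof (intro conjI allI impI)
    fix \<delta> \<gamma> :: real assume "0 < \<delta> \<and> \<delta> < 1 \<and> admissible_gamma \<delta> \<gamma>"
    then show "\<exists>C::real. \<forall>\<mu> :: int \<Rightarrow> int \<Rightarrow> complex.
           coeff_norm_pow p q \<omega> k \<alpha> \<gamma> \<mu> < \<infinity> \<longrightarrow>
           (\<exists>F. sums_in_mixed_bergman p q \<omega> k \<alpha> (atom_term \<alpha> \<delta> \<gamma> \<mu>) UNIV F \<and>
                mixed_norm_pow p q \<omega> k \<alpha> F \<le> ennreal C * coeff_norm_pow p q \<omega> k \<alpha> \<gamma> \<mu>)"
      using synth[of \<delta> \<gamma>] unfolding infinity_ennreal_def by meson
  next
    define c where "c = reproducing_const \<alpha>"
    obtain K :: real where K: "0 < K" "\<And>f. f \<in> borel_measurable borel \<Longrightarrow> MS.N (PP \<alpha> f) \<le> ennreal K * MS.N f"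
      using MS.PP_bounded by blast
    \<comment> \<open>Makes \<open>norm c * \<epsilon> * K \<le> 1 / 2\<close>, the contraction
      condition of \<open>analysis\<close>; the \<open>+ 1\<close> keeps the denominator
      positive.\<close>
    define \<epsilon> where "\<epsilon> = 1 / (2 * (norm c * K + 1))"
    have \<epsilon>: "0 < \<epsilon>" "norm c * \<epsilon> * K \<le> 1 / 2"
    proof -
      have "0 \<le> norm c * K" using K by simp
      then show "0 < \<epsilon>" "norm c * \<epsilon> * K \<le> 1 / 2" by (auto simp: \<epsilon>_def field_simps)
    qed
    obtain \<theta> where \<theta>: "0 < \<theta>"
      and pert: "\<forall>\<xi>\<in>upper_half_plane. \<forall>\<xi>'\<in>upper_half_plane. norm (\<xi> - \<xi>') \<le> \<theta> * norm \<xi> \<longrightarrow>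
      norm (1 / \<xi> powr of_real (2 + \<alpha>) - 1 / \<xi>' powr of_real (2 + \<alpha>)) \<le> \<epsilon> / norm \<xi> powr (2 + \<alpha>)"
      using kernel_perturbation[OF \<epsilon>(1), of \<alpha>] by blast
    \<comment> \<open>Below this bound
      \<open>\<eta> \<le> 2 * \<delta>\<^sup>2 \<le> \<theta>\<close>, which is the mesh condition
      of \<open>analysis\<close>.\<close>
    define \<delta>0 where "\<delta>0 = min (1 / 2) (sqrt (\<theta> / 2))"
    have d0: "0 < \<delta>0" "\<delta>0 < 1" using \<theta> by (auto simp: \<delta>0_def)
    have "\<exists>C::real. \<forall>F \<in> mixed_bergman p q \<omega> k \<alpha>.
             \<exists>\<mu> :: int \<Rightarrow> int \<Rightarrow> complex.
               sums_in_mixed_bergman p q \<omega> k \<alpha> (atom_term \<alpha> \<delta> \<gamma> \<mu>) UNIV F \<and>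
               (\<forall>z \<in> upper_half_plane. ((\<lambda>i. atom_term \<alpha> \<delta> \<gamma> \<mu> i z) has_sum F z) UNIV) \<and>
               coeff_norm_pow p q \<omega> k \<alpha> \<gamma> \<mu> \<le> ennreal C * mixed_norm_pow p q \<omega> k \<alpha> F"
      if h: "0 < \<delta> \<and> \<delta> < \<delta>0 \<and> admissible_gamma \<delta> \<gamma>" for \<delta> \<gamma>
    proof -
      have adm: "0 < \<delta>" "\<delta> < 1" "admissible_gamma \<delta> \<gamma>" using h d0 by auto
      interpret L: lattice_space p q \<alpha> "\<lambda>y. \<omega> y powr k" \<gamma> "\<delta>\<^sup>2 / 8" by (rule ls[OF adm])
      have "\<delta>\<^sup>2 \<le> (sqrt (\<theta> / 2))\<^sup>2" using h by (intro power_mono) (auto simp: \<delta>0_def)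
      then have "2 * \<delta>\<^sup>2 \<le> \<theta>" using \<theta> by simp
      then have eta: "L.\<eta> \<le> \<theta>" using admissible_gamma_bounds(2)[OF adm] by (simp add: L.\<eta>_def)
      obtain a :: real where a: "0 < a" "\<And>x. ennreal a * L.coeff_norm x \<le> ennreal_powr (MS.N (L.step x)) q"
        using L.step_norm by blast
      define B where "B = 2 * L.cell_const * K"
      have B: "0 \<le> B" using K by (simp add: B_def L.cell_const_def)
      show ?thesis
      \<comment> \<open>\<open>B\<close> is the norm bound from \<open>analysis\<close>, raised to
        the power \<open>q\<close>; \<open>a\<close> is the lower constant of
        \<open>step_norm\<close>, which converts the norm of the step function into the coefficient
        norm.\<close>
      proof (intro exI[of _ "B powr q / a"] ballI)
        fix F assume "F \<in> mixed_bergman p q \<omega> k \<alpha>"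
        then have F: "F holomorphic_on upper_half_plane" and NF: "MS.N (hnorm F) < top"
          by (auto simp: mixed_bergman_def eq)
        obtain \<nu> where \<nu>: "MS.N (L.step (\<lambda>i. ennreal (norm (\<nu> i)))) \<le> ennreal B * MS.N (hnorm F)"
          "\<forall>z\<in>upper_half_plane. ((\<lambda>i. L.atom c \<nu> i z) has_sum F z) UNIV"
          using L.analysis[OF K(2) less_imp_le[OF K(1)] \<epsilon>(1) \<epsilon>(2)[unfolded c_def] pert eta F NF]
          unfolding B_def c_def by blast
        define \<mu> where "\<mu> l j = \<nu> (l, j)" for l j
        have mu: "(\<lambda>(l, j). \<mu> l j) = \<nu>" by (auto simp: \<mu>_def)
        note tr = lattice_translation[OF ls[OF adm], of \<mu>, unfolded mu bergman_const_eq[OF assms(1)], folded c_def]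
        have hs: "\<forall>z \<in> upper_half_plane. ((\<lambda>i. atom_term \<alpha> \<delta> \<gamma> \<mu> i z) has_sum F z) UNIV"
          unfolding tr by (rule \<nu>(2))
        have "ennreal a * L.coeff_norm (\<lambda>i. ennreal (norm (\<nu> i))) \<le> ennreal_powr (MS.N (L.step (\<lambda>i. ennreal (norm (\<nu> i))))) q"
          by (rule a(2))
        also have "\<dots> \<le> ennreal_powr (ennreal B * MS.N (hnorm F)) q"
          using \<nu>(1) assms(3) by (intro ennreal_powr_mono) auto
        also have "\<dots> = ennreal (B powr q) * mixed_norm_pow p q \<omega> k \<alpha> F"
          using B by (simp add: ennreal_powr_mult eq[OF F])
        finally have "ennreal (1 / a) * (ennreal a * L.coeff_norm (\<lambda>i. ennreal (norm (\<nu> i))))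
            \<le> ennreal (1 / a) * (ennreal (B powr q) * mixed_norm_pow p q \<omega> k \<alpha> F)"
          by (rule mult_left_mono) simp
        then have le: "coeff_norm_pow p q \<omega> k \<alpha> \<gamma> \<mu> \<le> ennreal (B powr q / a) * mixed_norm_pow p q \<omega> k \<alpha> F"
          unfolding tr using a(1) by (simp add: mult.assoc[symmetric] ennreal_mult[symmetric])
        also have "\<dots> < top" using NF F by (simp add: eq ennreal_mult_less_top)
        finally have "coeff_norm_pow p q \<omega> k \<alpha> \<gamma> \<mu> < top" .
        then have "sums_in_mixed_bergman p q \<omega> k \<alpha> (atom_term \<alpha> \<delta> \<gamma> \<mu>) UNIV F"
          using synth[OF adm] hs by blast
        then show "\<exists>\<mu>. sums_in_mixed_bergman p q \<omega> k \<alpha> (atom_term \<alpha> \<delta> \<gamma> \<mu>) UNIV F \<and>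
               (\<forall>z \<in> upper_half_plane. ((\<lambda>i. atom_term \<alpha> \<delta> \<gamma> \<mu> i z) has_sum F z) UNIV) \<and>
               coeff_norm_pow p q \<omega> k \<alpha> \<gamma> \<mu> \<le> ennreal (B powr q / a) * mixed_norm_pow p q \<omega> k \<alpha> F"
          using hs le by blast
      qed
    qed
    then show "\<exists>\<delta>0. 0 < \<delta>0 \<and> \<delta>0 < 1 \<and>
        (\<forall>\<delta> \<gamma>. 0 < \<delta> \<and> \<delta> < \<delta>0 \<and> admissible_gamma \<delta> \<gamma> \<longrightarrow>
          (\<exists>C::real. \<forall>F \<in> mixed_bergman p q \<omega> k \<alpha>.
             \<exists>\<mu> :: int \<Rightarrow> int \<Rightarrow> complex.
               sums_in_mixed_bergman p q \<omega> k \<alpha> (atom_term \<alpha> \<delta> \<gamma> \<mu>) UNIV F \<and>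
               (\<forall>z \<in> upper_half_plane. ((\<lambda>i. atom_term \<alpha> \<delta> \<gamma> \<mu> i z) has_sum F z) UNIV) \<and>
               coeff_norm_pow p q \<omega> k \<alpha> \<gamma> \<mu> \<le> ennreal C * mixed_norm_pow p q \<omega> k \<alpha> F))"
      using d0 by blast
  qed
qed

end
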